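(* Let $S$ be the critical exponent of the Boyd/Mallows packing. Let $\kappa>0$ and let $m\ge 0$ be an integer, and consider the functions $f_m(\kappa;0,1,1;t)$ and $g_m(\kappa;0,1,1;t)$ for $t>\frac12$. Let $\mu_m(\kappa)$ and $\lambda_m(\kappa)$ satisfy $f_m(\kappa;0,1,1;\mu_m(\kappa))=1$ and $g_m(\kappa;0,1,1;\lambda_m(\kappa))=1$. Then $$\lambda_m(\kappa)\le S\le\mu_m(\kappa).$$ Moreover, if $1<\kappa\le(3+2\sqrt2)^{m+1}$, then $$0<\mu_m(\kappa)-\lambda_m(\kappa)<\frac{2.3}{\log\kappa}.$$
   Context: Circle coordinates. To an open disk in $\mathbb{R}^2$ with center $(x,y)$, radius $r$ and curvature $k=1/r$ associate $(k,kx,ky,k(x^2+y^2)-1/k)\in\mathbb{R}^4$; to the open half-plane $\{p: p\cdot u>h\}$ ($u$ a unit vector) associate $(0,u_1,u_2,2h)$. Boyd/Mallows packing. On $\mathbb{R}^4$ with standard basis $\vec e_1,\dots,\vec e_4$ let $\vec x\circ\vec y=\vec x^{\,t}J\vec y$ with $$J=-\begin{pmatrix}-1&3&1&1\\3&-1&1&1\\1&1&-1&1\\1&1&1&-1\end{pmatrix},\qquad R_{\vec n}(\vec x)=\vec x-2\frac{\vec x\circ\vec n}{\vec n\circ\vec n}\vec n.$$ Let $\Gamma=\langle R_{\vec n_1},\dots,R_{\vec n_5}\rangle$ with $\vec n_1=(-1,1,2,2)$, $\vec n_2=(1,-1,2,2)$, $\vec n_3=(1,1,-2,0)$, $\vec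 n_4=(3,1,2,-2)$, $\vec n_5=(1,3,2,-2)$. The packing, denoted $\mathcal P$, is the set of disks represented by the vectors in the $\Gamma$-orbit of $\{\vec e_1,\vec e_2,\vec e_3,\vec e_4,\vec e_1+\vec e_2-\vec e_4\}$, where $\vec e_1,\vec e_2$ represent the disks of radius $1/2$ centered at $(0,0)$, $(\sqrt2,0)$, $\vec e_3$ the half-plane $y>1/2$, $\vec e_4$ the half-plane $y<-1/2$, and $\sum v_i\vec e_i$ represents the disk with circle coordinates $\sum v_i\cdot(\text{coordinates of }\vec e_i)$. Packing in a triangle. For $0\le a\le b\le c$, $b>0$, $T(a,b,c)$ is the bounded curvilinear triangle between three mutually externally tangent circles $A,B,C$ of curvatures $a,b,c$ (a line if $a=0$). The Boyd/Mallows packing within $T(a,b,c)$ consists of the disks contained in $T(a,b,c)$ of the image of the packing $\mathcal P$ under a Möbius transformation taking the mutually tangent disks of $\vec e_1,\vec e_3,\vec e_4$ to the disks bounded by $A,B,C$. With $\{r_n\}$ the radii of these disks, the critical exponent is $S=\inf\{t:\sum_n r_n^t<\infty\}$; it does not depend on $(a,b,c)$ (one may take $(0,1,1)$). Necklace curvatures. For $0\le a\le b\le c$, $b>0$, $d=\sqrt{ab+ac+bc}$ and $n\ge1$ put $$c_n=c+2n^2(a+b)+n\sqrt8\,d,\quad b_n=b+2n^2(a+c)+n\sqrt8\,d,\quad a_n=a+2n^2(b+c)+n\sqrt8\,d,$$ and, with $N=4(n^2+n)$ and $D=(2n+1)\sqrt8\,d$, $$c_{n,r}=a+2b+2c+N(a+b)+D,\qquad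 c_{n,l}=2a+b+2c+N(a+b)+D,$$ $$b_{n,l}=a+2b+2c+N(a+c)+D,\qquad b_{n,r}=2a+2b+c+N(a+c)+D,$$ $$a_{n,r}=2a+b+2c+N(b+c)+D,\qquad a_{n,l}=2a+2b+c+N(b+c)+D.$$ Define the list (multiset, counted with multiplicity) of triples $\tau(a,b,c)$ consisting of $(a,c_1,b_1)$, $(b,c_1,a_1)$, $(c,b_1,a_1)$, $(c_1,b_1,a_1)$ and, for every $n\ge1$, $(b,a_n,a_{n,l})$, $(b,a_{n+1},a_{n,l})$, $(a_n,a_{n,l},a_{n,r})$, $(a_{n+1},a_{n,l},a_{n,r})$, $(c,a_n,a_{n,r})$, $(c,a_{n+1},a_{n,r})$, $(c,b_n,b_{n,l})$, $(c,b_{n+1},b_{n,l})$, $(b_n,b_{n,r},b_{n,l})$, $(b_{n+1},b_{n,r},b_{n,l})$, $(a,b_n,b_{n,r})$, $(a,b_{n+1},b_{n,r})$, $(a,c_n,c_{n,l})$, $(a,c_{n+1},c_{n,l})$, $(c_n,c_{n,l},c_{n,r})$, $(c_{n+1},c_{n,l},c_{n,r})$, $(b,c_n,c_{n,r})$, $(b,c_{n+1},c_{n,r})$. Each triple $(x,y,z)$ in the list satisfies $0\le x\le y\le z$, $y>0$. For a list $l$ of such triples, $\mathscr S(\kappa;l)$ is obtained from $l$ by removing every $(x,y,z)\in l$ with $y<\kappa$ and adjoining in its place all triples of $\tau(x,y,z)$. Let $\mathscr S^0(\kappa;l)=l$ and $\mathscr S^{m}(\kappa;l)=\mathscr S(\kappa;\mathscr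 S^{m-1}(\kappa;l))$. For $m\ge0$ define $$f_m(\kappa;a,b,c;t)=\sum_{(x,y,z)\in\mathscr S^m(\kappa;\tau(a,b,c))}\tfrac12\big((x+y)^{-t}+z^{-t}\big),$$ $$g_m(\kappa;a,b,c;t)=\sum_{(x,y,z)\in\mathscr S^m(\kappa;\tau(a,b,c))}\Big(x+\frac{y+z}{2}\Big)^{-t}.$$ $\log$ is the natural logarithm. *)

theory Defs
  imports "HOL-Analysis.Analysis" "HOL-Algebra.Bij" "HOL-Algebra.Generated_Groups"
begin

subsection \<open>Disks, half-planes and circle coordinates\<close>

text \<open>The plane is \<^typ>\<open>complex\<close>, with inner product \<open>z \<bullet> w = Re z * Re w + Im z * Im w\<close>.\<close>

definition half_plane :: "complex \<Rightarrow> real \<Rightarrow> complex set" where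
  "half_plane u h = {p. p \<bullet> u > h}"

definition disk_coords :: "complex \<Rightarrow> real \<Rightarrow> real^4" where
  "disk_coords p r = (let k = 1 / r in
     vector [k, k * Re p, k * Im p, k * ((Re p)^2 + (Im p)^2) - 1 / k])"

definition half_plane_coords :: "complex \<Rightarrow> real \<Rightarrow> real^4" where
  "half_plane_coords u h = vector [0, Re u, Im u, 2 * h]"

inductive has_circle_coords :: "complex set \<Rightarrow> real^4 \<Rightarrow> bool" where
  disk: "r > 0 \<Longrightarrow> has_circle_coords (ball p r) (disk_coords p r)"
| half_plane: "norm u = 1 \<Longrightarrow> has_circle_coords (half_plane u h) (half_plane_coords u h)"

text \<open>The first circle coordinate is the curvature (\<open>0\<close> for a half-plane).\<close>

definition has_curvature :: "complex set \<Rightarrow> real \<Rightarrow> bool" where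
  "has_curvature D k \<longleftrightarrow> (\<exists>w. has_circle_coords D w \<and> w $ 1 = k)"


lemma vector_4 [simp]:
  "(vector [w, x, y, z] :: ('a::zero)^4) $ 1 = w"
  "(vector [w, x, y, z] :: ('a::zero)^4) $ 2 = x"
  "(vector [w, x, y, z] :: ('a::zero)^4) $ 3 = y"
  "(vector [w, x, y, z] :: ('a::zero)^4) $ 4 = z"
  by (simp_all add: vector_def)


subsection \<open>The Boyd/Mallows packing\<close>

definition J_mat :: "real^4^4" where
  "J_mat = - vector [vector [-1, 3, 1, 1],
                     vector [3, -1, 1, 1],
                     vector [1, 1, -1, 1],
                     vector [1, 1, 1, -1]]"

definition J_form :: "real^4 \<Rightarrow> real^4 \<Rightarrow> real" where
  "J_form x y = x \<bullet> (J_mat *v y)"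

definition J_refl :: "real^4 \<Rightarrow> real^4 \<Rightarrow> real^4" where
  "J_refl n x = x - (2 * (J_form x n / J_form n n)) *\<^sub>R n"

definition BM_normals :: "(real^4) set" where
  "BM_normals = {vector [-1, 1, 2, 2], vector [1, -1, 2, 2], vector [1, 1, -2, 0],
                 vector [3, 1, 2, -2], vector [1, 3, 2, -2]}"

definition BM_group :: "(real^4 \<Rightarrow> real^4) set" where
  "BM_group = generate (BijGroup UNIV) (J_refl ` BM_normals)"

definition BM_seeds :: "(real^4) set" where
  "BM_seeds = {axis 1 1, axis 2 1, axis 3 1, axis 4 1, axis 1 1 + axis 2 1 - axis 4 1}"

text \<open>The \<open>i\<close>-th row holds the circle coordinates of the disk represented by \<open>axis i 1\<close>.\<close>

definition BM_basis :: "real^4^4" where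
  "BM_basis = vector [disk_coords 0 (1/2), disk_coords (Complex (sqrt 2) 0) (1/2),
                      half_plane_coords \<i> (1/2), half_plane_coords (- \<i>) (1/2)]"

definition represents :: "real^4 \<Rightarrow> complex set \<Rightarrow> bool" where
  "represents v D \<longleftrightarrow> has_circle_coords D (\<Sum>i\<in>UNIV. (v $ i) *\<^sub>R (BM_basis $ i))"

definition BM_packing :: "complex set set" where
  "BM_packing = {D. \<exists>g\<in>BM_group. \<exists>v\<in>BM_seeds. represents (g v) D}"


subsection \<open>Moebius transformations of the extended plane\<close>

text \<open>The extended plane is \<^typ>\<open>complex option\<close>, with \<^const>\<open>None\<close> as the point at infinity.\<close>

fun moebius :: "complex \<Rightarrow> complex \<Rightarrow> complex \<Rightarrow> complex \<Rightarrow> complex option \<Rightarrow> complex option" where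
  "moebius p q r s None = (if r = 0 then None else Some (p / r))"
| "moebius p q r s (Some z) =
     (if r * z + s = 0 then None else Some ((p * z + q) / (r * z + s)))"

definition is_moebius :: "(complex option \<Rightarrow> complex option) \<Rightarrow> bool" where
  "is_moebius M \<longleftrightarrow> (\<exists>p q r s. p * s - q * r \<noteq> 0 \<and> M = moebius p q r s)"

definition maps_onto :: "(complex option \<Rightarrow> complex option) \<Rightarrow> complex set \<Rightarrow> complex set \<Rightarrow> bool" where
  "maps_onto M D E \<longleftrightarrow> M ` Some ` D = Some ` E"


subsection \<open>The packing within a curvilinear triangle, and the critical exponent\<close>

definition externally_tangent :: "complex set \<Rightarrow> complex set \<Rightarrow> bool" where
  "externally_tangent D E \<longleftrightarrow> D \<inter> E = {} \<and> (\<exists>p. closure D \<inter> closure E = {p})"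

text \<open>\<open>A\<close>, \<open>B\<close>, \<open>C\<close> are the open disks bounded by the three circles (a half-plane for
  curvature \<open>0\<close>).  The bounded curvilinear triangle between the circles is
  \<^const>\<open>inside\<close> of the union of the closed disks: the bounded part of its complement.\<close>

definition tangent_triple :: "real \<Rightarrow> real \<Rightarrow> real \<Rightarrow> complex set \<Rightarrow> complex set \<Rightarrow> complex set \<Rightarrow> bool" where
  "tangent_triple a b c A B C \<longleftrightarrow>
     has_curvature A a \<and> has_curvature B b \<and> has_curvature C c \<and>
     externally_tangent A B \<and> externally_tangent B C \<and> externally_tangent A C"

definition curvilinear_triangle :: "complex set \<Rightarrow> complex set \<Rightarrow> complex set \<Rightarrow> complex set" where
  "curvilinear_triangle A B C = inside (closure A \<union> closure B \<union> closure C)"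

text \<open>\<open>Q\<close> is the Boyd/Mallows packing within a triangle \<open>T(a,b,c)\<close>, for some position of the
  triangle in the plane.  A disk of the packing whose image contains the point at infinity has
  no counterpart \<open>E\<close> below; it does not lie in the (bounded) triangle anyway.\<close>

definition BM_packing_within :: "real \<Rightarrow> real \<Rightarrow> real \<Rightarrow> complex set set \<Rightarrow> bool" where
  "BM_packing_within a b c Q \<longleftrightarrow>
     (\<exists>A B C M D1 D3 D4. tangent_triple a b c A B C \<and> is_moebius M \<and>
        represents (axis 1 1) D1 \<and> represents (axis 3 1) D3 \<and> represents (axis 4 1) D4 \<and>
        maps_onto M D1 A \<and> maps_onto M D3 B \<and> maps_onto M D4 C \<and>
        Q = {E. (\<exists>D\<in>BM_packing. maps_onto M D E) \<and> E \<subseteq> curvilinear_triangle A B C})"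

text \<open>The disks of a packing are enumerated by their (center, radius) pairs.\<close>

definition critical_exponent :: "complex set set \<Rightarrow> real" where
  "critical_exponent Q =
     Inf {t. (\<lambda>(p, r). r powr t) summable_on {(p, r). r > 0 \<and> ball p r \<in> Q}}"


subsection \<open>Necklace curvatures\<close>

definition neck_d :: "real \<Rightarrow> real \<Rightarrow> real \<Rightarrow> real" where
  "neck_d a b c = sqrt (a * b + a * c + b * c)"

definition neck_a :: "real \<Rightarrow> real \<Rightarrow> real \<Rightarrow> nat \<Rightarrow> real" where
  "neck_a a b c n = a + 2 * real n ^ 2 * (b + c) + real n * sqrt 8 * neck_d a b c"

definition neck_b :: "real \<Rightarrow> real \<Rightarrow> real \<Rightarrow> nat \<Rightarrow> real" where
  "neck_b a b c n = b + 2 * real n ^ 2 * (a + c) + real n * sqrt 8 * neck_d a b c"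

definition neck_c :: "real \<Rightarrow> real \<Rightarrow> real \<Rightarrow> nat \<Rightarrow> real" where
  "neck_c a b c n = c + 2 * real n ^ 2 * (a + b) + real n * sqrt 8 * neck_d a b c"

definition neck_N :: "nat \<Rightarrow> real" where
  "neck_N n = 4 * (real n ^ 2 + real n)"

definition neck_D :: "real \<Rightarrow> real \<Rightarrow> real \<Rightarrow> nat \<Rightarrow> real" where
  "neck_D a b c n = (2 * real n + 1) * sqrt 8 * neck_d a b c"

definition neck_cr :: "real \<Rightarrow> real \<Rightarrow> real \<Rightarrow> nat \<Rightarrow> real" where
  "neck_cr a b c n = a + 2 * b + 2 * c + neck_N n * (a + b) + neck_D a b c n"

definition neck_cl :: "real \<Rightarrow> real \<Rightarrow> real \<Rightarrow> nat \<Rightarrow> real" where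
  "neck_cl a b c n = 2 * a + b + 2 * c + neck_N n * (a + b) + neck_D a b c n"

definition neck_bl :: "real \<Rightarrow> real \<Rightarrow> real \<Rightarrow> nat \<Rightarrow> real" where
  "neck_bl a b c n = a + 2 * b + 2 * c + neck_N n * (a + c) + neck_D a b c n"

definition neck_br :: "real \<Rightarrow> real \<Rightarrow> real \<Rightarrow> nat \<Rightarrow> real" where
  "neck_br a b c n = 2 * a + 2 * b + c + neck_N n * (a + c) + neck_D a b c n"

definition neck_ar :: "real \<Rightarrow> real \<Rightarrow> real \<Rightarrow> nat \<Rightarrow> real" where
  "neck_ar a b c n = 2 * a + b + 2 * c + neck_N n * (b + c) + neck_D a b c n"

definition neck_al :: "real \<Rightarrow> real \<Rightarrow> real \<Rightarrow> nat \<Rightarrow> real" where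
  "neck_al a b c n = 2 * a + 2 * b + c + neck_N n * (b + c) + neck_D a b c n"


subsection \<open>Lists of triples and the functions \<open>f\<close> and \<open>g\<close>\<close>

type_synonym triple = "real \<times> real \<times> real"

text \<open>\<open>tau_block (a,b,c) 0\<close> holds the four exceptional triples of the list \<open>\<tau>(a,b,c)\<close>, and
  \<open>tau_block (a,b,c) n\<close>, for \<open>n \<ge> 1\<close>, the eighteen triples belonging to \<open>n\<close>.\<close>

definition tau_block :: "triple \<Rightarrow> nat \<Rightarrow> triple list" where
  "tau_block = (\<lambda>(a, b, c) n.
      let
        an = neck_a a b c n; an' = neck_a a b c (n + 1);
        bn = neck_b a b c n; bn' = neck_b a b c (n + 1);
        cn = neck_c a b c n; cn' = neck_c a b c (n + 1);
        al = neck_al a b c n; ar = neck_ar a b c n;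
        bl = neck_bl a b c n; br = neck_br a b c n;
        cl = neck_cl a b c n; cr = neck_cr a b c n;
        a1 = neck_a a b c 1; b1 = neck_b a b c 1; c1 = neck_c a b c 1
      in
        if n = 0 then [(a, c1, b1), (b, c1, a1), (c, b1, a1), (c1, b1, a1)]
        else
          [(b, an, al), (b, an', al), (an, al, ar), (an', al, ar), (c, an, ar), (c, an', ar),
           (c, bn, bl), (c, bn', bl), (bn, br, bl), (bn', br, bl), (a, bn, br), (a, bn', br),
           (a, cn, cl), (a, cn', cl), (cn, cl, cr), (cn', cl, cr), (b, cn, cr), (b, cn', cr)])"

text \<open>An infinite list counted with multiplicity is a set of labelled triples.  A label is the
  word of positions through which the triple was produced, most recent position first, so that
  equal triples arising in different ways stay distinct.\<close>

type_synonym label = "(nat \<times> nat) list"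

definition tau :: "triple \<Rightarrow> ((nat \<times> nat) \<times> triple) set" where
  "tau q = {((n, j), tau_block q n ! j) | n j. j < length (tau_block q n)}"

definition tau_list :: "triple \<Rightarrow> (label \<times> triple) set" where
  "tau_list q = {([i], s) | i s. (i, s) \<in> tau q}"

definition refine :: "real \<Rightarrow> (label \<times> triple) set \<Rightarrow> (label \<times> triple) set" where
  "refine \<kappa> L =
     {(w, (x, y, z)) | w x y z. (w, (x, y, z)) \<in> L \<and> \<not> y < \<kappa>} \<union>
     {(i # w, s) | i w s x y z. (w, (x, y, z)) \<in> L \<and> y < \<kappa> \<and> (i, s) \<in> tau (x, y, z)}"

definition f_fun :: "nat \<Rightarrow> real \<Rightarrow> real \<Rightarrow> real \<Rightarrow> real \<Rightarrow> real \<Rightarrow> real" where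
  "f_fun m \<kappa> a b c t =
     (\<Sum>\<^sub>\<infinity>(w, (x, y, z))\<in>(refine \<kappa> ^^ m) (tau_list (a, b, c)).
        1/2 * ((x + y) powr (- t) + z powr (- t)))"

definition g_fun :: "nat \<Rightarrow> real \<Rightarrow> real \<Rightarrow> real \<Rightarrow> real \<Rightarrow> real \<Rightarrow> real" where
  "g_fun m \<kappa> a b c t =
     (\<Sum>\<^sub>\<infinity>(w, (x, y, z))\<in>(refine \<kappa> ^^ m) (tau_list (a, b, c)).
        (x + (y + z) / 2) powr (- t))"

end

theory Submission
  imports Defs
begin

text \<open>The packing is octahedral: three mutually tangent disks \<open>A\<close>, \<open>B\<close>, \<open>C\<close> determine three disks
  antipodal to them in an octahedral configuration, and the gap between \<open>A\<close>, \<open>B\<close>, \<open>C\<close> is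
  divided by these into seven gaps of the same kind.  The curvature of each disk in a gap is
  \<open>x a + y b + z c + d e\<close> with coefficients independent of the gap and invariant, as a set, under
  permutations of \<open>a, b, c\<close>.  Applying Jensen's inequality to each orbit of coefficient vectors
  compares the sum of \<open>curvature\<close> to the power \<open>-t\<close> over the gap of \<open>(a,b,c)\<close> with that over
  the gap of \<open>(0,1,1)\<close>; the factors are precisely the summands of \<open>f\<close> and \<open>g\<close>.  The list
  \<open>\<tau>\<close> iterates the subdivision along the three corners, so finiteness of the sum forces the
  sum of the \<open>g\<close> factors to be at most 1, and is implied by the sum of the \<open>f\<close> factors being
  below 1.\<close>

section \<open>Octahedral subdivision in coordinates\<close>

type_synonym quad = "real \<times> real \<times> real \<times> real"
type_synonym face = "bool \<times> bool \<times> bool"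

fun dotq :: "quad \<Rightarrow> quad \<Rightarrow> real" where
  "dotq (x, y, z, d) (a, b, c, e) = x * a + y * b + z * c + d * e"

text \<open>A quadruple \<open>(a, b, c, e)\<close> stands for curvatures with \<open>e = sqrt 2 * neck_d a b c\<close>.  The
  disk antipodal to \<open>a\<close> then has curvature \<open>2 s - a\<close>, where \<open>s = a + b + c + e\<close>, and a face of the
  octahedron is given by the set of coordinates that are replaced by their antipodes.\<close>

fun sub :: "face \<Rightarrow> quad \<Rightarrow> quad" where
  "sub (i, j, k) (a, b, c, e) = (let s = a + b + c + e;
      a' = (if i then 2 * s - a else a);
      b' = (if j then 2 * s - b else b);
      c' = (if k then 2 * s - c else c)
    in (a', b', c', a' + b' + c' - s))"

text \<open>The transpose of \<^const>\<open>sub\<close>, acting on coefficient vectors.\<close>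

fun lift :: "face \<Rightarrow> quad \<Rightarrow> quad" where
  "lift (i, j, k) (x, y, z, d) = (let
      t = 2 * ((if i then x + d else 0) + (if j then y + d else 0) + (if k then z + d else 0)) - d
    in (if i then t - (x + d) else t + (x + d),
        if j then t - (y + d) else t + (y + d),
        if k then t - (z + d) else t + (z + d), t))"

definition faces :: "face set" where
  "faces = UNIV - {(False, False, False)}"

definition tips :: "quad set" where
  "tips = {(1, 2, 2, 2), (2, 1, 2, 2), (2, 2, 1, 2)}"

primrec disks :: "nat \<Rightarrow> quad set" where
  "disks 0 = {}"
| "disks (Suc n) = tips \<union> (\<Union>f\<in>faces. lift f ` disks n)"

definition all_disks :: "quad set" where
  "all_disks = (\<Union>n. disks n)"

text \<open>The Lorentz form in the basis of the three disks and the circle through their points of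
  tangency.\<close>

fun qf :: "quad \<Rightarrow> real" where
  "qf (x, y, z, d) = x\<^sup>2 + y\<^sup>2 + z\<^sup>2 - 2 * x * y - 2 * x * z - 2 * y * z + 2 * d\<^sup>2"

text \<open>The Lorentz product with the dual circle of a face: it is positive exactly on the disks
  beyond that face, and so separates the seven gaps.\<close>

fun side :: "face \<Rightarrow> quad \<Rightarrow> real" where
  "side (i, j, k) (x, y, z, d) =
     - d - 2 * ((if i then x - d else 0) + (if j then y - d else 0) + (if k then z - d else 0))"

text \<open>The last three inequalities say that the disk is disjoint from \<open>A\<close>, \<open>B\<close> and \<open>C\<close>.\<close>

fun in_gap :: "quad \<Rightarrow> bool" where
  "in_gap (x, y, z, d) \<longleftrightarrow> 0 \<le> x \<and> 0 \<le> y \<and> 0 \<le> z \<and> 1 \<le> d \<and>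
     x + 1 \<le> y + z \<and> y + 1 \<le> x + z \<and> z + 1 \<le> x + y"

lemma UNIV_face: "(UNIV :: face set) = {(True,True,True),(True,True,False),(True,False,True),(True,False,False),
   (False,True,True),(False,True,False),(False,False,True),(False,False,False)}"
  by (auto simp: UNIV_Times_UNIV[symmetric] simp del: UNIV_Times_UNIV simp: UNIV_bool)

lemma faces_eq: "faces = {(True,True,True),(True,True,False),(True,False,True),(True,False,False),
   (False,True,True),(False,True,False),(False,False,True)}"
  unfolding faces_def UNIV_face by auto

lemma finite_faces [simp]: "finite faces"
  by (simp add: faces_eq)

text \<open>Adjointness of \<open>lift\<close> and \<open>sub\<close>: a disk with coefficients
  \<open>v\<close> in the subgap beyond face \<open>f\<close> has coefficients
  \<open>lift f v\<close> in the original gap.\<close>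

lemma dotq_lift: "dotq (lift f v) q = dotq v (sub f q)"
proof -
  obtain i j k x y z d a b c e where "f = (i, j, k)" "v = (x, y, z, d)" "q = (a, b, c, e)"
    by (metis prod_cases4 prod_cases3)
  then show ?thesis
    by (cases i; cases j; cases k) (simp_all add: Let_def algebra_simps)
qed

lemma qf_lift: "qf (lift f v) = qf v"
proof -
  obtain i j k x y z d where "f = (i, j, k)" "v = (x, y, z, d)"
    by (metis prod_cases4 prod_cases3)
  then show ?thesis
    by (cases i; cases j; cases k) (simp_all add: Let_def algebra_simps power2_eq_square)
qed

lemma in_gap_tips: "v \<in> tips \<Longrightarrow> in_gap v"
  by (auto simp: tips_def)

lemma in_gap_lift: "in_gap v \<Longrightarrow> f \<in> faces \<Longrightarrow> in_gap (lift f v)"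
  by (cases v) (auto simp: faces_eq Let_def)

lemma side_lift_self:
  assumes "in_gap v" shows "side f (lift f v) > 0"
proof -
  obtain i j k x y z d where "f = (i, j, k)" "v = (x, y, z, d)"
    by (metis prod_cases4 prod_cases3)
  then show ?thesis using assms
    by (cases i; cases j; cases k) (simp_all add: Let_def)
qed

lemma side_lift_other:
  assumes "in_gap v" "f \<noteq> g" shows "side g (lift f v) < 0"
proof -
  obtain i j k x y z d i' j' k' where "f = (i, j, k)" "v = (x, y, z, d)" "g = (i', j', k')"
    by (metis prod_cases4 prod_cases3)
  then show ?thesis using assms
    by (cases i; cases j; cases k; cases i'; cases j'; cases k') (simp_all add: Let_def)
qed

lemma side_tips:
  assumes "v \<in> tips" shows "side f v \<le> 0"
  using assms by (cases f) (auto simp: tips_def)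

lemma lift_inj: "inj (lift f)"
proof (rule injI)
  fix v w assume A: "lift f v = lift f w"
  have "\<And>q. dotq v (sub f q) = dotq w (sub f q)"
    by (metis A dotq_lift)
  moreover obtain i j k where f: "f = (i, j, k)" by (metis prod_cases3)
  moreover obtain x y z d where v: "v = (x, y, z, d)" by (metis prod_cases4)
  moreover obtain x' y' z' d' where w: "w = (x', y', z', d')" by (metis prod_cases4)
  ultimately show "v = w" using A
    by (cases i; cases j; cases k; simp add: Let_def)
qed

lemma disks_SucE:
  assumes "v \<in> disks (Suc n)"
  obtains "v \<in> tips" | f u where "f \<in> faces" "u \<in> disks n" "v = lift f u"
  using assms unfolding disks.simps by blast

lemma disks_Suc_lift: "u \<in> disks n \<Longrightarrow> f \<in> faces \<Longrightarrow> lift f u \<in> disks (Suc n)"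
  unfolding disks.simps by blast

lemma disks_Suc_tips: "u \<in> tips \<Longrightarrow> u \<in> disks (Suc n)"
  unfolding disks.simps by blast

lemma in_gap_disks: "v \<in> disks n \<Longrightarrow> in_gap v"
proof (induction n arbitrary: v)
  case (Suc n)
  from Suc.prems show ?case
    by (cases rule: disks_SucE) (use Suc.IH in_gap_tips in_gap_lift in blast)+
qed simp

lemma qf_disks: "v \<in> disks n \<Longrightarrow> qf v = 1"
proof (induction n arbitrary: v)
  case (Suc n)
  from Suc.prems show ?case
  proof (cases rule: disks_SucE)
    case 1
    then show ?thesis by (auto simp: tips_def)
  next
    case (2 f u)
    then show ?thesis using Suc.IH[of u] by (simp only: qf_lift)
  qed
qed simp

lemma finite_tips [simp]: "finite tips"
  by (simp add: tips_def)

lemma finite_disks [simp]: "finite (disks n)"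
  by (induction n) auto

lemma disks_mono_Suc: "disks n \<subseteq> disks (Suc n)"
proof (induction n)
  case (Suc n)
  then have "\<And>f. lift f ` disks n \<subseteq> lift f ` disks (Suc n)" by (rule image_mono)
  then show ?case by (subst (1 2) disks.simps) blast
qed simp

lemma disks_mono: "m \<le> n \<Longrightarrow> disks m \<subseteq> disks n"
  by (rule lift_Suc_mono_le[where f = disks]) (rule disks_mono_Suc)

section \<open>Invariance of the disks under permutations of the three curvatures, and truncated
  power sums\<close>

fun swap12 :: "quad \<Rightarrow> quad" where
  "swap12 (x, y, z, d) = (y, x, z, d)"

fun swap23 :: "quad \<Rightarrow> quad" where
  "swap23 (x, y, z, d) = (x, z, y, d)"

lemma swap12_swap12 [simp]: "swap12 (swap12 v) = v" by (cases v) auto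
lemma swap23_swap23 [simp]: "swap23 (swap23 v) = v" by (cases v) auto

lemma swap12_lift: "swap12 (lift (i, j, k) v) = lift (j, i, k) (swap12 v)"
  by (cases v) (auto simp: Let_def)

lemma swap23_lift: "swap23 (lift (i, j, k) v) = lift (i, k, j) (swap23 v)"
  by (cases v) (auto simp: Let_def)

lemma swap12_disks: "v \<in> disks n \<Longrightarrow> swap12 v \<in> disks n"
proof (induction n arbitrary: v)
  case (Suc n)
  from Suc.prems show ?case
  proof (cases rule: disks_SucE)
    case 1
    then have "swap12 v \<in> tips" by (auto simp: tips_def)
    then show ?thesis by (rule disks_Suc_tips)
  next
    case (2 f u)
    obtain i j k where f: "f = (i, j, k)" by (metis prod_cases3)
    have "swap12 v = lift (j, i, k) (swap12 u)" unfolding 2(3) f by (rule swap12_lift)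
    moreover have "(j, i, k) \<in> faces" using 2(1) unfolding f faces_def by auto
    ultimately show ?thesis using Suc.IH[OF 2(2)] disks_Suc_lift by metis
  qed
qed simp

lemma swap23_disks: "v \<in> disks n \<Longrightarrow> swap23 v \<in> disks n"
proof (induction n arbitrary: v)
  case (Suc n)
  from Suc.prems show ?case
  proof (cases rule: disks_SucE)
    case 1
    then have "swap23 v \<in> tips" by (auto simp: tips_def)
    then show ?thesis by (rule disks_Suc_tips)
  next
    case (2 f u)
    obtain i j k where f: "f = (i, j, k)" by (metis prod_cases3)
    have "swap23 v = lift (i, k, j) (swap23 u)" unfolding 2(3) f by (rule swap23_lift)
    moreover have "(i, k, j) \<in> faces" using 2(1) unfolding f faces_def by auto
    ultimately show ?thesis using Suc.IH[OF 2(2)] disks_Suc_lift by metis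
  qed
qed simp

definition mass :: "nat \<Rightarrow> real \<Rightarrow> quad \<Rightarrow> real" where
  "mass n t q = (\<Sum>v\<in>disks n. dotq v q powr (- t))"

lemma mass_0 [simp]: "mass 0 t q = 0"
  by (simp add: mass_def)

text \<open>The sum splits because the pieces are disjoint: on a disk lifted through
  \<open>f\<close>, \<open>side f\<close> is positive and \<open>side g\<close> is negative for
  every other face, while no \<open>side\<close> is positive on \<open>tips\<close>.\<close>

lemma mass_Suc:
  "mass (Suc n) t q = (\<Sum>v\<in>tips. dotq v q powr (- t)) + (\<Sum>f\<in>faces. mass n t (sub f q))"
proof -
  have disj: "lift f ` disks n \<inter> lift g ` disks n = {}" if "f \<noteq> g" for f g
  proof (rule ccontr)
    assume "\<not> ?thesis"
    then obtain u v where uv: "u \<in> disks n" "v \<in> disks n" "lift f u = lift g v" by blast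
    show False
      using side_lift_self[OF in_gap_disks[OF uv(2)], of g]
        side_lift_other[OF in_gap_disks[OF uv(1)] that] uv(3) by simp
  qed
  have "mass (Suc n) t q = (\<Sum>v\<in>tips. dotq v q powr (- t)) +
      (\<Sum>v\<in>(\<Union>f\<in>faces. lift f ` disks n). dotq v q powr (- t))"
    unfolding mass_def disks.simps
  proof (rule sum.union_disjoint)
    show "tips \<inter> (\<Union>f\<in>faces. lift f ` disks n) = {}"
    proof (rule ccontr)
      assume "\<not> ?thesis"
      then obtain f u where "lift f u \<in> tips" "u \<in> disks n" by blast
      then show False using side_tips[of "lift f u" f] side_lift_self[OF in_gap_disks, of u n f] by simp
    qed
  qed auto
  also have "(\<Sum>v\<in>(\<Union>f\<in>faces. lift f ` disks n). dotq v q powr (- t)) =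
      (\<Sum>f\<in>faces. \<Sum>v\<in>lift f ` disks n. dotq v q powr (- t))"
    by (rule sum.UNION_disjoint) (use disj in auto)
  also have "\<dots> = (\<Sum>f\<in>faces. mass n t (sub f q))"
    unfolding mass_def
    by (rule sum.cong[OF refl], subst sum.reindex[OF inj_on_subset[OF lift_inj subset_UNIV]])
       (simp add: dotq_lift)
  finally show ?thesis .
qed

lemma dotq_swap12: "dotq (swap12 v) (swap12 q) = dotq v q"
  by (cases v; cases q) auto

lemma dotq_swap23: "dotq (swap23 v) (swap23 q) = dotq v q"
  by (cases v; cases q) auto

lemma mass_swap12: "mass n t (swap12 q) = mass n t q"
  unfolding mass_def
  by (rule sum.reindex_bij_witness[of _ swap12 swap12])
     (metis swap12_disks swap12_swap12 dotq_swap12)+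

lemma mass_swap23: "mass n t (swap23 q) = mass n t q"
  unfolding mass_def
  by (rule sum.reindex_bij_witness[of _ swap23 swap23])
     (metis swap23_disks swap23_swap23 dotq_swap23)+

section \<open>Comparing the gap of (a,b,c) with the gap of (0,1,1)\<close>

lemma convex_on_powr_neg:
  fixes t :: real
  assumes "t \<ge> 0"
  shows "convex_on {0<..} (\<lambda>x. x powr (- t))"
proof (rule f''_ge0_imp_convex)
  show "((\<lambda>x. x powr (- t)) has_real_derivative - t * x powr (- t - 1)) (at x)"
    if "x \<in> {0<..}" for x
    using has_real_derivative_powr[of x "- t"] that by simp
  show "((\<lambda>x. - t * x powr (- t - 1)) has_real_derivative - t * ((- t - 1) * x powr (- t - 1 - 1))) (at x)"
    if "x \<in> {0<..}" for x
    using that by (intro DERIV_cmult has_real_derivative_powr) auto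
  show "0 \<le> - t * ((- t - 1) * x powr (- t - 1 - 1))" for x
  proof -
    have "- t * ((- t - 1) * x powr (- t - 1 - 1)) = t * (t + 1) * x powr (- t - 1 - 1)"
      by (simp add: algebra_simps)
    then show ?thesis using assms by simp
  qed
qed simp

lemma powr_neg_antimono:
  fixes x y t :: real
  assumes "t \<ge> 0" "0 < x" "x \<le> y"
  shows "y powr (- t) \<le> x powr (- t)"
  using assms powr_mono2' by force

text \<open>Two-point majorization: \<open>x\<close> and \<open>y\<close> are convex combinations of
  \<open>l\<close> and \<open>h\<close> with mirrored weights, so the two chord estimates add up to
  the right-hand side.\<close>

lemma convex_on_pair:
  fixes f :: "real \<Rightarrow> real"
  assumes f: "convex_on A f" and in_A: "l \<in> A" "h \<in> A"
    and "l \<le> x" "x \<le> h" "x + y = l + h"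
  shows "f x + f y \<le> f l + f h"
proof (cases "l = h")
  case False
  define w where "w = (x - l) / (h - l)"
  have w: "0 \<le> w" "w \<le> 1" using assms False by (auto simp: w_def field_simps)
  have wx: "w * (h - l) = x - l" using False by (simp add: w_def)
  have x: "x = (1 - w) *\<^sub>R l + w *\<^sub>R h" using wx by (simp add: algebra_simps)
  have y: "y = (1 - w) *\<^sub>R h + w *\<^sub>R l" using wx assms(6) by (simp add: algebra_simps)
  have "f x \<le> (1 - w) * f l + w * f h" unfolding x by (rule convex_onD[OF f w in_A])
  moreover have "f y \<le> (1 - w) * f h + w * f l" unfolding y by (rule convex_onD[OF f w in_A(2,1)])
  ultimately show ?thesis by (simp add: algebra_simps)
qed (use assms in auto)

lemma convex_on_midpoint:
  fixes f :: "real \<Rightarrow> real"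
  assumes f: "convex_on A f" and "x \<in> A" "y \<in> A"
  shows "2 * f ((x + y) / 2) \<le> f x + f y"
  using convex_onD[OF f, of "1/2" x y] assms by (simp add: field_simps)

lemma convex_on_sum3:
  fixes f :: "real \<Rightarrow> real"
  assumes f: "convex_on A f" and "x \<in> A" "y \<in> A" "z \<in> A"
    and "0 \<le> p" "0 \<le> q" "0 \<le> r" "p + q + r = 1"
  shows "f (p * x + q * y + r * z) \<le> p * f x + q * f y + r * f z"
proof -
  let ?w = "\<lambda>i::nat. if i = 0 then p else if i = 1 then q else r"
  let ?v = "\<lambda>i::nat. if i = 0 then x else if i = 1 then y else z"
  have "f (\<Sum>i\<in>{0,1,2}. ?w i *\<^sub>R ?v i) \<le> (\<Sum>i\<in>{0,1,2}. ?w i * f (?v i))"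
    by (rule convex_on_sum[OF _ _ f]) (use assms in auto)
  then show ?thesis by (simp add: add.assoc)
qed

text \<open>Both arguments on the left lie between \<open>p * u + k\<close> and
  \<open>q * u + k\<close> and have the same sum as these. Moving all of a+b into one place
  therefore spreads the pair and increases the sum; lowering \<open>k\<close> to \<open>k'\<close>
  increases it further.\<close>

lemma majorized_pair:
  fixes a b u k p q t :: real
  assumes t: "t \<ge> 0" and "0 \<le> a" "0 \<le> b" "0 \<le> p" "0 \<le> q" and k: "0 < k'" "k' \<le> k" and u: "u = a + b"
  shows "(p * a + q * b + k) powr (- t) + (q * a + p * b + k) powr (- t)
    \<le> (p * u + k') powr (- t) + (q * u + k') powr (- t)"
proof -
  have *: "(p * a + q * b + k) powr (- t) + (q * a + p * b + k) powr (- t)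
    \<le> (p * u + k) powr (- t) + (q * u + k) powr (- t)"
    if "p \<le> q" "0 \<le> p" "0 \<le> a" "0 \<le> b" for p q
  proof (rule convex_on_pair[OF convex_on_powr_neg[OF t]])
    have "p * b \<le> q * b" "p * a \<le> q * a" using that by (auto intro: mult_right_mono)
    then show "p * u + k \<le> p * a + q * b + k" "p * a + q * b + k \<le> q * u + k"
      by (auto simp: u algebra_simps)
    show "p * u + k \<in> {0<..}" "q * u + k \<in> {0<..}"
      using that k by (auto simp: u intro!: add_nonneg_pos mult_nonneg_nonneg)
  qed (simp add: u algebra_simps)
  have "(p * a + q * b + k) powr (- t) + (q * a + p * b + k) powr (- t)
    \<le> (p * u + k) powr (- t) + (q * u + k) powr (- t)"
    using *[of p q] *[of q p] assms by (cases "p \<le> q") auto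
  also have "\<dots> \<le> (p * u + k') powr (- t) + (q * u + k') powr (- t)"
    using assms by (intro add_mono powr_neg_antimono) (auto intro: add_nonneg_pos)
  finally show ?thesis .
qed

text \<open>A power of the geometric mean is the geometric mean of the powers, so this is the AM-GM
  inequality.\<close>

lemma powr_neg_geom_mean:
  fixes u c t :: real
  assumes "0 < u" "0 < c"
  shows "sqrt (u * c) powr (- t) \<le> (u powr (- t) + c powr (- t)) / 2"
proof -
  have "sqrt (u * c) powr (- t) = sqrt (u powr (- t) * c powr (- t))"
    using assms by (simp add: powr_half_sqrt[symmetric] powr_powr powr_mult mult.commute)
  then show ?thesis using arith_geo_mean_sqrt[of "u powr (- t)" "c powr (- t)"] by simp
qed

text \<open>After factoring out p+r+d each argument is a weighted mean of u, c and their geometric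
  mean, so Jensen applies. Adding the version with p and r exchanged makes the weights of u and c
  equal, and \<open>powr_neg_geom_mean\<close> absorbs the third term.\<close>

lemma symmetrized_pair:
  fixes u c p r d t :: real
  assumes t: "t \<ge> 0" and uc: "0 < u" "0 < c" and "0 \<le> p" "0 \<le> r" "0 < d"
  shows "(p * u + r * c + d * sqrt (u * c)) powr (- t) + (r * u + p * c + d * sqrt (u * c)) powr (- t)
    \<le> (u powr (- t) + c powr (- t)) * (p + r + d) powr (- t)"
proof -
  define k where "k = p + r + d"
  define g where "g = sqrt (u * c)"
  have k: "k > 0" and g: "g > 0" using assms by (auto simp: k_def g_def)
  have *: "(p * u + r * c + d * g) powr (- t)
      \<le> k powr (- t) * (p / k * u powr (- t) + r / k * c powr (- t) + d / k * g powr (- t))"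
    if "0 \<le> p" "0 \<le> r" "k = p + r + d" for p r
  proof -
    have "p * u + r * c + d * g = k * (p / k * u + r / k * c + d / k * g)"
      using k by (simp add: field_simps)
    then have "(p * u + r * c + d * g) powr (- t) =
        k powr (- t) * (p / k * u + r / k * c + d / k * g) powr (- t)"
      using k g assms that by (simp add: powr_mult)
    also have "\<dots> \<le> k powr (- t) * (p / k * u powr (- t) + r / k * c powr (- t) + d / k * g powr (- t))"
    proof (intro mult_left_mono convex_on_sum3[OF convex_on_powr_neg[OF t]])
      show "p / k + r / k + d / k = 1"
        using that k by (simp add: add_divide_distrib[symmetric])
    qed (use k g assms that in auto)
    finally show ?thesis .
  qed
  have "(p * u + r * c + d * g) powr (- t) + (r * u + p * c + d * g) powr (- t)
    \<le> k powr (- t) * (p / k * u powr (- t) + r / k * c powr (- t) + d / k * g powr (- t)) +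
      k powr (- t) * (r / k * u powr (- t) + p / k * c powr (- t) + d / k * g powr (- t))"
    by (intro add_mono *) (use assms in \<open>auto simp: k_def\<close>)
  also have "\<dots> = k powr (- t) * ((p + r) / k * (u powr (- t) + c powr (- t)) + d / k * (2 * g powr (- t)))"
    using k by (simp add: field_simps)
  also have "\<dots> \<le> k powr (- t) * ((p + r) / k * (u powr (- t) + c powr (- t)) + d / k * (u powr (- t) + c powr (- t)))"
    using powr_neg_geom_mean[OF uc, of t] k assms unfolding g_def
    by (intro mult_left_mono add_mono) auto
  also have "\<dots> = k powr (- t) * ((p + r + d) / k * (u powr (- t) + c powr (- t)))"
    by (simp add: add_divide_distrib distrib_right)
  also have "\<dots> = (u powr (- t) + c powr (- t)) * k powr (- t)"
    using k by (simp add: k_def)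
  finally show ?thesis by (simp add: g_def k_def)
qed

text \<open>The difference of the squares is a^2 + ((b-c)/2)^2.\<close>

lemma neck_d_upper:
  assumes "0 \<le> a" "0 \<le> b" "0 \<le> c"
  shows "neck_d a b c \<le> a + (b + c) / 2"
proof -
  have "a * b + a * c + b * c \<le> (a + (b + c) / 2)\<^sup>2"
    using sum_squares_ge_zero[of a "(b - c) / 2"] by (simp add: power2_eq_square field_simps)
  then show ?thesis unfolding neck_d_def
    using assms by (intro real_le_lsqrt) auto
qed

text \<open>The left-hand side is \<open>neck_d 0 (a + b) c\<close>; the radicands differ by
  a*b.\<close>

lemma neck_d_lower:
  assumes "0 \<le> a" "0 \<le> b" "0 \<le> c"
  shows "sqrt ((a + b) * c) \<le> neck_d a b c"
  unfolding neck_d_def using assms by (intro real_sqrt_le_mono) (simp add: algebra_simps)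

text \<open>All six permutations are listed even if coordinates coincide; summing over the
  permutation invariant set \<open>disks n\<close> then counts every disk exactly six times.\<close>

definition orbit_sum :: "real \<Rightarrow> quad \<Rightarrow> quad \<Rightarrow> real" where
  "orbit_sum t = (\<lambda>(x, y, z, d) q.
     dotq (x, y, z, d) q powr (- t) + dotq (y, x, z, d) q powr (- t) +
     dotq (x, z, y, d) q powr (- t) + dotq (z, x, y, d) q powr (- t) +
     dotq (y, z, x, d) q powr (- t) + dotq (z, y, x, d) q powr (- t))"

definition gap :: "real \<Rightarrow> real \<Rightarrow> real \<Rightarrow> quad" where
  "gap a b c = (a, b, c, sqrt 2 * neck_d a b c)"

lemma orbit_sum_base:
  "orbit_sum t (x, y, z, d) (gap 0 1 1) = 2 * ((x + y + sqrt 2 * d) powr (- t) +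
     (x + z + sqrt 2 * d) powr (- t) + (y + z + sqrt 2 * d) powr (- t))"
  by (simp add: orbit_sum_def gap_def neck_d_def algebra_simps)

text \<open>The six permutations are paired twice: first by exchanging the coefficients of a and b,
  which collapses the gap to that of (0,a+b,c), then by exchanging the coefficients of a+b and
  c.\<close>

lemma orbit_sum_upper:
  assumes t: "t \<ge> 0" and v: "in_gap v" and abc: "0 \<le> a" "0 \<le> b" "0 < a + b" "0 < c"
  shows "orbit_sum t v (gap a b c) \<le> 1/2 * ((a + b) powr (- t) + c powr (- t)) * orbit_sum t v (gap 0 1 1)"
proof -
  obtain x y z d where v_eq: "v = (x, y, z, d)" by (metis prod_cases4)
  define \<phi> where "\<phi> r = r powr (- t)" for r :: real
  define u where "u = a + b"
  define g where "g = sqrt 2 * d * sqrt (u * c)"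
  define e where "e = d * (sqrt 2 * neck_d a b c)"
  have xyz: "0 \<le> x" "0 \<le> y" "0 \<le> z" "d \<ge> 1" using v v_eq by auto
  have g: "0 < g" using xyz abc by (auto simp: g_def u_def)
  have ge: "g \<le> e" unfolding g_def e_def u_def
    using neck_d_lower[of a b c] xyz abc by (simp add: mult_left_mono)
  have maj: "\<phi> (p * a + q * b + r * c + e) + \<phi> (q * a + p * b + r * c + e)
      \<le> \<phi> (p * u + r * c + g) + \<phi> (q * u + r * c + g)"
    if "0 \<le> p" "0 \<le> q" "0 \<le> r" for p q r
    using majorized_pair[of t a b p q "r * c + g" "r * c + e" u] that t abc g ge
    by (simp add: u_def \<phi>_def add.assoc add_nonneg_pos)
  have sym: "\<phi> (p * u + r * c + g) + \<phi> (r * u + p * c + g)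
      \<le> (\<phi> u + \<phi> c) * \<phi> (p + r + sqrt 2 * d)" if "0 \<le> p" "0 \<le> r" for p r
    using symmetrized_pair[of t u c p r "sqrt 2 * d"] that t abc xyz by (simp add: u_def g_def \<phi>_def)
  have "orbit_sum t v (gap a b c) =
      (\<phi> (x * a + y * b + z * c + e) + \<phi> (y * a + x * b + z * c + e)) +
      (\<phi> (x * a + z * b + y * c + e) + \<phi> (z * a + x * b + y * c + e)) +
      (\<phi> (y * a + z * b + x * c + e) + \<phi> (z * a + y * b + x * c + e))"
    unfolding orbit_sum_def v_eq \<phi>_def e_def gap_def by simp
  also have "\<dots> \<le> (\<phi> (x * u + z * c + g) + \<phi> (y * u + z * c + g)) +
      (\<phi> (x * u + y * c + g) + \<phi> (z * u + y * c + g)) +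
      (\<phi> (y * u + x * c + g) + \<phi> (z * u + x * c + g))"
    by (intro add_mono maj) (use xyz in auto)
  also have "\<dots> = (\<phi> (x * u + z * c + g) + \<phi> (z * u + x * c + g)) +
      (\<phi> (x * u + y * c + g) + \<phi> (y * u + x * c + g)) +
      (\<phi> (y * u + z * c + g) + \<phi> (z * u + y * c + g))"
    by simp
  also have "\<dots> \<le> (\<phi> u + \<phi> c) * \<phi> (x + z + sqrt 2 * d) + (\<phi> u + \<phi> c) * \<phi> (x + y + sqrt 2 * d) +
      (\<phi> u + \<phi> c) * \<phi> (y + z + sqrt 2 * d)"
    by (intro add_mono sym) (use xyz in auto)
  also have "\<dots> = 1/2 * ((a + b) powr (- t) + c powr (- t)) * orbit_sum t v (gap 0 1 1)"
    unfolding v_eq orbit_sum_base by (simp add: \<phi>_def u_def algebra_simps)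
  finally show ?thesis .
qed

text \<open>The permutations are paired by exchanging the coefficients of b and c. By midpoint
  convexity each pair is at least twice the value at its mean, and the mean is bounded by a multiple
  of a+(b+c)/2.\<close>

lemma orbit_sum_lower:
  assumes t: "t \<ge> 0" and v: "in_gap v" and abc: "0 \<le> a" "0 \<le> b" "0 \<le> c" "0 < b + c"
    and pos: "0 < neck_d a b c"
  shows "(a + (b + c) / 2) powr (- t) * orbit_sum t v (gap 0 1 1) \<le> orbit_sum t v (gap a b c)"
proof -
  obtain x y z d where v_eq: "v = (x, y, z, d)" by (metis prod_cases4)
  define \<phi> where "\<phi> r = r powr (- t)" for r :: real
  define u where "u = a + (b + c) / 2"
  define e where "e = d * (sqrt 2 * neck_d a b c)"
  have xyz: "0 \<le> x" "0 \<le> y" "0 \<le> z" "d \<ge> 1" and tri: "x \<le> y + z" "y \<le> x + z" "z \<le> x + y"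
    using v v_eq by auto
  have u: "u > 0" unfolding u_def by (rule add_nonneg_pos) (use abc in auto)
  have eu: "e \<le> sqrt 2 * d * u"
  proof -
    have "d * sqrt 2 * neck_d a b c \<le> d * sqrt 2 * u"
      unfolding u_def by (rule mult_left_mono[OF neck_d_upper[OF abc(1-3)]]) (use xyz in simp)
    then show ?thesis by (simp only: e_def mult_ac)
  qed
  have e: "e > 0" using pos xyz by (simp add: e_def)
  have mid: "2 * (\<phi> u * \<phi> (q + r + sqrt 2 * d))
      \<le> \<phi> (p * a + q * b + r * c + e) + \<phi> (p * a + r * b + q * c + e)"
    if "0 \<le> p" "0 \<le> q" "0 \<le> r" "p \<le> q + r" for p q r
  proof -
    let ?l = "p * a + q * b + r * c + e" and ?l' = "p * a + r * b + q * c + e"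
    have l: "?l \<in> {0<..}" "?l' \<in> {0<..}" using that abc e by (auto intro!: add_nonneg_pos)
    have "(?l + ?l') / 2 = p * a + (q + r) * ((b + c) / 2) + e" by (simp add: field_simps)
    \<comment> \<open>Disjointness of the disk from A, B, C enters here: p \<le> q+r lets the
      coefficient of a grow to that of (b+c)/2, so that the scale factors out.\<close>
    also have "\<dots> \<le> (q + r) * a + (q + r) * ((b + c) / 2) + sqrt 2 * d * u"
      using that abc eu by (intro add_mono mult_right_mono) auto
    also have "\<dots> = u * (q + r + sqrt 2 * d)"
      unfolding u_def distrib_left distrib_right by (simp only: mult_ac add_ac)
    finally have le: "(?l + ?l') / 2 \<le> u * (q + r + sqrt 2 * d)" .
    have "\<phi> u * \<phi> (q + r + sqrt 2 * d) = \<phi> (u * (q + r + sqrt 2 * d))"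
      using u that xyz by (simp add: \<phi>_def powr_mult)
    also have "\<dots> \<le> \<phi> ((?l + ?l') / 2)"
      unfolding \<phi>_def by (rule powr_neg_antimono[OF t _ le]) (rule half_gt_zero, rule add_pos_pos, use l in simp_all)
    finally show ?thesis
      using convex_on_midpoint[OF convex_on_powr_neg[OF t] l] by (simp add: \<phi>_def)
  qed
  have "(a + (b + c) / 2) powr (- t) * orbit_sum t v (gap 0 1 1) =
     2 * (\<phi> u * \<phi> (y + z + sqrt 2 * d)) + 2 * (\<phi> u * \<phi> (x + z + sqrt 2 * d)) +
     2 * (\<phi> u * \<phi> (x + y + sqrt 2 * d))"
    unfolding v_eq orbit_sum_base by (simp add: \<phi>_def u_def algebra_simps)
  also have "\<dots> \<le> (\<phi> (x * a + y * b + z * c + e) + \<phi> (x * a + z * b + y * c + e)) +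
      (\<phi> (y * a + x * b + z * c + e) + \<phi> (y * a + z * b + x * c + e)) +
      (\<phi> (z * a + x * b + y * c + e) + \<phi> (z * a + y * b + x * c + e))"
    by (intro add_mono mid) (use xyz tri in auto)
  also have "\<dots> = orbit_sum t v (gap a b c)"
    unfolding orbit_sum_def v_eq \<phi>_def e_def gap_def by simp
  finally show ?thesis .
qed

lemma mass_swap12': "mass n t (b, a, c, e) = mass n t (a, b, c, e)"
  using mass_swap12[of n t "(a, b, c, e)"] by simp

lemma mass_swap23': "mass n t (a, c, b, e) = mass n t (a, b, c, e)"
  using mass_swap23[of n t "(a, b, c, e)"] by simp

lemma mass_orbit_sum: "6 * mass n t q = (\<Sum>v\<in>disks n. orbit_sum t v q)"
proof -
  obtain a b c e where q: "q = (a, b, c, e)" by (metis prod_cases4)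
  have "(\<Sum>v\<in>disks n. orbit_sum t v q) =
      mass n t (a, b, c, e) + mass n t (b, a, c, e) + mass n t (a, c, b, e) +
      mass n t (b, c, a, e) + mass n t (c, a, b, e) + mass n t (c, b, a, e)"
    unfolding mass_def sum.distrib[symmetric]
  proof (rule sum.cong[OF refl])
    fix v :: quad
    obtain x y z d where v: "v = (x, y, z, d)" by (metis prod_cases4)
    show "orbit_sum t v q = dotq v (a, b, c, e) powr (- t) + dotq v (b, a, c, e) powr (- t) +
        dotq v (a, c, b, e) powr (- t) + dotq v (b, c, a, e) powr (- t) +
        dotq v (c, a, b, e) powr (- t) + dotq v (c, b, a, e) powr (- t)"
      unfolding v q orbit_sum_def by (simp add: add_ac)
  qed
  also have "\<dots> = 6 * mass n t (a, b, c, e)"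
    using mass_swap12'[of n t a b c e] mass_swap23'[of n t a b c e] mass_swap23'[of n t b a c e]
      mass_swap12'[of n t a c b e] mass_swap12'[of n t b c a e] mass_swap12'[of n t c a b e] by linarith
  finally show ?thesis by (simp add: q)
qed

lemma mass_upper:
  assumes "t \<ge> 0" "0 \<le> a" "0 \<le> b" "0 < a + b" "0 < c"
  shows "mass n t (gap a b c) \<le> 1/2 * ((a + b) powr (- t) + c powr (- t)) * mass n t (gap 0 1 1)"
proof -
  have "6 * mass n t (gap a b c) \<le> (\<Sum>v\<in>disks n. 1/2 * ((a + b) powr (- t) + c powr (- t)) * orbit_sum t v (gap 0 1 1))"
    unfolding mass_orbit_sum by (intro sum_mono orbit_sum_upper in_gap_disks assms)
  also have "\<dots> = 6 * (1/2 * ((a + b) powr (- t) + c powr (- t)) * mass n t (gap 0 1 1))"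
    unfolding sum_distrib_left[symmetric] mass_orbit_sum[symmetric] by simp
  finally show ?thesis by linarith
qed

lemma mass_lower:
  assumes "t \<ge> 0" "0 \<le> a" "0 \<le> b" "0 \<le> c" "0 < b + c" "0 < neck_d a b c"
  shows "(a + (b + c) / 2) powr (- t) * mass n t (gap 0 1 1) \<le> mass n t (gap a b c)"
proof -
  have "6 * ((a + (b + c) / 2) powr (- t) * mass n t (gap 0 1 1)) =
     (\<Sum>v\<in>disks n. (a + (b + c) / 2) powr (- t) * orbit_sum t v (gap 0 1 1))"
    unfolding sum_distrib_left[symmetric] mass_orbit_sum[symmetric] by simp
  also have "\<dots> \<le> 6 * mass n t (gap a b c)"
    unfolding mass_orbit_sum by (intro sum_mono orbit_sum_lower in_gap_disks assms)
  finally show ?thesis by simp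
qed

section \<open>Necklaces as iterated corner subdivisions\<close>

text \<open>Closed form of n successive passages through the face (False, False, True), which keeps
  A and B and replaces the third disk by its antipode. The third curvatures form the chain that
  converges to the tangency point of A and B.\<close>

definition corner :: "nat \<Rightarrow> quad \<Rightarrow> quad" where
  "corner n = (\<lambda>(a, b, c, e). (a, b, c + 2 * (real n)\<^sup>2 * (a + b) + 2 * real n * e, e + 2 * real n * (a + b)))"

fun null :: "quad \<Rightarrow> bool" where
  "null (a, b, c, e) \<longleftrightarrow> 0 \<le> a \<and> 0 \<le> b \<and> 0 \<le> c \<and> 0 \<le> e \<and> e\<^sup>2 = 2 * (a * b + a * c + b * c)"

lemma null_gap: "0 \<le> a \<Longrightarrow> 0 \<le> b \<Longrightarrow> 0 \<le> c \<Longrightarrow> null (gap a b c)"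
  by (simp add: gap_def neck_d_def power_mult_distrib)

text \<open>The sign condition on e selects the root, so the three curvatures determine the
  quadruple. Later identifications of quadruples thus need only the first three entries.\<close>

lemma null_imp_gap:
  assumes "null (a, b, c, e)" shows "(a, b, c, e) = gap a b c"
proof -
  have "sqrt 2 * neck_d a b c = sqrt (e\<^sup>2)"
    using assms by (simp add: neck_d_def real_sqrt_mult[symmetric] del: real_sqrt_abs distrib_left_numeral)
  then show ?thesis using assms by (simp add: gap_def)
qed

text \<open>The choice of fourth entry in \<open>sub\<close> is explained here: s is the mean of
  every antipodal pair, and seen from the far side of the new face the same octahedron has s =
  a'+b'+c'-e'.\<close>

lemma null_sub:
  assumes "null q" "f \<in> faces" shows "null (sub f q)"
proof -
  obtain a b c e where q: "q = (a, b, c, e)" by (metis prod_cases4)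
  have e: "0 \<le> a" "0 \<le> b" "0 \<le> c" "0 \<le> e" "e\<^sup>2 = 2 * (a * b + a * c + b * c)"
    using assms(1) by (auto simp: q)
  have sq: "e * e = 2 * (a * b) + 2 * (a * c) + 2 * (b * c)"
    using e(5) by (simp add: power2_eq_square)
  show ?thesis
    using assms(2) e(1-4) unfolding faces_eq q
    by (auto simp: Let_def power2_eq_square algebra_simps sq)
qed

lemma null_corner: "null q \<Longrightarrow> null (corner n q)"
proof -
  assume q: "null q"
  obtain a b c e where abc: "q = (a, b, c, e)" by (metis prod_cases4)
  have e: "0 \<le> a" "0 \<le> b" "0 \<le> c" "0 \<le> e" "e\<^sup>2 = 2 * (a * b + a * c + b * c)"
    using q by (auto simp: abc)
  have sq: "e * e = 2 * (a * b) + 2 * (a * c) + 2 * (b * c)"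
    using e(5) by (simp add: power2_eq_square)
  show ?thesis
    using e(1-4) by (simp add: abc corner_def power2_eq_square algebra_simps sq)
qed

lemma corner_0 [simp]: "corner 0 q = q"
  by (cases q) (simp add: corner_def)

lemma sub_corner: "sub (False, False, True) (corner n q) = corner (Suc n) q"
  by (cases q) (simp add: corner_def Let_def power2_eq_square algebra_simps)

lemma sqrt_8: "sqrt 8 = 2 * sqrt 2"
  using real_sqrt_mult[of 4 2] by simp

lemma corner_gap:
  assumes "0 \<le> a" "0 \<le> b" "0 \<le> c"
  shows "corner n (gap a b c) = gap a b (neck_c a b c n)"
proof -
  have "\<exists>e. corner n (gap a b c) = (a, b, neck_c a b c n, e)"
    by (simp add: corner_def gap_def neck_c_def sqrt_8)
  then show ?thesis
    by (metis null_corner null_gap assms null_imp_gap)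
qed

text \<open>Applied both to the truncated masses and to their supremum. Symmetry is all that is
  needed to ignore the order in which the list writes the curvatures of a face.\<close>

locale symmetric_fun =
  fixes h :: "quad \<Rightarrow> 'a :: comm_monoid_add"
  assumes h12: "h (swap12 q) = h q" and h23: "h (swap23 q) = h q"
begin

lemma perm:
  "h (gap b a c) = h (gap a b c)" "h (gap a c b) = h (gap a b c)"
proof -
  have "neck_d b a c = neck_d a b c" "neck_d a c b = neck_d a b c"
    by (simp_all add: neck_d_def add_ac mult_ac)
  then show "h (gap b a c) = h (gap a b c)" "h (gap a c b) = h (gap a b c)"
    using h12[of "gap a b c"] h23[of "gap a b c"] by (simp_all add: gap_def)
qed

text \<open>These are the six faces that remain at the n-th step of a chain once the face continuing
  the chain is set aside.\<close>

definition ring_sum :: "real \<Rightarrow> real \<Rightarrow> real \<Rightarrow> nat \<Rightarrow> 'a" where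
  "ring_sum a b c n =
     h (gap a (neck_c a b c n) (neck_cl a b c n)) +
     h (gap a (neck_c a b c (n + 1)) (neck_cl a b c n)) +
     h (gap (neck_c a b c n) (neck_cl a b c n) (neck_cr a b c n)) +
     h (gap (neck_c a b c (n + 1)) (neck_cl a b c n) (neck_cr a b c n)) +
     h (gap b (neck_c a b c n) (neck_cr a b c n)) +
     h (gap b (neck_c a b c (n + 1)) (neck_cr a b c n))"

lemma h_sub:
  assumes "null q" "f \<in> faces"
  shows "h (sub f q) = h (gap (fst (sub f q)) (fst (snd (sub f q))) (fst (snd (snd (sub f q)))))"
  using null_sub[OF assms] null_imp_gap by (metis prod.collapse)

lemma sum_sub_corner:
  assumes abc: "0 \<le> a" "0 \<le> b" "0 \<le> c"
  shows "(\<Sum>f\<in>faces. h (sub f (corner n (gap a b c)))) =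
     ring_sum a b c n + h (corner (Suc n) (gap a b c))"
proof -
  define e where "e = sqrt 2 * neck_d a b c"
  define c\<^sub>n where "c\<^sub>n = neck_c a b c n"
  define c\<^sub>n' where "c\<^sub>n' = neck_c a b c (n + 1)"
  define l where "l = neck_cl a b c n"
  define r where "r = neck_cr a b c n"
  define u where "u = e + 2 * real n * (a + b)"
  have q: "corner n (gap a b c) = (a, b, c\<^sub>n, u)"
    by (simp add: corner_def gap_def c\<^sub>n_def neck_c_def sqrt_8 e_def u_def)
  have nl: "null (a, b, c\<^sub>n, u)"
    unfolding q[symmetric] by (intro null_corner null_gap abc)
  have eqs: "2 * (a + b + c\<^sub>n + u) - a = r" "2 * (a + b + c\<^sub>n + u) - b = l" "2 * (a + b + c\<^sub>n + u) - c\<^sub>n = c\<^sub>n'"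
    unfolding r_def l_def c\<^sub>n_def c\<^sub>n'_def u_def e_def
    by (simp_all add: neck_c_def neck_cl_def neck_cr_def neck_N_def neck_D_def sqrt_8
        power2_eq_square algebra_simps)
  have hs: "h (sub (True, False, False) (a, b, c\<^sub>n, u)) = h (gap b c\<^sub>n r)"
    "h (sub (False, True, False) (a, b, c\<^sub>n, u)) = h (gap a c\<^sub>n l)"
    "h (sub (True, True, False) (a, b, c\<^sub>n, u)) = h (gap c\<^sub>n l r)"
    "h (sub (True, False, True) (a, b, c\<^sub>n, u)) = h (gap b c\<^sub>n' r)"
    "h (sub (False, True, True) (a, b, c\<^sub>n, u)) = h (gap a c\<^sub>n' l)"
    "h (sub (True, True, True) (a, b, c\<^sub>n, u)) = h (gap c\<^sub>n' l r)"
    by - (subst h_sub[OF nl]; simp add: faces_eq Let_def eqs[symmetric] perm)+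
  have "h (corner (Suc n) (gap a b c)) = h (sub (False, False, True) (a, b, c\<^sub>n, u))"
    unfolding sub_corner[symmetric] q ..
  then show ?thesis
    unfolding q faces_eq ring_sum_def c\<^sub>n_def[symmetric] c\<^sub>n'_def[symmetric] l_def[symmetric] r_def[symmetric]
    by (simp add: hs add_ac del: sub.simps)
qed

text \<open>Of the seven faces, the four with at least two replaced disks give the exceptional
  triples; the three with a single replaced disk start the three chains.\<close>

lemma sum_sub_gap:
  assumes abc: "0 \<le> a" "0 \<le> b" "0 \<le> c"
  shows "(\<Sum>f\<in>faces. h (sub f (gap a b c))) =
     (\<Sum>(x, y, z)\<leftarrow>tau_block (a, b, c) 0. h (gap x y z)) +
     (h (corner 1 (gap a b c)) + h (corner 1 (gap b c a)) + h (corner 1 (gap c a b)))"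
proof -
  define e where "e = sqrt 2 * neck_d a b c"
  define c1 where "c1 = neck_c a b c 1"
  define b1 where "b1 = neck_b a b c 1"
  define a1 where "a1 = neck_a a b c 1"
  have q: "gap a b c = (a, b, c, e)" by (simp add: gap_def e_def)
  have nl: "null (a, b, c, e)"
    unfolding q[symmetric] by (intro null_gap abc)
  have eqs: "2 * (a + b + c + e) - a = a1" "2 * (a + b + c + e) - b = b1" "2 * (a + b + c + e) - c = c1"
    unfolding a1_def b1_def c1_def e_def
    by (simp_all add: neck_c_def neck_b_def neck_a_def sqrt_8 algebra_simps)
  have "neck_c b c a 1 = a1" "neck_c c a b 1 = b1"
    by (simp_all add: a1_def b1_def neck_c_def neck_b_def neck_a_def neck_d_def algebra_simps)
  then have cn: "corner 1 (gap a b c) = gap a b c1" "corner 1 (gap b c a) = gap b c a1"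
    "corner 1 (gap c a b) = gap c a b1"
    using abc by (simp_all add: corner_gap c1_def)
  have hs: "h (sub (True, False, False) (a, b, c, e)) = h (gap b c a1)"
    "h (sub (False, True, False) (a, b, c, e)) = h (gap c a b1)"
    "h (sub (False, False, True) (a, b, c, e)) = h (gap a b c1)"
    "h (sub (True, True, False) (a, b, c, e)) = h (gap c b1 a1)"
    "h (sub (True, False, True) (a, b, c, e)) = h (gap b c1 a1)"
    "h (sub (False, True, True) (a, b, c, e)) = h (gap a c1 b1)"
    "h (sub (True, True, True) (a, b, c, e)) = h (gap c1 b1 a1)"
    by - (subst h_sub[OF nl]; simp add: faces_eq Let_def eqs[symmetric] perm)+
  have "tau_block (a, b, c) 0 = [(a, c1, b1), (b, c1, a1), (c, b1, a1), (c1, b1, a1)]"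
    by (simp add: tau_block_def Let_def a1_def b1_def c1_def)
  then show ?thesis
    unfolding q cn[unfolded q] faces_eq cn by (simp add: hs add_ac del: sub.simps)
qed

text \<open>The eighteen triples are three rings of six, one per corner; cyclic relabelling turns
  the c-necklace into the a- and b-necklaces.\<close>

lemma tau_block_sum:
  assumes "n \<ge> 1"
  shows "(\<Sum>(x, y, z)\<leftarrow>tau_block (a, b, c) n. h (gap x y z)) =
     ring_sum a b c n + ring_sum b c a n + ring_sum c a b n"
proof -
  have eqs: "neck_c b c a = neck_a a b c" "neck_cl b c a = neck_al a b c" "neck_cr b c a = neck_ar a b c"
     "neck_c c a b = neck_b a b c" "neck_cl c a b = neck_bl a b c" "neck_cr c a b = neck_br a b c"
    by (simp_all add: fun_eq_iff neck_c_def neck_b_def neck_a_def neck_cl_def neck_cr_def neck_bl_def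
        neck_br_def neck_al_def neck_ar_def neck_D_def neck_d_def algebra_simps)
  show ?thesis
    unfolding ring_sum_def eqs using assms perm(2)
    by (simp add: tau_block_def Let_def add_ac)
qed

end

section \<open>Growth of curvatures along the lists\<close>

definition sorted_triple :: "triple \<Rightarrow> bool" where
  "sorted_triple = (\<lambda>(x, y, z). 0 \<le> x \<and> x \<le> y \<and> y \<le> z \<and> 0 < y)"

text \<open>This is the curvature of the \<open>n\<close>-th necklace disk of the gap of \<open>(0, 1, 1)\<close>.\<close>

definition growth :: "nat \<Rightarrow> real" where
  "growth n = (1 + sqrt 2 * real n)\<^sup>2"

lemma growth_1: "growth 1 = 3 + 2 * sqrt 2"
  by (simp add: growth_def power2_eq_square algebra_simps)

text \<open>To be used for all three corners with m the middle curvature; the disjunction covers the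
  corner whose third curvature is the smallest one, possibly 0. The constant 9/2 is sharp
  coefficientwise: for n = 1 the coefficient of q is 1+4+4 = 9 in L and 2 in A.\<close>

lemma ring_bounds:
  fixes p q r m :: real and n :: nat
  assumes pos: "0 \<le> p" "0 \<le> q" "0 \<le> r" "0 \<le> m" and m: "m \<le> p + q" "m \<le> r \<or> (m \<le> p \<and> m \<le> q)"
    and d: "m \<le> neck_d p q r" and n: "n \<ge> 1"
  defines "A \<equiv> neck_c p q r n" and "A' \<equiv> neck_c p q r (n + 1)"
    and "L \<equiv> neck_cl p q r n" and "R \<equiv> neck_cr p q r n"
  shows "growth n * m \<le> A" "A \<le> A'" "A' \<le> L" "A' \<le> R" "p \<le> A" "q \<le> A"
    "p \<le> q \<Longrightarrow> L \<le> R" "q \<le> p \<Longrightarrow> R \<le> L"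
    "L \<le> 9/2 * (p + A)" "R \<le> 9/2 * (q + A)" "L \<le> 9/2 * (A + R)" "R \<le> 9/2 * (A + L)"
proof -
  define N where "N = real n"
  define g where "g = sqrt 8 * neck_d p q r"
  define k where "k = sqrt 2 * m"
  have N: "1 \<le> N" using n by (simp add: N_def)
  have g0: "0 \<le> g" unfolding g_def neck_d_def using pos by simp
  have kg: "2 * k \<le> g" unfolding g_def k_def using d by (simp add: sqrt_8 mult_left_mono)
  have up: "x \<le> N * x" "N * x \<le> N * (N * x)" if "0 \<le> x" for x
    using mult_right_mono[of 1 N x] mult_right_mono[of 1 N "N * x"] that N by auto
  have pq: "0 \<le> N * (N * p)" "0 \<le> N * (N * q)" using pos N by auto
  note facts = up[OF pos(1)] up[OF pos(2)] up[OF pos(3)] up[OF g0] pos g0 kg N pq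
  have growth: "growth n * m = m + 2 * (N * k) + 2 * (N * (N * m))"
    by (simp add: growth_def N_def k_def power2_eq_square algebra_simps)
  have A: "A = r + 2 * (N * (N * p)) + 2 * (N * (N * q)) + N * g"
    by (simp add: A_def neck_c_def N_def g_def power2_eq_square algebra_simps)
  have A': "A' = r + 2 * (N * (N * p)) + 2 * (N * (N * q)) + 4 * (N * p) + 4 * (N * q) + 2 * p + 2 * q + N * g + g"
    by (simp add: A'_def neck_c_def N_def g_def power2_eq_square algebra_simps)
  have L: "L = 2 * p + q + 2 * r + 4 * (N * (N * p)) + 4 * (N * p) + 4 * (N * (N * q)) + 4 * (N * q) + 2 * (N * g) + g"
    by (simp add: L_def neck_cl_def neck_N_def neck_D_def N_def g_def power2_eq_square algebra_simps)
  have R: "R = p + 2 * q + 2 * r + 4 * (N * (N * p)) + 4 * (N * p) + 4 * (N * (N * q)) + 4 * (N * q) + 2 * (N * g) + g"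
    by (simp add: R_def neck_cr_def neck_N_def neck_D_def N_def g_def power2_eq_square algebra_simps)
  have Nk: "2 * (N * k) \<le> N * g" using mult_left_mono[OF kg, of N] N by simp
  have Nm: "N * (N * m) \<le> N * (N * p) + N * (N * q)"
    using mult_left_mono[OF mult_left_mono[OF m(1), of N], of N] N by (simp add: distrib_left)
  show "growth n * m \<le> A"
    using m(2)
  proof
    assume "m \<le> r"
    then show ?thesis unfolding growth A using Nk Nm by linarith
  next
    assume *: "m \<le> p \<and> m \<le> q"
    then have "N * (N * m) \<le> N * (N * p)" "N * (N * m) \<le> N * (N * q)"
      using N by (auto intro!: mult_left_mono)
    then show ?thesis unfolding growth A using Nk up[OF pos(4)] pos by linarith
  qed
  have nonneg: "0 \<le> N * p" "0 \<le> N * q" "0 \<le> N * g"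
    using pos g0 N by auto
  have A0: "0 \<le> A" "0 \<le> L" "0 \<le> R" unfolding A L R using pos pq nonneg g0 by linarith+
  show "A \<le> A'" unfolding A A' using pos nonneg g0 by linarith
  show "A' \<le> L" "A' \<le> R" "p \<le> A" "q \<le> A" unfolding A A' L R using facts nonneg by linarith+
  show "L \<le> 9/2 * (p + A)" "R \<le> 9/2 * (q + A)"
    unfolding A L R distrib_left using facts nonneg by linarith+
  have "R \<le> 2 * L" "L \<le> 2 * R" unfolding L R distrib_left using pos pq nonneg g0 by linarith+
  then show "L \<le> 9/2 * (A + R)" "R \<le> 9/2 * (A + L)"
    unfolding distrib_left using A0 by linarith+
  show "L \<le> R" if "p \<le> q" using that unfolding L R by linarith
  show "R \<le> L" if "q \<le> p" using that unfolding L R by linarith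
qed

lemma tau_block_bounds:
  assumes s: "sorted_triple (a, b, c)" and mem: "(x, y, z) \<in> set (tau_block (a, b, c) n)"
  shows "0 \<le> x" "x \<le> y" "y \<le> z" "growth (max 1 n) * b \<le> y" "z \<le> 9/2 * (x + y)"
proof -
  have abc: "0 \<le> a" "a \<le> b" "b \<le> c" "0 < b" using s by (auto simp: sorted_triple_def)
  have "b \<le> sqrt (b * c)" using abc by (intro real_le_rsqrt) (simp add: power2_eq_square)
  also have "\<dots> \<le> neck_d a b c" unfolding neck_d_def using abc by (intro real_sqrt_le_mono) simp
  finally have d: "b \<le> neck_d a b c" .
  have sym: "neck_d b c a = neck_d a b c" "neck_d c a b = neck_d a b c"
    by (simp_all add: neck_d_def algebra_simps)
  have eqs: "neck_c b c a = neck_a a b c" "neck_cl b c a = neck_al a b c" "neck_cr b c a = neck_ar a b c"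
     "neck_c c a b = neck_b a b c" "neck_cl c a b = neck_bl a b c" "neck_cr c a b = neck_br a b c"
    by (simp_all add: fun_eq_iff neck_c_def neck_b_def neck_a_def neck_cl_def neck_cr_def neck_bl_def
        neck_br_def neck_al_def neck_ar_def neck_D_def neck_d_def algebra_simps)
  have C: "0 \<le> a" "0 \<le> b" "0 \<le> c" "0 \<le> b" "b \<le> a + b" "b \<le> c \<or> (b \<le> a \<and> b \<le> b)" "b \<le> neck_d a b c"
    using abc d by auto
  have A: "0 \<le> b" "0 \<le> c" "0 \<le> a" "0 \<le> b" "b \<le> b + c" "b \<le> a \<or> (b \<le> b \<and> b \<le> c)" "b \<le> neck_d b c a"
    using abc d sym by auto
  have B: "0 \<le> c" "0 \<le> a" "0 \<le> b" "0 \<le> b" "b \<le> c + a" "b \<le> b \<or> (b \<le> c \<and> b \<le> a)" "b \<le> neck_d c a b"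
    using abc d sym by auto
  have pos: "0 \<le> growth k * b" for k using abc by (simp add: growth_def)
  have "0 \<le> x \<and> x \<le> y \<and> y \<le> z \<and> growth (max 1 n) * b \<le> y \<and> z \<le> 9/2 * (x + y)"
  proof (cases "n = 0")
    case True
    note bounds = ring_bounds(1,5,6)[OF C, of 1] ring_bounds(1,5,6)[OF A, of 1, unfolded eqs]
      ring_bounds(1,5,6)[OF B, of 1, unfolded eqs]
    define g where "g = sqrt 8 * neck_d a b c"
    have g: "0 \<le> g" using d abc by (simp add: g_def)
    have eq: "neck_c a b c 1 = 2 * a + 2 * b + c + g" "neck_b a b c 1 = 2 * a + b + 2 * c + g"
      "neck_a a b c 1 = a + 2 * b + 2 * c + g"
      by (simp_all add: neck_c_def neck_b_def neck_a_def g_def)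
    show ?thesis
      using mem True bounds abc g unfolding tau_block_def Let_def
      by (auto simp: eq[unfolded One_nat_def])
  next
    case False
    then have n: "n \<ge> 1" "max 1 n = n" by auto
    \<comment> \<open>Each corner contributes twelve facts. Of the two conditional orderings of L
      and R in each corner, the one that matches a \<le> b \<le> c is selected below: number 7, 19
      and 32.\<close>
    note bounds = ring_bounds[OF C n(1)] ring_bounds[OF A n(1), unfolded eqs]
      ring_bounds[OF B n(1), unfolded eqs]
    show ?thesis
      using mem False bounds(1-6,9-18,21-30,33-36) bounds(7)[OF abc(2)] bounds(19)[OF abc(3)]
        bounds(32)[OF order_trans[OF abc(2,3)]] abc pos[of n] n(2)
      unfolding tau_block_def Let_def
      by (auto; linarith)
  qed
  then show "0 \<le> x" "x \<le> y" "y \<le> z" "growth (max 1 n) * b \<le> y" "z \<le> 9/2 * (x + y)"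
    by auto
qed

lemma growth_mono: "m \<le> n \<Longrightarrow> growth m \<le> growth n"
  unfolding growth_def by (intro power_mono add_mono mult_left_mono) auto

lemma growth_ge_1: "1 \<le> growth n"
  unfolding growth_def by (simp add: power2_eq_square algebra_simps)

section \<open>Sums over lists of triples\<close>

text \<open>Extended nonnegative values avoid all summability conditions when lists are split and
  rearranged.\<close>

definition wsum :: "('l \<times> triple) set \<Rightarrow> (triple \<Rightarrow> ennreal) \<Rightarrow> ennreal" where
  "wsum L h = (\<integral>\<^sup>+p. h (snd p) \<partial>count_space L)"

definition tau_sum :: "(triple \<Rightarrow> ennreal) \<Rightarrow> triple \<Rightarrow> ennreal" where
  "tau_sum h s = (\<Sum>n. \<Sum>s'\<leftarrow>tau_block s n. h s')"

lemma nn_integral_count_space_UNIV: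
  "(\<integral>\<^sup>+x. f x \<partial>count_space X) = (\<integral>\<^sup>+x. f x * indicator X x \<partial>count_space UNIV)"
  by (simp add: nn_integral_restrict_space[symmetric] restrict_count_space)

lemma nn_integral_count_space_Sigma:
  fixes f :: "'a \<times> 'b \<Rightarrow> ennreal"
  shows "(\<integral>\<^sup>+z. f z \<partial>count_space (Sigma A B)) = (\<integral>\<^sup>+x. (\<integral>\<^sup>+y. f (x, y) \<partial>count_space (B x)) \<partial>count_space A)"
proof -
  have "(\<integral>\<^sup>+x. (\<integral>\<^sup>+y. f (x, y) \<partial>count_space (B x)) \<partial>count_space A) =
      (\<integral>\<^sup>+x. (\<integral>\<^sup>+y. f (x, y) * indicator (B x) y \<partial>count_space UNIV) * indicator A x \<partial>count_space UNIV)"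
    by (simp only: nn_integral_count_space_UNIV[of A] nn_integral_count_space_UNIV[of "B _"])
  also have "\<dots> = (\<integral>\<^sup>+x. (\<integral>\<^sup>+y. f (x, y) * indicator (Sigma A B) (x, y) \<partial>count_space UNIV) \<partial>count_space UNIV)"
    by (subst nn_integral_multc[symmetric]) (auto intro!: nn_integral_cong split: split_indicator)
  also have "\<dots> = (\<integral>\<^sup>+z. f z * indicator (Sigma A B) z \<partial>count_space UNIV)"
    by (rule nn_integral_fst_count_space)
  finally show ?thesis by (simp add: nn_integral_count_space_indicator)
qed

lemma wsum_mono: "(\<And>w s. (w, s) \<in> L \<Longrightarrow> h s \<le> h' s) \<Longrightarrow> wsum L h \<le> wsum L h'"
  unfolding wsum_def by (intro nn_integral_mono) auto

lemma wsum_cong: "(\<And>w s. (w, s) \<in> L \<Longrightarrow> h s = h' s) \<Longrightarrow> wsum L h = wsum L h'"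
  unfolding wsum_def by (intro nn_integral_cong) auto

lemma wsum_add: "wsum L (\<lambda>s. h s + h' s) = wsum L h + wsum L h'"
  unfolding wsum_def by (subst nn_integral_add) auto

lemma wsum_cmult: "wsum L (\<lambda>s. c * h s) = c * wsum L h"
  unfolding wsum_def by (subst nn_integral_cmult) auto

lemma wsum_reindex:
  assumes "bij_betw g A B" "\<And>w s. (w, s) \<in> A \<Longrightarrow> snd (g (w, s)) = s"
  shows "wsum B h = wsum A h"
proof -
  have "wsum B h = (\<integral>\<^sup>+p. h (snd (g p)) \<partial>count_space A)"
    unfolding wsum_def by (rule nn_integral_bij_count_space[OF assms(1), symmetric])
  also have "\<dots> = wsum A h"
    unfolding wsum_def using assms(2) by (intro nn_integral_cong) auto
  finally show ?thesis .
qed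

lemma wsum_tau: "wsum (tau s) h = tau_sum h s"
proof -
  let ?I = "SIGMA n:UNIV. {..<length (tau_block s n)}"
  have "bij_betw (\<lambda>(n, j). ((n, j), tau_block s n ! j)) ?I (tau s)"
    by (auto simp: bij_betw_def inj_on_def tau_def image_iff)
  then have "wsum (tau s) h = (\<integral>\<^sup>+i. h (snd (case i of (n, j) \<Rightarrow> ((n, j), tau_block s n ! j))) \<partial>count_space ?I)"
    unfolding wsum_def by (rule nn_integral_bij_count_space[symmetric])
  also have "\<dots> = (\<Sum>n. \<Sum>j<length (tau_block s n). h (tau_block s n ! j))"
    unfolding nn_integral_count_space_Sigma
    by (simp add: nn_integral_count_space_finite nn_integral_count_space_nat)
  finally show ?thesis
    unfolding tau_sum_def by (simp add: sum_list_sum_nth atLeast0LessThan)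
qed

lemma wsum_tau_list: "wsum (tau_list s) h = tau_sum h s"
proof -
  have "bij_betw (\<lambda>(i, s). ([i], s)) (tau s) (tau_list s)"
    by (auto simp: bij_betw_def inj_on_def tau_list_def image_iff)
  then have "wsum (tau_list s) h = wsum (tau s) h" by (rule wsum_reindex) auto
  then show ?thesis by (simp add: wsum_tau)
qed

text \<open>Labels grow at the front, so a suffix of a label is the label of an ancestor. The
  condition says that no entry is a proper descendant of another; it keeps new labels from colliding
  with kept ones.\<close>

definition suffix_free :: "(label \<times> triple) set \<Rightarrow> bool" where
  "suffix_free L \<longleftrightarrow> (\<forall>w s v s'. (w, s) \<in> L \<longrightarrow> (v @ w, s') \<in> L \<longrightarrow> v = [] \<and> s = s')"

lemma suffix_freeD:
  assumes "suffix_free L" "(w, s) \<in> L" "(v @ w, s') \<in> L"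
  shows "v = [] \<and> s = s'"
  using assms unfolding suffix_free_def by blast

lemma tau_functional: "(i, s) \<in> tau q \<Longrightarrow> (i, s') \<in> tau q \<Longrightarrow> s = s'"
  by (auto simp: tau_def)

lemma suffix_free_tau_list: "suffix_free (tau_list s)"
  unfolding suffix_free_def tau_list_def by (auto dest: tau_functional)

definition refined :: "real \<Rightarrow> triple \<Rightarrow> bool" where
  "refined \<kappa> = (\<lambda>(x, y, z). y < \<kappa>)"

lemma refine_cases:
  assumes "(u, r) \<in> refine \<kappa> L"
  obtains (keep) "(u, r) \<in> L" "\<not> refined \<kappa> r"
    | (split) i w s where "u = i # w" "(w, s) \<in> L" "refined \<kappa> s" "(i, r) \<in> tau s"
  using assms unfolding refine_def refined_def by auto

lemma refine_keep: "(w, s) \<in> L \<Longrightarrow> \<not> refined \<kappa> s \<Longrightarrow> (w, s) \<in> refine \<kappa> L"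
  unfolding refine_def refined_def by (cases s) auto

lemma refine_split: "(w, s) \<in> L \<Longrightarrow> refined \<kappa> s \<Longrightarrow> (i, r) \<in> tau s \<Longrightarrow> (i # w, r) \<in> refine \<kappa> L"
  unfolding refine_def refined_def by (cases s) force

lemma suffix_free_refine:
  assumes L: "suffix_free L" shows "suffix_free (refine \<kappa> L)"
  unfolding suffix_free_def
proof (intro allI impI)
  fix u r v r'
  assume "(u, r) \<in> refine \<kappa> L" and vu: "(v @ u, r') \<in> refine \<kappa> L"
  then show "v = [] \<and> r = r'"
  proof (cases rule: refine_cases)
    case keep
    from vu show ?thesis
    proof (cases rule: refine_cases)
      case k2: keep
      then show ?thesis using suffix_freeD[OF L] keep by blast
    next
      case (split i w s)
      show ?thesis
      proof (cases v)
        case Nil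
        then have "([i] @ w, r) \<in> L" using keep split by simp
        then show ?thesis using suffix_freeD[OF L split(2)] by blast
      next
        case (Cons i' v')
        then have "(v' @ u, s) \<in> L" using split by simp
        then show ?thesis using suffix_freeD[OF L keep(1)] keep(2) split(3) by blast
      qed
    qed
  next
    case s1: (split i w s)
    from vu show ?thesis
    proof (cases rule: refine_cases)
      case keep
      then have "((v @ [i]) @ w, r') \<in> L" using s1 by simp
      then show ?thesis using suffix_freeD[OF L s1(2)] by blast
    next
      case (split i' w' s')
      show ?thesis
      proof (cases v)
        case Nil
        then have "i' = i" "([] @ w, s') \<in> L" using s1 split by auto
        then show ?thesis using suffix_freeD[OF L s1(2)] s1 split Nil tau_functional by blast
      next
        case (Cons j v')
        then have "((v' @ [i]) @ w, s') \<in> L" using split s1 by simp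
        then show ?thesis using suffix_freeD[OF L s1(2)] by blast
      qed
    qed
  qed
qed

lemma wsum_refine:
  assumes L: "suffix_free L"
  shows "wsum (refine \<kappa> L) h = wsum L (\<lambda>s. if refined \<kappa> s then tau_sum h s else h s)"
proof -
  \<comment> \<open>The refined list is parametrized by an old entry together with an option:
    \<open>None\<close> keeps the entry, \<open>Some\<close> selects one of its
    replacements.\<close>
  define opts where "opts p = (if refined \<kappa> (snd p) then Some ` tau (snd p) else {None})"
    for p :: "label \<times> triple"
  define g where "g z = (case snd z of None \<Rightarrow> fst z | Some (i, s') \<Rightarrow> (i # fst (fst z), s'))"
    for z :: "(label \<times> triple) \<times> ((nat \<times> nat) \<times> triple) option"
  have bij: "bij_betw g (Sigma L opts) (refine \<kappa> L)"
    unfolding bij_betw_def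
  proof
    show "inj_on g (Sigma L opts)"
    proof (rule inj_onI)
      fix z1 z2
      assume z: "z1 \<in> Sigma L opts" "z2 \<in> Sigma L opts" and "g z1 = g z2"
      moreover obtain w s o1 w' s' o2 where zs: "z1 = ((w, s), o1)" "z2 = ((w', s'), o2)"
        by (metis prod.collapse)
      ultimately have A: "(w, s) \<in> L" "o1 \<in> opts (w, s)" "(w', s') \<in> L" "o2 \<in> opts (w', s')"
        and eq: "g ((w, s), o1) = g ((w', s'), o2)" by auto
      have "(w = w' \<and> s = s') \<and> o1 = o2"
      proof (cases o1; cases o2)
        assume "o1 = None" "o2 = None"
        then show ?thesis using eq by (simp add: g_def)
      next
        fix j assume "o1 = None" "o2 = Some j"
        moreover obtain i r where "j = (i, r)" by (cases j)
        ultimately have "([i] @ w', s) \<in> L" using A eq by (auto simp: g_def)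
        then show ?thesis using suffix_freeD[OF L A(3)] by blast
      next
        fix j assume "o1 = Some j" "o2 = None"
        moreover obtain i r where "j = (i, r)" by (cases j)
        ultimately have "([i] @ w, s') \<in> L" using A eq by (auto simp: g_def)
        then show ?thesis using suffix_freeD[OF L A(1)] by blast
      next
        fix j j' assume o: "o1 = Some j" "o2 = Some j'"
        obtain i r i' r' where j: "j = (i, r)" "j' = (i', r')" by (cases j; cases j')
        have "i = i'" "w = w'" "r = r'" using o j eq by (auto simp: g_def)
        moreover have "s = s'" using suffix_freeD[OF L A(1), of "[]" s'] A(3) \<open>w = w'\<close> by simp
        ultimately show ?thesis using o j by simp
      qed
      then show "z1 = z2" by (simp add: zs)
    qed
    show "g ` Sigma L opts = refine \<kappa> L"
    proof (intro equalityI subsetI)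
      fix p assume "p \<in> g ` Sigma L opts"
      then obtain w s o' where "(w, s) \<in> L" "o' \<in> opts (w, s)" "p = g ((w, s), o')" by auto
      then show "p \<in> refine \<kappa> L"
        by (auto simp: opts_def g_def intro: refine_keep refine_split split: if_splits)
    next
      fix p assume "p \<in> refine \<kappa> L"
      moreover obtain u r where p: "p = (u, r)" by (cases p)
      ultimately have "(u, r) \<in> refine \<kappa> L" by simp
      then show "p \<in> g ` Sigma L opts"
      proof (cases rule: refine_cases)
        case keep
        then show ?thesis
          by (auto simp: p g_def opts_def intro!: image_eqI[of _ _ "((u, r), None)"])
      next
        case (split i w s)
        then show ?thesis
          by (auto simp: p g_def opts_def intro!: image_eqI[of _ _ "((w, s), Some (i, r))"])
      qed
    qed
  qed
  have "wsum (refine \<kappa> L) h = (\<integral>\<^sup>+z. h (snd (g z)) \<partial>count_space (Sigma L opts))"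
    unfolding wsum_def by (rule nn_integral_bij_count_space[OF bij, symmetric])
  also have "\<dots> = (\<integral>\<^sup>+p. (\<integral>\<^sup>+o'. h (snd (g (p, o'))) \<partial>count_space (opts p)) \<partial>count_space L)"
    by (rule nn_integral_count_space_Sigma)
  also have "\<dots> = wsum L (\<lambda>s. if refined \<kappa> s then tau_sum h s else h s)"
    unfolding wsum_def
  proof (rule nn_integral_cong)
    fix p :: "label \<times> triple"
    have "bij_betw Some (tau (snd p)) (Some ` tau (snd p))" by (auto simp: bij_betw_def)
    from nn_integral_bij_count_space[OF this, of "\<lambda>o'. h (snd (g (p, o')))"]
    have "(\<integral>\<^sup>+o'. h (snd (g (p, o'))) \<partial>count_space (Some ` tau (snd p))) = wsum (tau (snd p)) h"
      unfolding wsum_def by (simp add: g_def split_beta)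
    then show "(\<integral>\<^sup>+o'. h (snd (g (p, o'))) \<partial>count_space (opts p)) =
        (if refined \<kappa> (snd p) then tau_sum h (snd p) else h (snd p))"
      by (simp add: opts_def wsum_tau nn_integral_count_space_finite) (simp add: g_def)
  qed
  finally show ?thesis .
qed

lemma wsum_refine_le:
  assumes "suffix_free L" "\<And>w s. (w, s) \<in> L \<Longrightarrow> tau_sum h s \<le> h s"
  shows "wsum (refine \<kappa> L) h \<le> wsum L h"
  unfolding wsum_refine[OF assms(1)] using assms(2) by (intro wsum_mono) auto

definition triples :: "real \<Rightarrow> nat \<Rightarrow> (label \<times> triple) set" where
  "triples \<kappa> m = (refine \<kappa> ^^ m) (tau_list (0, 1, 1))"

lemma triples_0: "triples \<kappa> 0 = tau_list (0, 1, 1)"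
  by (simp add: triples_def)

lemma triples_Suc: "triples \<kappa> (Suc m) = refine \<kappa> (triples \<kappa> m)"
  by (simp add: triples_def)

lemma suffix_free_triples: "suffix_free (triples \<kappa> m)"
  by (induction m) (simp_all add: triples_0 triples_Suc suffix_free_tau_list suffix_free_refine)

lemma sorted_base: "sorted_triple (0, 1, 1)"
  by (simp add: sorted_triple_def)

lemma tau_elim:
  assumes "(i, r) \<in> tau s"
  obtains n where "r \<in> set (tau_block s n)"
  using assms nth_mem unfolding tau_def by fastforce

text \<open>The last conjunct controls how unbalanced a triple can be; it is what makes the f and g
  summands comparable.\<close>

definition well_formed :: "triple \<Rightarrow> bool" where
  "well_formed = (\<lambda>(x, y, z). 0 \<le> x \<and> x \<le> y \<and> y \<le> z \<and> growth 1 \<le> y \<and> z \<le> 9/2 * (x + y))"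

lemma well_formed_sorted: "well_formed s \<Longrightarrow> sorted_triple s"
  using growth_ge_1[of 1] by (auto simp: well_formed_def sorted_triple_def)

lemma tau_well_formed:
  assumes "sorted_triple (a, b, c)" "1 \<le> b" "(i, (x, y, z)) \<in> tau (a, b, c)"
  shows "well_formed (x, y, z)" "growth 1 * b \<le> y"
proof -
  obtain n where n: "(x, y, z) \<in> set (tau_block (a, b, c) n)" using tau_elim[OF assms(3)] .
  note bounds = tau_block_bounds[OF assms(1) n]
  have "growth 1 * b \<le> growth (max 1 n) * b" using growth_mono[of 1 "max 1 n"] assms(2) by simp
  then show *: "growth 1 * b \<le> y" using bounds(4) by linarith
  have "growth 1 * 1 \<le> growth 1 * b" using growth_ge_1[of 1] assms(2) by (intro mult_left_mono) auto
  then show "well_formed (x, y, z)" using * bounds by (simp add: well_formed_def)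
qed

text \<open>The exponent is \<open>Suc m\<close> because the starting list is already one
  application of \<open>tau\<close>. An entry either is left alone, having reached
  \<open>\<kappa>\<close>, or gains a factor \<open>growth 1\<close> in every round.\<close>

lemma triples_well_formed:
  assumes "(w, (x, y, z)) \<in> triples \<kappa> m"
  shows "well_formed (x, y, z)" "\<kappa> \<le> y \<or> growth 1 ^ Suc m \<le> y"
proof -
  have "well_formed (x, y, z) \<and> (\<kappa> \<le> y \<or> growth 1 ^ Suc m \<le> y)"
    using assms
  proof (induction m arbitrary: w x y z)
    case 0
    then obtain i where "(i, (x, y, z)) \<in> tau (0, 1, 1)" by (auto simp: triples_0 tau_list_def)
    from tau_well_formed[OF sorted_base _ this] show ?case by simp
  next
    case (Suc m)
    from Suc.prems[unfolded triples_Suc] show ?case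
    proof (cases rule: refine_cases)
      case keep
      then show ?thesis using Suc.IH by (auto simp: refined_def)
    next
      case (split i v s)
      obtain a b c where s: "s = (a, b, c)" by (metis prod_cases3)
      have IH: "well_formed (a, b, c)" "growth 1 ^ Suc m \<le> b"
        using Suc.IH[of v a b c] split s by (auto simp: refined_def)
      have b: "1 \<le> b" using IH(1) growth_ge_1[of 1] by (auto simp: well_formed_def)
      note wf = tau_well_formed[OF well_formed_sorted[OF IH(1)] b split(4)[unfolded s]]
      have "growth 1 ^ Suc (Suc m) \<le> growth 1 * b"
        using IH(2) growth_ge_1[of 1] by (simp add: mult_left_mono)
      then show ?thesis using wf by linarith
    qed
  qed
  then show "well_formed (x, y, z)" "\<kappa> \<le> y \<or> growth 1 ^ Suc m \<le> y" by auto
qed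

section \<open>Bounds for the mass of a gap in terms of the lists\<close>

definition tip_sum :: "real \<Rightarrow> quad \<Rightarrow> real" where
  "tip_sum t q = (\<Sum>v\<in>tips. dotq v q powr (- t))"

definition total :: "real \<Rightarrow> quad \<Rightarrow> ennreal" where
  "total t q = (SUP n. ennreal (mass n t q))"

definition on_gap :: "(quad \<Rightarrow> 'a) \<Rightarrow> triple \<Rightarrow> 'a" where
  "on_gap h = (\<lambda>(x, y, z). h (gap x y z))"

lemma mass_nonneg: "0 \<le> mass n t q"
  by (simp add: mass_def sum_nonneg)

lemma mass_mono: "m \<le> n \<Longrightarrow> mass m t q \<le> mass n t q"
  unfolding mass_def by (intro sum_mono2 disks_mono) auto

lemma ennreal_mass_Suc:
  "ennreal (mass (Suc n) t q) = ennreal (tip_sum t q) + (\<Sum>f\<in>faces. ennreal (mass n t (sub f q)))"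
  by (simp add: mass_Suc tip_sum_def mass_nonneg sum_nonneg)

lemma incseq_mass: "incseq (\<lambda>n. ennreal (mass n t q))"
  by (auto simp: incseq_def intro: ennreal_leI mass_mono)

interpretation mass: symmetric_fun "\<lambda>q. ennreal (mass n t q)" for n t
  by unfold_locales (simp_all add: mass_swap12 mass_swap23)

interpretation total: symmetric_fun "total t" for t
  by unfold_locales (simp_all add: total_def mass_swap12 mass_swap23)

lemma SUP_sum_ennreal:
  fixes f :: "'i \<Rightarrow> nat \<Rightarrow> ennreal"
  assumes "finite I" "\<And>i. i \<in> I \<Longrightarrow> incseq (f i)"
  shows "(SUP n. \<Sum>i\<in>I. f i n) = (\<Sum>i\<in>I. SUP n. f i n)"
  using assms
proof (induction I)
  case (insert i I)
  have "incseq (\<lambda>n. \<Sum>i\<in>I. f i n)"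
    using insert.prems by (auto simp: incseq_def intro!: sum_mono)
  then show ?case
    using insert by (simp add: ennreal_SUP_add)
qed simp

lemma total_ge_sub: "(\<Sum>f\<in>faces. total t (sub f q)) \<le> total t q"
proof -
  have "(\<Sum>f\<in>faces. total t (sub f q)) = (SUP n. \<Sum>f\<in>faces. ennreal (mass n t (sub f q)))"
    unfolding total_def by (rule SUP_sum_ennreal[symmetric]) (simp_all add: incseq_mass)
  also have "\<dots> \<le> total t q"
    unfolding total_def
  proof (rule SUP_mono)
    fix n
    have "(\<Sum>f\<in>faces. ennreal (mass n t (sub f q))) \<le> ennreal (mass (Suc n) t q)"
      unfolding ennreal_mass_Suc by simp
    then show "\<exists>m\<in>UNIV. (\<Sum>f\<in>faces. ennreal (mass n t (sub f q))) \<le> ennreal (mass m t q)" by blast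
  qed
  finally show ?thesis .
qed

text \<open>Dropping the antipodal disks at every step of the chain gives a superadditive bound,
  iterated N times from an arbitrary position k.\<close>

lemma total_corner:
  assumes "0 \<le> a" "0 \<le> b" "0 \<le> c"
  shows "(\<Sum>j<N. total.ring_sum t a b c (Suc j)) \<le> total t (corner 1 (gap a b c))"
proof -
  have "(\<Sum>j<N. total.ring_sum t a b c (k + j)) \<le> total t (corner k (gap a b c))" for k
  proof (induction N arbitrary: k)
    case (Suc N)
    have "(\<Sum>j<Suc N. total.ring_sum t a b c (k + j)) =
        total.ring_sum t a b c k + (\<Sum>j<N. total.ring_sum t a b c (Suc k + j))"
      by (subst sum.lessThan_Suc_shift) simp
    also have "\<dots> \<le> total.ring_sum t a b c k + total t (corner (Suc k) (gap a b c))"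
      by (intro add_left_mono Suc.IH)
    also have "\<dots> \<le> total t (corner k (gap a b c))"
      using total_ge_sub[of t "corner k (gap a b c)"] total.sum_sub_corner[OF assms, of t k] by simp
    finally show ?case .
  qed simp
  from this[of 1] show ?thesis by simp
qed

lemma sum_list_on_gap: "(\<Sum>(x, y, z)\<leftarrow>l. h (gap x y z)) = (\<Sum>s\<leftarrow>l. on_gap h s)"
  by (simp add: on_gap_def)

text \<open>The triples of the list describe disjoint parts of the gap; only finite partial sums
  need to be checked.\<close>

lemma tau_sum_le_total:
  assumes "sorted_triple s"
  shows "tau_sum (on_gap (total t)) s \<le> on_gap (total t) s"
proof -
  obtain a b c where s: "s = (a, b, c)" by (metis prod_cases3)
  have abc: "0 \<le> a" "0 \<le> b" "0 \<le> c" using assms by (auto simp: s sorted_triple_def)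
  have block: "(\<Sum>s'\<leftarrow>tau_block s (Suc n). on_gap (total t) s') =
      total.ring_sum t a b c (Suc n) + total.ring_sum t b c a (Suc n) + total.ring_sum t c a b (Suc n)" for n
    unfolding sum_list_on_gap[symmetric] s by (rule total.tau_block_sum) simp
  show ?thesis
    unfolding tau_sum_def
  proof (rule suminf_le_const[OF summableI])
    fix N
    have "(\<Sum>n<N. \<Sum>s'\<leftarrow>tau_block s n. on_gap (total t) s')
        \<le> (\<Sum>n<Suc N. \<Sum>s'\<leftarrow>tau_block s n. on_gap (total t) s')" by simp
    also have "\<dots> = (\<Sum>s'\<leftarrow>tau_block s 0. on_gap (total t) s') +
        ((\<Sum>n<N. total.ring_sum t a b c (Suc n)) + (\<Sum>n<N. total.ring_sum t b c a (Suc n)) +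
         (\<Sum>n<N. total.ring_sum t c a b (Suc n)))"
      unfolding sum.lessThan_Suc_shift block by (simp add: sum.distrib)
    also have "\<dots> \<le> (\<Sum>s'\<leftarrow>tau_block s 0. on_gap (total t) s') +
        (total t (corner 1 (gap a b c)) + total t (corner 1 (gap b c a)) + total t (corner 1 (gap c a b)))"
      by (intro add_mono order_refl total_corner abc)
    also have "\<dots> = (\<Sum>f\<in>faces. total t (sub f (gap a b c)))"
      unfolding total.sum_sub_gap[OF abc] sum_list_on_gap s ..
    also have "\<dots> \<le> on_gap (total t) s"
      using total_ge_sub by (simp add: s on_gap_def)
    finally show "(\<Sum>n<N. \<Sum>s'\<leftarrow>tau_block s n. on_gap (total t) s') \<le> on_gap (total t) s" .
  qed
qed

definition necklace :: "real \<Rightarrow> real \<Rightarrow> real \<Rightarrow> real \<Rightarrow> ennreal" where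
  "necklace t a b c = (\<Sum>j. ennreal (tip_sum t (corner (Suc j) (gap a b c))))"

definition necklaces :: "real \<Rightarrow> triple \<Rightarrow> ennreal" where
  "necklaces t = (\<lambda>(a, b, c). ennreal (tip_sum t (gap a b c)) +
     (necklace t a b c + necklace t b c a + necklace t c a b))"

text \<open>Every step along the chain uses up one level of depth, so a truncation at depth n meets
  at most n rings. Their depths are then all raised to n.\<close>

lemma mass_corner:
  assumes abc: "0 \<le> a" "0 \<le> b" "0 \<le> c"
  shows "ennreal (mass n t (corner 1 (gap a b c)))
    \<le> necklace t a b c + (\<Sum>j<n. mass.ring_sum n t a b c (Suc j))"
proof -
  have "ennreal (mass m t (corner k (gap a b c)))
     \<le> (\<Sum>j<m. ennreal (tip_sum t (corner (k + j) (gap a b c))) + mass.ring_sum n t a b c (k + j))"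
    if "m \<le> n" for m k
    using that
  proof (induction m arbitrary: k)
    case (Suc m)
    have ring: "mass.ring_sum m t a b c k \<le> mass.ring_sum n t a b c k"
      unfolding mass.ring_sum_def using Suc.prems by (intro add_mono ennreal_leI mass_mono) auto
    have "ennreal (mass (Suc m) t (corner k (gap a b c))) =
        ennreal (tip_sum t (corner k (gap a b c))) +
        (mass.ring_sum m t a b c k + ennreal (mass m t (corner (Suc k) (gap a b c))))"
      unfolding ennreal_mass_Suc mass.sum_sub_corner[OF abc] ..
    also have "\<dots> \<le> ennreal (tip_sum t (corner k (gap a b c))) + (mass.ring_sum n t a b c k +
        (\<Sum>j<m. ennreal (tip_sum t (corner (Suc k + j) (gap a b c))) + mass.ring_sum n t a b c (Suc k + j)))"
      using Suc.prems by (intro add_left_mono add_mono ring Suc.IH) auto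
    also have "\<dots> = (\<Sum>j<Suc m. ennreal (tip_sum t (corner (k + j) (gap a b c))) + mass.ring_sum n t a b c (k + j))"
      by (subst sum.lessThan_Suc_shift) (simp add: add.assoc)
    finally show ?case .
  qed simp
  from this[of n 1] have "ennreal (mass n t (corner 1 (gap a b c)))
     \<le> (\<Sum>j<n. ennreal (tip_sum t (corner (Suc j) (gap a b c)))) + (\<Sum>j<n. mass.ring_sum n t a b c (Suc j))"
    by (simp add: sum.distrib del: sum_ennreal)
  also have "\<dots> \<le> necklace t a b c + (\<Sum>j<n. mass.ring_sum n t a b c (Suc j))"
    unfolding necklace_def by (intro add_right_mono sum_le_suminf summableI) auto
  finally show ?thesis .
qed

text \<open>The left-hand side is first raised to depth n+1, so that after one subdivision the same
  depth n stands on both sides; this makes the inequality iterable.\<close>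

lemma mass_le_tau_sum:
  assumes "sorted_triple s"
  shows "on_gap (\<lambda>q. ennreal (mass n t q)) s \<le> necklaces t s + tau_sum (on_gap (\<lambda>q. ennreal (mass n t q))) s"
proof -
  obtain a b c where s: "s = (a, b, c)" by (metis prod_cases3)
  have abc: "0 \<le> a" "0 \<le> b" "0 \<le> c" using assms by (auto simp: s sorted_triple_def)
  let ?h = "on_gap (\<lambda>q. ennreal (mass n t q))"
  have block: "(\<Sum>s'\<leftarrow>tau_block s (Suc j). ?h s') =
      mass.ring_sum n t a b c (Suc j) + mass.ring_sum n t b c a (Suc j) + mass.ring_sum n t c a b (Suc j)" for j
    unfolding sum_list_on_gap[symmetric] s by (rule mass.tau_block_sum) simp
  have "?h s \<le> ennreal (mass (Suc n) t (gap a b c))"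
    by (simp add: s on_gap_def ennreal_leI mass_mono)
  also have "\<dots> = ennreal (tip_sum t (gap a b c)) + ((\<Sum>s'\<leftarrow>tau_block s 0. ?h s') +
     (ennreal (mass n t (corner 1 (gap a b c))) + ennreal (mass n t (corner 1 (gap b c a))) +
      ennreal (mass n t (corner 1 (gap c a b)))))"
    unfolding ennreal_mass_Suc mass.sum_sub_gap[OF abc] s by (simp add: on_gap_def)
  also have "\<dots> \<le> ennreal (tip_sum t (gap a b c)) + ((\<Sum>s'\<leftarrow>tau_block s 0. ?h s') +
     ((necklace t a b c + (\<Sum>j<n. mass.ring_sum n t a b c (Suc j))) +
      (necklace t b c a + (\<Sum>j<n. mass.ring_sum n t b c a (Suc j))) +
      (necklace t c a b + (\<Sum>j<n. mass.ring_sum n t c a b (Suc j)))))"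
    by (intro add_left_mono add_mono mass_corner abc)
  also have "\<dots> = necklaces t s + (\<Sum>j<Suc n. \<Sum>s'\<leftarrow>tau_block s j. ?h s')"
    unfolding sum.lessThan_Suc_shift block
    unfolding necklaces_def s by (simp add: sum.distrib add_ac)
  also have "\<dots> \<le> necklaces t s + tau_sum ?h s"
    unfolding tau_sum_def by (intro add_left_mono sum_le_suminf summableI) auto
  finally show ?thesis .
qed

section \<open>Convergence of necklaces and lists for exponents above 1/2\<close>

definition growth_sum :: "real \<Rightarrow> ennreal" where
  "growth_sum t = (\<Sum>j. ennreal (growth (Suc j) powr (- t)))"

lemma growth_ge_square: "(real n)\<^sup>2 \<le> growth n"
  by (simp add: growth_def power2_eq_square algebra_simps)

lemma growth_sum_finite:
  assumes "t > 1/2" shows "growth_sum t < \<infinity>"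
proof -
  have "summable (\<lambda>j. real j powr (- (2 * t)))"
    using assms by (simp add: summable_real_powr_iff)
  then have s: "summable (\<lambda>j. real (Suc j) powr (- (2 * t)))"
    by (subst summable_Suc_iff)
  have le: "growth (Suc j) powr (- t) \<le> real (Suc j) powr (- (2 * t))" for j
  proof -
    have "growth (Suc j) powr (- t) \<le> ((real (Suc j))\<^sup>2) powr (- t)"
      by (rule powr_neg_antimono) (use assms growth_ge_square[of "Suc j"] in auto)
    also have "\<dots> = real (Suc j) powr (- (2 * t))"
      by (simp add: powr_powr flip: powr_numeral)
    finally show ?thesis .
  qed
  have "summable (\<lambda>j. growth (Suc j) powr (- t))"
    by (rule summable_comparison_test'[OF s, of 0]) (use le in auto)
  then show ?thesis
    unfolding growth_sum_def using ennreal_suminf_neq_top by (simp add: less_top[symmetric] infinity_ennreal_def)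
qed

definition y_weight :: "real \<Rightarrow> triple \<Rightarrow> ennreal" where
  "y_weight t = (\<lambda>(x, y, z). ennreal (y powr (- t)))"

text \<open>Every coefficient of a tip is at least 1, so each of the three antipodal disks has
  curvature at least a, b and c.\<close>

lemma tip_sum_le:
  assumes t: "t \<ge> 0" and abc: "0 \<le> a" "0 \<le> b" "0 \<le> c" and e: "0 \<le> e"
    and m: "0 < m" "m \<le> c \<or> m \<le> a \<or> m \<le> b"
  shows "tip_sum t (a, b, c, e) \<le> 3 * m powr (- t)"
proof -
  have "dotq v (a, b, c, e) powr (- t) \<le> m powr (- t)" if "v \<in> tips" for v
    by (rule powr_neg_antimono[OF t m(1)]) (use that abc e m in \<open>auto simp: tips_def\<close>)
  then have "tip_sum t (a, b, c, e) \<le> (\<Sum>v\<in>tips. m powr (- t))"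
    unfolding tip_sum_def by (intro sum_mono) auto
  then show ?thesis by (simp add: tips_def)
qed

text \<open>The j-th gap of the chain contains a side of curvature at least
  \<open>growth j * m\<close>, which bounds its three antipodal disks.\<close>

lemma necklace_le:
  assumes t: "t \<ge> 0" and pos: "0 \<le> p" "0 \<le> q" "0 \<le> r" "0 < m"
    and m: "m \<le> p + q" "m \<le> r \<or> (m \<le> p \<and> m \<le> q)" and d: "m \<le> neck_d p q r"
  shows "necklace t p q r \<le> 3 * growth_sum t * ennreal (m powr (- t))"
proof -
  have "ennreal (tip_sum t (corner (Suc j) (gap p q r)))
      \<le> 3 * ennreal (growth (Suc j) powr (- t)) * ennreal (m powr (- t))" for j
  proof -
    let ?c = "neck_c p q r (Suc j)"
    have c: "growth (Suc j) * m \<le> ?c"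
      by (rule ring_bounds(1)[OF pos(1-3) _ m d]) (use pos in auto)
    have gm: "0 < growth (Suc j) * m" using growth_ge_1[of "Suc j"] pos by simp
    have "tip_sum t (corner (Suc j) (gap p q r)) = tip_sum t (p, q, ?c, sqrt 2 * neck_d p q ?c)"
      unfolding corner_gap[OF pos(1-3)] by (simp add: gap_def)
    also have "\<dots> \<le> 3 * (growth (Suc j) * m) powr (- t)"
      by (rule tip_sum_le[OF t]) (use pos c gm in \<open>auto simp: neck_d_def\<close>)
    also have "\<dots> = 3 * growth (Suc j) powr (- t) * m powr (- t)"
      using pos growth_ge_1[of "Suc j"] by (simp add: powr_mult)
    finally have "ennreal (tip_sum t (corner (Suc j) (gap p q r)))
      \<le> ennreal (3 * growth (Suc j) powr (- t) * m powr (- t))" by (rule ennreal_leI)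
    then show ?thesis by (simp add: ennreal_mult)
  qed
  then have "necklace t p q r \<le> (\<Sum>j. 3 * ennreal (growth (Suc j) powr (- t)) * ennreal (m powr (- t)))"
    unfolding necklace_def by (intro suminf_le summableI)
  then show ?thesis by (simp add: growth_sum_def)
qed

lemma neck_d_ge:
  assumes "sorted_triple (a, b, c)"
  shows "b \<le> neck_d a b c" "neck_d b c a = neck_d a b c" "neck_d c a b = neck_d a b c"
proof -
  have abc: "0 \<le> a" "a \<le> b" "b \<le> c" "0 < b" using assms by (auto simp: sorted_triple_def)
  have "b \<le> sqrt (b * c)" using abc by (intro real_le_rsqrt) (simp add: power2_eq_square)
  also have "\<dots> \<le> neck_d a b c" unfolding neck_d_def using abc by (intro real_sqrt_le_mono) simp
  finally show "b \<le> neck_d a b c" .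
qed (simp_all add: neck_d_def algebra_simps)

lemma necklaces_le:
  assumes t: "t \<ge> 0" and s: "sorted_triple s"
  shows "necklaces t s \<le> (3 + 9 * growth_sum t) * y_weight t s"
proof -
  obtain a b c where abc_eq: "s = (a, b, c)" by (metis prod_cases3)
  have abc: "0 \<le> a" "a \<le> b" "b \<le> c" "0 < b" using s by (auto simp: abc_eq sorted_triple_def)
  note d = neck_d_ge[OF s[unfolded abc_eq]]
  have "ennreal (tip_sum t (gap a b c)) \<le> ennreal (3 * b powr (- t))"
    unfolding gap_def using abc d by (intro ennreal_leI tip_sum_le t) auto
  then have "ennreal (tip_sum t (gap a b c)) \<le> 3 * ennreal (b powr (- t))"
    by (simp add: ennreal_mult)
  moreover have "necklace t a b c \<le> 3 * growth_sum t * ennreal (b powr (- t))"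
    "necklace t b c a \<le> 3 * growth_sum t * ennreal (b powr (- t))"
    "necklace t c a b \<le> 3 * growth_sum t * ennreal (b powr (- t))"
    by (rule necklace_le[OF t]; use abc d in auto)+
  ultimately have "necklaces t s \<le> 3 * ennreal (b powr (- t)) +
     (3 * growth_sum t * ennreal (b powr (- t)) + 3 * growth_sum t * ennreal (b powr (- t)) +
      3 * growth_sum t * ennreal (b powr (- t)))"
    unfolding necklaces_def abc_eq by (auto intro!: add_mono)
  also have "\<dots> = (3 + (3 * growth_sum t + 3 * growth_sum t + 3 * growth_sum t)) * y_weight t s"
    by (simp add: y_weight_def abc_eq distrib_right)
  also have "3 * growth_sum t + 3 * growth_sum t + 3 * growth_sum t = 9 * growth_sum t"
    by (simp flip: distrib_right)
  finally show ?thesis .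
qed

text \<open>Four exceptional triples and eighteen for every later index, each with middle curvature
  at least \<open>growth (max 1 n)\<close> times the old one.\<close>

definition tau_const :: "real \<Rightarrow> ennreal" where
  "tau_const t = 4 * ennreal (growth 1 powr (- t)) + 18 * growth_sum t"

lemma length_tau_block: "length (tau_block s n) = (if n = 0 then 4 else 18)"
  by (cases s) (simp add: tau_block_def Let_def)

lemma tau_sum_y_weight:
  assumes t: "t \<ge> 0" and s: "sorted_triple s"
  shows "tau_sum (y_weight t) s \<le> tau_const t * y_weight t s"
proof -
  obtain a b c where abc: "s = (a, b, c)" by (metis prod_cases3)
  have b: "0 < b" using s by (simp add: abc sorted_triple_def)
  have el: "y_weight t s' \<le> ennreal (growth (max 1 n) powr (- t)) * y_weight t s"
    if "s' \<in> set (tau_block s n)" for s' n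
  proof -
    obtain x y z where xyz: "s' = (x, y, z)" by (metis prod_cases3)
    have "growth (max 1 n) * b \<le> y"
      using tau_block_bounds(4)[OF s[unfolded abc] that[unfolded abc xyz]] .
    then have "y powr (- t) \<le> (growth (max 1 n) * b) powr (- t)"
      by (rule powr_neg_antimono[OF t, rotated]) (use b growth_ge_1[of "max 1 n"] in auto)
    also have "\<dots> = growth (max 1 n) powr (- t) * b powr (- t)"
      using b growth_ge_1[of "max 1 n"] by (simp add: powr_mult)
    finally show ?thesis
      by (simp add: y_weight_def xyz abc ennreal_leI flip: ennreal_mult)
  qed
  have block: "(\<Sum>s'\<leftarrow>tau_block s n. y_weight t s')
      \<le> of_nat (length (tau_block s n)) * (ennreal (growth (max 1 n) powr (- t)) * y_weight t s)" for n
  proof -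
    have "(\<Sum>s'\<leftarrow>tau_block s n. y_weight t s')
      \<le> (\<Sum>s'\<leftarrow>tau_block s n. ennreal (growth (max 1 n) powr (- t)) * y_weight t s)"
      by (rule sum_list_mono) (rule el)
    then show ?thesis by (simp add: sum_list_triv mult_ac)
  qed
  have "tau_sum (y_weight t) s \<le> 4 * (ennreal (growth 1 powr (- t)) * y_weight t s) +
      (\<Sum>n. 18 * (ennreal (growth (Suc n) powr (- t)) * y_weight t s))"
    unfolding tau_sum_def
  proof (rule suminf_le_const[OF summableI])
    fix N
    have "(\<Sum>n<N. \<Sum>s'\<leftarrow>tau_block s n. y_weight t s') \<le> (\<Sum>n<Suc N. \<Sum>s'\<leftarrow>tau_block s n. y_weight t s')"
      by simp
    also have "\<dots> = (\<Sum>s'\<leftarrow>tau_block s 0. y_weight t s') + (\<Sum>n<N. \<Sum>s'\<leftarrow>tau_block s (Suc n). y_weight t s')"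
      by (rule sum.lessThan_Suc_shift)
    also have "\<dots> \<le> 4 * (ennreal (growth 1 powr (- t)) * y_weight t s) +
        (\<Sum>n<N. 18 * (ennreal (growth (Suc n) powr (- t)) * y_weight t s))"
      using block[of 0] block[of "Suc _"]
      by (intro add_mono sum_mono) (simp_all add: length_tau_block)
    also have "\<dots> \<le> 4 * (ennreal (growth 1 powr (- t)) * y_weight t s) +
        (\<Sum>n. 18 * (ennreal (growth (Suc n) powr (- t)) * y_weight t s))"
      by (intro add_left_mono sum_le_suminf summableI) auto
    finally show "(\<Sum>n<N. \<Sum>s'\<leftarrow>tau_block s n. y_weight t s') \<le>
        4 * (ennreal (growth 1 powr (- t)) * y_weight t s) +
        (\<Sum>n. 18 * (ennreal (growth (Suc n) powr (- t)) * y_weight t s))" .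
  qed
  also have "\<dots> = tau_const t * y_weight t s"
    by (simp add: tau_const_def growth_sum_def distrib_right mult.assoc)
  finally show ?thesis .
qed

lemma tau_const_finite: "t > 1/2 \<Longrightarrow> tau_const t < \<infinity>"
  using growth_sum_finite[of t] by (simp add: tau_const_def ennreal_mult_less_top)

text \<open>The first term is at most 3/100 and the tail telescopes to at most 1/80; 3/100 + 1/80 =
  17/400.\<close>

lemma growth_sum_2: "growth_sum 2 \<le> ennreal (17/400)"
proof -
  define f where "f j = growth (Suc j) powr (- 2)" for j
  have sq2: "1.4 \<le> sqrt 2" by (rule real_le_rsqrt) (simp add: power2_eq_square)
  have f: "f j = 1 / (growth (Suc j))\<^sup>2" for j
    using growth_ge_1[of "Suc j"] by (simp add: f_def powr_minus powr_numeral field_simps)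
  have f0: "f 0 \<le> 3/100"
  proof -
    have "5.8 \<le> growth 1" unfolding growth_1 using sq2 by simp
    then have "5.8\<^sup>2 \<le> (growth 1)\<^sup>2" by (intro power_mono) auto
    then show ?thesis by (simp add: f field_simps power2_eq_square)
  qed
  \<comment> \<open>With n = j+2 the curvature is at least 2n(n+1), and 5 \<le> 2n+1 turns
    1/(2n(n+1))^2 into a multiple of a difference of consecutive inverse squares.\<close>
  have tele: "f (Suc j) \<le> 1/20 * (1 / (real (j + 2))\<^sup>2 - 1 / (real (j + 3))\<^sup>2)" for j
  proof -
    define n where "n = real (j + 2)"
    have n: "2 \<le> n" "n = real (Suc (Suc j))" "real (j + 3) = n + 1" by (auto simp: n_def)
    have "n \<le> sqrt 2 * n" using sq2 n(1) by (simp add: mult_le_cancel_right1)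
    then have "2 * n * (n + 1) \<le> growth (Suc (Suc j))"
      unfolding growth_def n(2)[symmetric] by (simp add: power2_eq_square algebra_simps)
    then have "(2 * n * (n + 1))\<^sup>2 \<le> (growth (Suc (Suc j)))\<^sup>2"
      using n(1) by (intro power_mono) auto
    then have "f (Suc j) \<le> 1 / (2 * n * (n + 1))\<^sup>2"
      unfolding f using n(1) growth_ge_1[of "Suc (Suc j)"]
      by (intro divide_left_mono) (auto intro!: mult_pos_pos zero_less_power)
    also have "\<dots> \<le> (2 * n + 1) / (20 * (n * (n + 1))\<^sup>2)"
    proof -
      have "1 / (2 * n * (n + 1))\<^sup>2 = 5 / (20 * (n * (n + 1))\<^sup>2)"
        by (simp add: power_mult_distrib)
      also have "\<dots> \<le> (2 * n + 1) / (20 * (n * (n + 1))\<^sup>2)"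
        using n(1) by (intro divide_right_mono) auto
      finally show ?thesis .
    qed
    also have "\<dots> = 1/20 * (1 / n\<^sup>2 - 1 / (n + 1)\<^sup>2)"
      using n(1) by (simp add: divide_simps power_mult_distrib) (simp add: power2_eq_square algebra_simps)
    finally show ?thesis by (simp only: n(3) n_def[symmetric])
  qed
  have sum: "(\<Sum>j<N. f (Suc j)) \<le> 1/20 * (1/4 - 1 / (real (N + 2))\<^sup>2)" for N
  proof (induction N)
    case (Suc N)
    then show ?case using tele[of N] by (simp add: algebra_simps)
  qed simp
  show ?thesis
    unfolding growth_sum_def
  proof (rule suminf_le_const[OF summableI])
    fix N
    have "(\<Sum>j<N. f j) \<le> (\<Sum>j<Suc N. f j)" by (simp add: f)
    also have "\<dots> = f 0 + (\<Sum>j<N. f (Suc j))" by (rule sum.lessThan_Suc_shift)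
    also have "\<dots> \<le> 3/100 + 1/20 * (1/4 - 1 / (real (N + 2))\<^sup>2)" by (intro add_mono f0 sum)
    also have "\<dots> \<le> 17/400" by (simp add: field_simps)
    finally have "(\<Sum>j<N. f j) \<le> 17/400" .
    moreover have "(\<Sum>j<N. ennreal (growth (Suc j) powr (- 2))) = ennreal (\<Sum>j<N. f j)"
      by (simp add: f_def)
    ultimately show "(\<Sum>j<N. ennreal (growth (Suc j) powr (- 2))) \<le> ennreal (17/400)"
      by (simp add: ennreal_leI)
  qed
qed

text \<open>Numerically 4 * 0.03 + 18 * 17/400 = 0.885. At exponent 2 the list sums therefore never
  reach 1, which will force \<open>mu < 2\<close>.\<close>

lemma tau_const_2: "tau_const 2 < 1"
proof -
  have sq2: "1.4 \<le> sqrt 2" by (rule real_le_rsqrt) (simp add: power2_eq_square)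
  have "5.8 \<le> growth 1" unfolding growth_1 using sq2 by simp
  then have "growth 1 powr (- 2) \<le> 5.8 powr (- 2)" by (intro powr_neg_antimono) auto
  also have "\<dots> \<le> (3/100 :: real)" by (simp add: powr_minus powr_numeral power2_eq_square field_simps)
  finally have "4 * ennreal (growth 1 powr (- 2)) \<le> ennreal (12/100)"
    by (simp add: ennreal_leI numeral_mult_ennreal)
  moreover have "18 * growth_sum 2 \<le> 18 * ennreal (17/400)"
    by (intro mult_left_mono growth_sum_2) simp
  ultimately have "tau_const 2 \<le> ennreal (12/100) + 18 * ennreal (17/400)"
    unfolding tau_const_def by (rule add_mono)
  also have "\<dots> = ennreal (12/100 + 18 * (17/400))"
    by (simp add: numeral_mult_ennreal flip: ennreal_plus)
  also have "\<dots> < 1" by (simp add: ennreal_less_one_iff)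
  finally show ?thesis .
qed

lemma triples_sorted: "(w, s) \<in> triples \<kappa> m \<Longrightarrow> sorted_triple s"
  using triples_well_formed(1)[of w "fst s" "fst (snd s)" "snd (snd s)"] by (auto intro: well_formed_sorted)

lemma wsum_triples_Suc:
  "wsum (triples \<kappa> (Suc m)) h = wsum (triples \<kappa> m) (\<lambda>s. if refined \<kappa> s then tau_sum h s else h s)"
  unfolding triples_Suc by (rule wsum_refine[OF suffix_free_triples])

lemma wsum_y_weight_finite:
  assumes t: "t > 1/2" shows "wsum (triples \<kappa> m) (y_weight t) < \<infinity>"
proof (induction m)
  case 0
  have "wsum (triples \<kappa> 0) (y_weight t) \<le> tau_const t * y_weight t (0, 1, 1)"
    unfolding triples_0 wsum_tau_list by (rule tau_sum_y_weight) (use t sorted_base in auto)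
  then show ?case using tau_const_finite[OF t] by (simp add: y_weight_def order_le_less_trans)
next
  case (Suc m)
  have "wsum (triples \<kappa> (Suc m)) (y_weight t) \<le> wsum (triples \<kappa> m) (\<lambda>s. (1 + tau_const t) * y_weight t s)"
    unfolding wsum_triples_Suc
  proof (rule wsum_mono)
    fix w s assume "(w, s) \<in> triples \<kappa> m"
    then have "tau_sum (y_weight t) s \<le> tau_const t * y_weight t s"
      using t triples_sorted by (intro tau_sum_y_weight) auto
    then show "(if refined \<kappa> s then tau_sum (y_weight t) s else y_weight t s) \<le> (1 + tau_const t) * y_weight t s"
      by (simp add: distrib_right add_increasing)
  qed
  also have "\<dots> < \<infinity>"
    unfolding wsum_cmult using Suc tau_const_finite[OF t] by (simp add: ennreal_mult_less_top)
  finally show ?case .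
qed

lemma wsum_y_weight_2: "wsum (triples \<kappa> m) (y_weight 2) < 1"
proof (induction m)
  case 0
  have "wsum (triples \<kappa> 0) (y_weight 2) \<le> tau_const 2 * y_weight 2 (0, 1, 1)"
    unfolding triples_0 wsum_tau_list by (rule tau_sum_y_weight) (use sorted_base in auto)
  then show ?case using tau_const_2 by (simp add: y_weight_def order_le_less_trans)
next
  case (Suc m)
  have "wsum (triples \<kappa> (Suc m)) (y_weight 2) \<le> wsum (triples \<kappa> m) (y_weight 2)"
    unfolding wsum_triples_Suc
  proof (rule wsum_mono)
    fix w s assume "(w, s) \<in> triples \<kappa> m"
    then have "tau_sum (y_weight 2) s \<le> tau_const 2 * y_weight 2 s"
      using triples_sorted by (intro tau_sum_y_weight) auto
    also have "\<dots> \<le> 1 * y_weight 2 s" by (intro mult_right_mono less_imp_le[OF tau_const_2]) simp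
    finally show "(if refined \<kappa> s then tau_sum (y_weight 2) s else y_weight 2 s) \<le> y_weight 2 s" by simp
  qed
  then show ?case using Suc by (rule order_le_less_trans)
qed

section \<open>The equations for mu and lam, and the two bounds for the exponent\<close>

definition f_weight :: "real \<Rightarrow> triple \<Rightarrow> real" where
  "f_weight t = (\<lambda>(x, y, z). 1/2 * ((x + y) powr (- t) + z powr (- t)))"

definition g_weight :: "real \<Rightarrow> triple \<Rightarrow> real" where
  "g_weight t = (\<lambda>(x, y, z). (x + (y + z) / 2) powr (- t))"

lemma f_weight_nonneg: "0 \<le> f_weight t s"
  by (simp add: f_weight_def split: prod.splits)

lemma g_weight_nonneg: "0 \<le> g_weight t s"
  by (simp add: g_weight_def split: prod.splits)

lemma infsum_eq_1_imp_wsum: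
  fixes h :: "triple \<Rightarrow> real"
  assumes "(\<Sum>\<^sub>\<infinity>p\<in>L. h (snd p)) = 1" "\<And>s. 0 \<le> h s"
  shows "wsum L (\<lambda>s. ennreal (h s)) = 1"
proof -
  \<comment> \<open>A divergent \<open>infsum\<close> has the value 0, so the value 1 certifies
    summability.\<close>
  have "(\<lambda>p. h (snd p)) summable_on L"
    using assms(1) infsum_not_exists by fastforce
  then have abs: "Infinite_Set_Sum.abs_summable_on (\<lambda>p. h (snd p)) L"
    using assms(2) by (subst abs_summable_equivalent[symmetric]) simp
  have "wsum L (\<lambda>s. ennreal (h s)) = ennreal (infsetsum (\<lambda>p. h (snd p)) L)"
    unfolding wsum_def by (rule nn_integral_conv_infsetsum[OF abs]) (rule assms(2))
  then show ?thesis by (simp add: infsetsum_infsum[OF abs] assms(1))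
qed

lemma f_fun_imp_wsum:
  assumes "f_fun m \<kappa> 0 1 1 t = 1"
  shows "wsum (triples \<kappa> m) (\<lambda>s. ennreal (f_weight t s)) = 1"
  by (rule infsum_eq_1_imp_wsum[OF _ f_weight_nonneg])
     (use assms in \<open>simp add: f_fun_def triples_def f_weight_def case_prod_unfold\<close>)

lemma g_fun_imp_wsum:
  assumes "g_fun m \<kappa> 0 1 1 t = 1"
  shows "wsum (triples \<kappa> m) (\<lambda>s. ennreal (g_weight t s)) = 1"
  by (rule infsum_eq_1_imp_wsum[OF _ g_weight_nonneg])
     (use assms in \<open>simp add: g_fun_def triples_def g_weight_def case_prod_unfold\<close>)

lemma powr_neg_decay:
  fixes B x t u :: real
  assumes "1 \<le> B" "B \<le> x" "t \<le> u"
  shows "x powr (- u) \<le> B powr (- (u - t)) * x powr (- t)"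
proof -
  have "x powr (- u) = x powr (- (u - t)) * x powr (- t)" by (simp flip: powr_add)
  also have "\<dots> \<le> B powr (- (u - t)) * x powr (- t)"
    using assms by (intro mult_right_mono powr_neg_antimono) auto
  finally show ?thesis .
qed

lemma f_weight_decay:
  assumes "1 \<le> B" "0 \<le> x" "B \<le> y" "y \<le> z" "t \<le> u"
  shows "f_weight u (x, y, z) \<le> B powr (- (u - t)) * f_weight t (x, y, z)"
  using powr_neg_decay[of B "x + y" t u] powr_neg_decay[of B z t u] assms
  by (simp add: f_weight_def algebra_simps)

lemma g_weight_decay:
  assumes "1 \<le> B" "0 \<le> x" "B \<le> y" "y \<le> z" "t \<le> u"
  shows "g_weight u (x, y, z) \<le> B powr (- (u - t)) * g_weight t (x, y, z)"
  using powr_neg_decay[of B "x + (y + z) / 2" t u] assms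
  by (simp add: g_weight_def field_simps)

text \<open>Any t beyond mu makes the sum of the f factors at most some r < 1. The truncated mass M
  of the gap of (0,1,1) then satisfies M \<le> D + r M with D independent of the depth, so M \<le>
  D/(1-r) uniformly.\<close>

theorem total_finite:
  assumes mu: "mu > 1/2" "f_fun m \<kappa> 0 1 1 mu = 1" and t: "mu < t"
  shows "total t (gap 0 1 1) < \<infinity>"
proof -
  have t0: "t \<ge> 0" "t > 1/2" using mu t by auto
  define C where "C = 3 + 9 * growth_sum t"
  have C: "C < \<infinity>" using growth_sum_finite[OF t0(2)] by (simp add: C_def ennreal_mult_less_top)
  define h where "h n = on_gap (\<lambda>q. ennreal (mass n t q))" for n
  have step: "h n s \<le> C * y_weight t s + tau_sum (h n) s" if "sorted_triple s" for n s
    using mass_le_tau_sum[OF that, of n t] necklaces_le[OF t0(1) that] unfolding h_def C_def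
    by (meson add_right_mono order_trans)
  \<comment> \<open>The essential point is the order of the quantifiers: D collects the necklaces
    left out in m rounds and does not depend on the depth n.\<close>
  have "\<exists>D<\<infinity>. \<forall>n. h n (0, 1, 1) \<le> D + wsum (triples \<kappa> m) (h n)"
  proof (induction m)
    case 0
    have "\<forall>n. h n (0, 1, 1) \<le> C * y_weight t (0, 1, 1) + wsum (triples \<kappa> 0) (h n)"
      unfolding triples_0 wsum_tau_list using step[OF sorted_base] by blast
    moreover have "C * y_weight t (0, 1, 1) < \<infinity>" using C by (simp add: y_weight_def)
    ultimately show ?case by blast
  next
    case (Suc m)
    then obtain D where D: "D < \<infinity>" "\<And>n. h n (0, 1, 1) \<le> D + wsum (triples \<kappa> m) (h n)" by blast
    define W where "W = C * wsum (triples \<kappa> m) (y_weight t)"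
    have W: "W < \<infinity>" using C wsum_y_weight_finite[OF t0(2), of \<kappa> m] by (simp add: W_def ennreal_mult_less_top)
    have "h n (0, 1, 1) \<le> (D + W) + wsum (triples \<kappa> (Suc m)) (h n)" for n
    proof -
      have "wsum (triples \<kappa> m) (h n) \<le> wsum (triples \<kappa> m)
          (\<lambda>s. C * y_weight t s + (if refined \<kappa> s then tau_sum (h n) s else h n s))"
        by (rule wsum_mono) (use step triples_sorted in \<open>auto simp: add_increasing\<close>)
      also have "\<dots> = W + wsum (triples \<kappa> (Suc m)) (h n)"
        unfolding wsum_add wsum_cmult wsum_triples_Suc W_def ..
      finally have "D + wsum (triples \<kappa> m) (h n) \<le> D + (W + wsum (triples \<kappa> (Suc m)) (h n))"
        by (rule add_left_mono)
      then show ?thesis unfolding add.assoc by (rule order_trans[OF D(2)])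
    qed
    then show ?case using D(1) W by (intro exI[of _ "D + W"]) auto
  qed
  then obtain D where D: "D < \<infinity>" "\<And>n. h n (0, 1, 1) \<le> D + wsum (triples \<kappa> m) (h n)" by blast
  \<comment> \<open>All relevant curvatures are at least \<open>growth 1\<close>, so passing from mu
    to t gains this factor in every summand.\<close>
  define r where "r = growth 1 powr (- (t - mu))"
  have growth_gt: "1 < growth 1" unfolding growth_1 using real_sqrt_ge_zero[of 2] by linarith
  have r: "0 < r" "r < 1" using growth_gt t by (auto simp: r_def powr_less_one)
  have "h n (0, 1, 1) \<le> D + ennreal r * h n (0, 1, 1)" for n
  proof -
    have "wsum (triples \<kappa> m) (h n) \<le> wsum (triples \<kappa> m) (\<lambda>s. h n (0, 1, 1) * (ennreal r * ennreal (f_weight mu s)))"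
    proof (rule wsum_mono)
      fix w s assume ws: "(w, s) \<in> triples \<kappa> m"
      obtain x y z where s: "s = (x, y, z)" by (metis prod_cases3)
      have xyz: "0 \<le> x" "growth 1 \<le> y" "y \<le> z"
        using triples_well_formed(1)[OF ws[unfolded s]] by (auto simp: well_formed_def)
      have "mass n t (gap x y z) \<le> f_weight t s * mass n t (gap 0 1 1)"
        using mass_upper[of t x y z n] xyz growth_gt t0 by (simp add: s f_weight_def)
      also have "\<dots> \<le> (r * f_weight mu s) * mass n t (gap 0 1 1)"
        unfolding r_def s using xyz growth_gt t
        by (intro mult_right_mono f_weight_decay mass_nonneg) auto
      finally have "ennreal (mass n t (gap x y z)) \<le> ennreal (mass n t (gap 0 1 1) * (r * f_weight mu s))"
        by (intro ennreal_leI) (simp add: mult.commute)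
      then show "h n s \<le> h n (0, 1, 1) * (ennreal r * ennreal (f_weight mu s))"
        using r by (simp add: h_def on_gap_def s ennreal_mult mass_nonneg f_weight_nonneg)
    qed
    also have "\<dots> = h n (0, 1, 1) * ennreal r"
      unfolding wsum_cmult f_fun_imp_wsum[OF mu(2)] by simp
    finally show ?thesis using D(2)[of n] by (simp add: mult.commute add_left_mono order_trans)
  qed
  then have *: "ennreal (mass n t (gap 0 1 1)) \<le> D + ennreal r * ennreal (mass n t (gap 0 1 1))" for n
    by (simp add: h_def on_gap_def)
  obtain d where d: "D = ennreal d" "0 \<le> d" using D(1) by (cases D) auto
  have "mass n t (gap 0 1 1) \<le> d / (1 - r)" for n
  proof -
    have "ennreal (mass n t (gap 0 1 1)) \<le> ennreal (d + r * mass n t (gap 0 1 1))"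
      using *[of n] r d mass_nonneg by (simp add: ennreal_mult)
    then have "mass n t (gap 0 1 1) \<le> d + r * mass n t (gap 0 1 1)"
      using r d mass_nonneg by (subst (asm) ennreal_le_iff) auto
    then show ?thesis using r by (simp add: field_simps)
  qed
  then have "total t (gap 0 1 1) \<le> ennreal (d / (1 - r))"
    unfolding total_def by (intro SUP_least ennreal_leI)
  then show ?thesis by (simp add: order_le_less_trans)
qed

text \<open>A finite positive total T satisfies T times the g sum at t \<le> T, hence the g sum at t
  is at most 1. For t below lam the g sum at lam would then be strictly less than 1.\<close>

theorem total_finite_imp_ge:
  assumes lam: "g_fun m \<kappa> 0 1 1 lam = 1" and t: "0 < t" "total t (gap 0 1 1) < \<infinity>"
  shows "lam \<le> t"
proof (rule ccontr)
  assume less: "\<not> lam \<le> t"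
  define T where "T = total t (gap 0 1 1)"
  have base: "gap 0 1 1 = (0, 1, 1, sqrt 2)" by (simp add: gap_def neck_d_def)
  have "ennreal (mass 1 t (gap 0 1 1)) \<le> T" unfolding T_def total_def by (rule SUP_upper) simp
  moreover have "0 < mass 1 t (gap 0 1 1)"
  proof -
    have "0 < 4 + 2 * sqrt 2" "0 < 3 + 2 * sqrt 2" by (simp_all add: add_pos_nonneg)
    then have "0 < (4 + 2 * sqrt 2) powr (- t)" "0 < (3 + 2 * sqrt 2) powr (- t)"
      by (metis powr_gt_zero less_irrefl)+
    then have "0 < (4 + 2 * sqrt 2) powr (- t) + 2 * (3 + 2 * sqrt 2) powr (- t)" by linarith
    then show ?thesis by (simp add: mass_Suc mass_def base tips_def)
  qed
  ultimately have T0: "0 < T" by (metis ennreal_0 ennreal_less_zero_iff order_less_le_trans)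
  have "wsum (triples \<kappa> m) (\<lambda>s. T * ennreal (g_weight t s)) \<le> wsum (triples \<kappa> m) (on_gap (total t))"
  proof (rule wsum_mono)
    fix w s assume ws: "(w, s) \<in> triples \<kappa> m"
    obtain x y z where s: "s = (x, y, z)" by (metis prod_cases3)
    have sorted: "sorted_triple (x, y, z)" using triples_sorted[OF ws] s by simp
    then have xyz: "0 \<le> x" "x \<le> y" "0 < y" "y \<le> z" by (auto simp: sorted_triple_def)
    have d: "0 < neck_d x y z" using neck_d_ge(1)[OF sorted] xyz by linarith
    have "T * ennreal (g_weight t s) = (SUP n. ennreal (g_weight t s) * ennreal (mass n t (gap 0 1 1)))"
      unfolding T_def total_def by (simp add: SUP_mult_left_ennreal mult.commute)
    also have "\<dots> \<le> total t (gap x y z)"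
      unfolding total_def
    proof (rule SUP_mono)
      fix n
      have "g_weight t s * mass n t (gap 0 1 1) \<le> mass n t (gap x y z)"
        using mass_lower[of t x y z n] xyz d t by (simp add: s g_weight_def)
      then have "ennreal (g_weight t s) * ennreal (mass n t (gap 0 1 1)) \<le> ennreal (mass n t (gap x y z))"
        by (simp add: ennreal_leI g_weight_nonneg mass_nonneg flip: ennreal_mult)
      then show "\<exists>k\<in>UNIV. ennreal (g_weight t s) * ennreal (mass n t (gap 0 1 1)) \<le> ennreal (mass k t (gap x y z))"
        by blast
    qed
    finally show "T * ennreal (g_weight t s) \<le> on_gap (total t) s" by (simp add: s on_gap_def)
  qed
  also have "\<dots> \<le> T"
  proof (induction m)
    case 0
    show ?case
      unfolding triples_0 wsum_tau_list using tau_sum_le_total[OF sorted_base, of t]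
      by (simp add: on_gap_def T_def)
  next
    case (Suc m)
    have "wsum (triples \<kappa> (Suc m)) (on_gap (total t)) \<le> wsum (triples \<kappa> m) (on_gap (total t))"
      unfolding triples_Suc
      by (rule wsum_refine_le[OF suffix_free_triples]) (rule tau_sum_le_total[OF triples_sorted])
    then show ?case using Suc by (rule order_trans)
  qed
  finally have "T * wsum (triples \<kappa> m) (\<lambda>s. ennreal (g_weight t s)) \<le> T * 1"
    by (simp add: wsum_cmult)
  then have le1: "wsum (triples \<kappa> m) (\<lambda>s. ennreal (g_weight t s)) \<le> 1"
    using T0 t(2) unfolding T_def[symmetric] by (subst (asm) ennreal_mult_le_mult_iff) auto
  define r where "r = growth 1 powr (- (lam - t))"
  have growth_gt: "1 < growth 1" unfolding growth_1 using real_sqrt_ge_zero[of 2] by linarith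
  have r: "0 < r" "r < 1" using growth_gt less by (auto simp: r_def powr_less_one)
  have "wsum (triples \<kappa> m) (\<lambda>s. ennreal (g_weight lam s))
      \<le> wsum (triples \<kappa> m) (\<lambda>s. ennreal r * ennreal (g_weight t s))"
  proof (rule wsum_mono)
    fix w s assume ws: "(w, s) \<in> triples \<kappa> m"
    obtain x y z where s: "s = (x, y, z)" by (metis prod_cases3)
    have xyz: "0 \<le> x" "growth 1 \<le> y" "y \<le> z"
      using triples_well_formed(1)[OF ws[unfolded s]] by (auto simp: well_formed_def)
    have "g_weight lam s \<le> r * g_weight t s"
      unfolding r_def s using xyz growth_gt less by (intro g_weight_decay) auto
    then show "ennreal (g_weight lam s) \<le> ennreal r * ennreal (g_weight t s)"
      using r by (simp add: ennreal_leI g_weight_nonneg flip: ennreal_mult)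
  qed
  also have "\<dots> \<le> ennreal r * 1" unfolding wsum_cmult by (intro mult_left_mono le1) simp
  also have "\<dots> < 1" using r by (simp add: ennreal_less_one_iff)
  finally show False using g_fun_imp_wsum[OF lam] by simp
qed

section \<open>Comparison of the f and g summands and the distance between mu and lam\<close>

lemma powr_neg_strict_mean:
  fixes u v t :: real
  assumes "0 < u" "0 < v" "u \<noteq> v" "0 < t"
  shows "((u + v) / 2) powr (- t) < (u powr (- t) + v powr (- t)) / 2"
proof -
  have "0 < (u - v)\<^sup>2" using assms by simp
  then have "u * v < ((u + v) / 2)\<^sup>2" by (simp add: power2_eq_square field_simps)
  then have "sqrt (u * v) < (u + v) / 2" using assms by (intro real_less_lsqrt) auto
  then have "((u + v) / 2) powr (- t) < sqrt (u * v) powr (- t)"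
    using assms by (intro powr_less_mono2_neg) auto
  also have "\<dots> \<le> (u powr (- t) + v powr (- t)) / 2" by (rule powr_neg_geom_mean[OF assms(1,2)])
  finally show ?thesis .
qed

lemma g_weight_le_mean:
  assumes "0 \<le> x" "0 < y" "0 < z" "0 \<le> t"
  shows "g_weight t (x, y, z) \<le> ((x + y + z) / 2) powr (- t)"
proof -
  have "(x + y + z) / 2 \<le> x + (y + z) / 2" using assms by (simp add: field_simps)
  then show ?thesis unfolding g_weight_def using assms by (simp add: powr_neg_antimono)
qed

lemma g_weight_less_f_weight:
  assumes "0 \<le> x" "0 < y" "0 < z" "0 < t" "x + y \<noteq> z"
  shows "g_weight t (x, y, z) < f_weight t (x, y, z)"
  using g_weight_le_mean[of x y z t] powr_neg_strict_mean[of "x + y" z t] assms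
  by (simp add: f_weight_def)

lemma g_weight_le_f_weight:
  assumes "0 \<le> x" "0 < y" "0 < z" "0 < t"
  shows "g_weight t (x, y, z) \<le> f_weight t (x, y, z)"
proof (cases "x + y = z")
  case True
  then show ?thesis using g_weight_le_mean[of x y z t] assms by (simp add: f_weight_def)
qed (use g_weight_less_f_weight[of x y z t] assms in auto)

text \<open>Supplies one summand on which f and g differ strictly, as needed for lam < mu. The
  exceptional triple (c1,b1,a1) serves, since c1+b1 exceeds a1.\<close>

lemma unbalanced_mem_tau:
  assumes "sorted_triple s"
  obtains i x y z where "(i, (x, y, z)) \<in> tau s" "x + y \<noteq> z"
proof -
  obtain a b c where s: "s = (a, b, c)" by (metis prod_cases3)
  let ?a = "neck_a a b c 1" and ?b = "neck_b a b c 1" and ?c = "neck_c a b c 1"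
  have "((0, 3), (?c, ?b, ?a)) \<in> tau s"
    by (simp add: s tau_def tau_block_def Let_def)
  moreover have "?c + ?b \<noteq> ?a"
  proof -
    have abc: "0 \<le> a" "a \<le> b" "b \<le> c" "0 < b" using assms by (auto simp: s sorted_triple_def)
    have "0 \<le> sqrt 8 * neck_d a b c" using neck_d_ge(1)[OF assms[unfolded s]] abc by simp
    then have "0 < sqrt 8 * neck_d a b c + (3 * a + (c + b))" using abc by linarith
    then show ?thesis by (simp add: neck_a_def neck_b_def neck_c_def mult.commute)
  qed
  ultimately show ?thesis by (rule that)
qed

lemma unbalanced_mem_triples: "\<exists>w x y z. (w, (x, y, z)) \<in> triples \<kappa> m \<and> x + y \<noteq> z"
proof (induction m)
  case 0
  obtain i x y z where "(i, (x, y, z)) \<in> tau (0, 1, 1)" "x + y \<noteq> z"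
    using unbalanced_mem_tau[OF sorted_base] .
  then show ?case unfolding triples_0 tau_list_def by blast
next
  case (Suc m)
  then obtain w x y z where *: "(w, (x, y, z)) \<in> triples \<kappa> m" "x + y \<noteq> z" by blast
  show ?case
  proof (cases "refined \<kappa> (x, y, z)")
    case True
    obtain i x' y' z' where "(i, (x', y', z')) \<in> tau (x, y, z)" "x' + y' \<noteq> z'"
      using unbalanced_mem_tau[OF triples_sorted[OF *(1)]] .
    then show ?thesis unfolding triples_Suc using refine_split[OF *(1) True] by blast
  next
    case False
    then show ?thesis unfolding triples_Suc using refine_keep[OF *(1)] * by blast
  qed
qed

text \<open>For mu \<ge> 2 every f summand is at most the inverse square of the middle curvature,
  and those inverse squares sum to less than 1.\<close>

lemma mu_less_2:
  assumes "f_fun m \<kappa> 0 1 1 mu = 1" shows "mu < 2"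
proof (rule ccontr)
  assume ge: "\<not> mu < 2"
  have "wsum (triples \<kappa> m) (\<lambda>s. ennreal (f_weight mu s)) \<le> wsum (triples \<kappa> m) (y_weight 2)"
  proof (rule wsum_mono)
    fix w s assume ws: "(w, s) \<in> triples \<kappa> m"
    obtain x y z where s: "s = (x, y, z)" by (metis prod_cases3)
    have xyz: "0 \<le> x" "growth 1 \<le> y" "y \<le> z"
      using triples_well_formed(1)[OF ws[unfolded s]] by (auto simp: well_formed_def)
    have y: "1 \<le> y" using xyz(2) growth_ge_1[of 1] by linarith
    have "r powr (- mu) \<le> y powr (- 2)" if "y \<le> r" for r
    proof -
      have "r powr (- mu) \<le> r powr (- 2)" using that y ge by (intro powr_mono) auto
      also have "\<dots> \<le> y powr (- 2)" using that y by (intro powr_neg_antimono) auto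
      finally show ?thesis .
    qed
    from this[of "x + y"] this[of z] show "ennreal (f_weight mu s) \<le> y_weight 2 s"
      using xyz by (simp add: f_weight_def y_weight_def s ennreal_leI)
  qed
  then show False
    using wsum_y_weight_2[of \<kappa> m] f_fun_imp_wsum[OF assms] by simp
qed

text \<open>With b = x+(y+z)/2 one has b \<le> 3(x+y), from z \<le> 9/2 (x+y) and x \<le> y, and b
  \<le> 2z. Since t < 2 these ratios cost at most 9 and 4, and (9+4)/2 = 13/2.\<close>

lemma f_weight_le_g_weight:
  assumes "0 \<le> x" "x \<le> y" "y \<le> z" "0 < y" "z \<le> 9/2 * (x + y)" and t: "0 < t" "t < 2"
  shows "f_weight t (x, y, z) \<le> 13/2 * g_weight t (x, y, z)"
proof -
  define b where "b = x + (y + z) / 2"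
  have b: "0 < b" unfolding b_def by (rule add_nonneg_pos) (use assms in auto)
  have *: "r powr (- t) \<le> k\<^sup>2 * b powr (- t)" if "b \<le> k * r" "1 \<le> k" "0 < r" for r k
  proof -
    have "r powr (- t) = k powr t * (k * r) powr (- t)"
      using that by (simp add: powr_mult powr_minus field_simps)
    also have "\<dots> \<le> k powr 2 * b powr (- t)"
      using that b t by (intro mult_mono powr_mono powr_neg_antimono) auto
    finally show ?thesis using that by simp
  qed
  have "(x + y) powr (- t) \<le> 3\<^sup>2 * b powr (- t)"
    by (rule *) (use assms in \<open>auto simp: b_def field_simps\<close>)
  moreover have "z powr (- t) \<le> 2\<^sup>2 * b powr (- t)"
    by (rule *) (use assms in \<open>auto simp: b_def field_simps\<close>)
  ultimately show ?thesis by (simp add: f_weight_def g_weight_def b_def)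
qed

theorem exponent_gap:
  assumes \<kappa>: "1 < \<kappa>" "\<kappa> \<le> (3 + 2 * sqrt 2) ^ (m + 1)"
    and mu: "1/2 < mu" "f_fun m \<kappa> 0 1 1 mu = 1" and lam: "1/2 < lam" "g_fun m \<kappa> 0 1 1 lam = 1"
  shows "0 < mu - lam \<and> mu - lam < 2.3 / ln \<kappa>"
proof -
  let ?S = "triples \<kappa> m"
  have wf: "0 \<le> x" "x \<le> y" "y \<le> z" "1 \<le> y" "z \<le> 9/2 * (x + y)" "\<kappa> \<le> y"
    if "(w, (x, y, z)) \<in> ?S" for w x y z
  proof -
    note A = triples_well_formed[OF that]
    show "0 \<le> x" "x \<le> y" "y \<le> z" "z \<le> 9/2 * (x + y)" using A(1) by (auto simp: well_formed_def)
    show "1 \<le> y" using A(1) growth_ge_1[of 1] by (auto simp: well_formed_def)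
    show "\<kappa> \<le> y" using A(2) \<kappa>(2) unfolding growth_1 by auto
  qed
  note f1 = f_fun_imp_wsum[OF mu(2)] and g1 = g_fun_imp_wsum[OF lam(2)]
  have lt: "lam < mu"
  proof (rule ccontr)
    assume "\<not> lam < mu"
    \<comment> \<open>If mu \<le> lam, the g sum at mu is at least 1. The f sum at mu is that sum
      plus the sum of \<open>\<Delta>\<close>, so equality with 1 leaves no room for a positive
      \<open>\<Delta>\<close>.\<close>
    define \<Delta> where "\<Delta> s = f_weight mu s - g_weight mu s" for s
    have \<Delta>: "0 \<le> \<Delta> s" if "(w, s) \<in> ?S" for w s
      using wf[of w "fst s" "fst (snd s)" "snd (snd s)"] that mu(1)
        g_weight_le_f_weight[of "fst s" "fst (snd s)" "snd (snd s)" mu] by (simp add: \<Delta>_def)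
    have "wsum ?S (\<lambda>s. ennreal (g_weight lam s)) \<le> wsum ?S (\<lambda>s. ennreal (g_weight mu s))"
    proof (rule wsum_mono)
      fix w s assume ws: "(w, s) \<in> ?S"
      obtain x y z where s: "s = (x, y, z)" by (metis prod_cases3)
      show "ennreal (g_weight lam s) \<le> ennreal (g_weight mu s)"
        using g_weight_decay[of 1 x y z mu lam] wf[OF ws[unfolded s]] \<open>\<not> lam < mu\<close>
        by (simp add: s ennreal_leI)
    qed
    moreover have "1 = wsum ?S (\<lambda>s. ennreal (g_weight mu s)) + wsum ?S (\<lambda>s. ennreal (\<Delta> s))"
      unfolding f1[symmetric] wsum_add[symmetric]
      by (rule wsum_cong) (use \<Delta> in \<open>simp add: \<Delta>_def g_weight_nonneg flip: ennreal_plus\<close>)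
    ultimately have le: "1 + wsum ?S (\<lambda>s. ennreal (\<Delta> s)) \<le> 1"
      unfolding g1 by (metis add_right_mono)
    obtain w x y z where u: "(w, (x, y, z)) \<in> ?S" "x + y \<noteq> z" using unbalanced_mem_triples by blast
    have "0 < \<Delta> (x, y, z)"
      using g_weight_less_f_weight[of x y z mu] wf[OF u(1)] u(2) mu(1) by (simp add: \<Delta>_def)
    moreover have "ennreal (\<Delta> (x, y, z)) \<le> wsum ?S (\<lambda>s. ennreal (\<Delta> s))"
      unfolding wsum_def using nn_integral_ge_point[OF u(1), of "\<lambda>p. ennreal (\<Delta> (snd p))"] by simp
    ultimately have "0 < wsum ?S (\<lambda>s. ennreal (\<Delta> s))"
      by (metis ennreal_less_zero_iff order_less_le_trans)
    then have "1 + 0 < 1 + wsum ?S (\<lambda>s. ennreal (\<Delta> s))"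
      unfolding ennreal_add_left_cancel_less by simp
    with le show False unfolding add.right_neutral by (meson leD)
  qed
  \<comment> \<open>Summing f(mu) \<le> 13/2 g(mu) \<le> r g(lam), where both outer sums are 1,
    gives 1 \<le> r.\<close>
  define r where "r = 13/2 * \<kappa> powr (- (mu - lam))"
  have "wsum ?S (\<lambda>s. ennreal (f_weight mu s)) \<le> wsum ?S (\<lambda>s. ennreal r * ennreal (g_weight lam s))"
  proof (rule wsum_mono)
    fix w s assume ws: "(w, s) \<in> ?S"
    obtain x y z where s: "s = (x, y, z)" by (metis prod_cases3)
    note xyz = wf[OF ws[unfolded s]]
    have "f_weight mu s \<le> 13/2 * g_weight mu s"
      unfolding s using f_weight_le_g_weight[of x y z mu] xyz mu(1) mu_less_2[OF mu(2)] by auto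
    also have "\<dots> \<le> 13/2 * (\<kappa> powr (- (mu - lam)) * g_weight lam s)"
      unfolding s using xyz \<kappa> lt by (intro mult_left_mono g_weight_decay) auto
    finally have "f_weight mu s \<le> r * g_weight lam s" by (simp add: r_def)
    then show "ennreal (f_weight mu s) \<le> ennreal r * ennreal (g_weight lam s)"
      by (simp add: ennreal_leI g_weight_nonneg r_def flip: ennreal_mult)
  qed
  then have "1 \<le> ennreal r" unfolding wsum_cmult f1 g1 by simp
  then have "1 \<le> r" by simp
  then have "\<kappa> powr (mu - lam) \<le> 13/2"
  proof -
    have "\<kappa> powr (mu - lam) * 1 \<le> \<kappa> powr (mu - lam) * r"
      using \<open>1 \<le> r\<close> by (intro mult_left_mono) auto
    also have "\<dots> = 13/2 * (\<kappa> powr (mu - lam) * \<kappa> powr (- (mu - lam)))" by (simp only: r_def mult_ac)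
    also have "\<kappa> powr (mu - lam) * \<kappa> powr (- (mu - lam)) = 1"
      using \<kappa>(1) unfolding powr_add[symmetric] by simp
    finally show ?thesis by simp
  qed
  then have "ln (\<kappa> powr (mu - lam)) \<le> ln (13/2)"
    using \<kappa>(1) by (subst ln_le_cancel_iff) auto
  then have "(mu - lam) * ln \<kappa> \<le> ln (13/2)"
    using \<kappa>(1) by (simp add: ln_powr)
  \<comment> \<open>Here 2.3 is split as 1.15 + 1.15, and the quadratic Taylor bound gives exp 1.15
    > 2.8, whose square exceeds 13/2.\<close>
  also have "ln (13/2 :: real) < 2.3"
  proof -
    have "1 + 1.15 + 1.15\<^sup>2 / 2 \<le> exp (1.15 :: real)" by (rule exp_lower_Taylor_quadratic) simp
    then have "2.8 \<le> exp (1.15 :: real)" by (simp add: power2_eq_square)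
    then have "2.8 * 2.8 \<le> exp (1.15 :: real) * exp 1.15" by (intro mult_mono) auto
    then have "13/2 < exp (2.3 :: real)" by (simp flip: exp_add)
    then have "ln (13/2) < ln (exp (2.3 :: real))" by (subst ln_less_cancel_iff) auto
    then show ?thesis by simp
  qed
  finally show ?thesis using lt \<kappa>(1) by (simp add: field_simps)
qed

section \<open>Circle coordinates and Moebius transformations\<close>

text \<open>A disk with circle coordinates \<open>w\<close> is the set where the Hermitian form \<open>hf w\<close> is negative,
  and \<open>lor w = 1\<close> is the normalization of circle coordinates.\<close>

definition hf :: "real^4 \<Rightarrow> complex \<Rightarrow> real" where
  "hf w z = w $ 1 * (cmod z)\<^sup>2 - 2 * (w $ 2 * Re z + w $ 3 * Im z) + w $ 4"

definition lor :: "real^4 \<Rightarrow> real" where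
  "lor w = (w $ 2)\<^sup>2 + (w $ 3)\<^sup>2 - w $ 1 * w $ 4"

definition region :: "real^4 \<Rightarrow> complex set" where
  "region w = {z. hf w z < 0}"

definition centre :: "real^4 \<Rightarrow> complex" where
  "centre w = Complex (w $ 2 / w $ 1) (w $ 3 / w $ 1)"

lemma hf_add: "hf (w + u) z = hf w z + hf u z"
  by (simp add: hf_def algebra_simps)

lemma hf_scale: "hf (t *\<^sub>R w) z = t * hf w z"
  by (simp add: hf_def algebra_simps)

lemma hf_uminus: "hf (- w) z = - hf w z"
  by (simp add: hf_def)

lemma hf_centre:
  assumes "w $ 1 \<noteq> 0"
  shows "hf w z = w $ 1 * (cmod (z - centre w))\<^sup>2 - lor w / w $ 1"
  unfolding hf_def centre_def lor_def cmod_power2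
  using assms by (simp add: power2_eq_square field_simps)

text \<open>Such a vector describes a point or an imaginary circle, so the form is semidefinite. For
  a sum of two disk vectors this yields disjointness, for a difference inclusion.\<close>

lemma hf_nonneg:
  assumes "w $ 1 > 0" "lor w \<le> 0"
  shows "0 \<le> hf w z"
proof -
  have "lor w / w $ 1 \<le> 0" using assms by (simp add: divide_nonpos_pos)
  moreover have "0 \<le> w $ 1 * (cmod (z - centre w))\<^sup>2" using assms by simp
  moreover have "hf w z = w $ 1 * (cmod (z - centre w))\<^sup>2 - lor w / w $ 1"
    using assms by (simp add: hf_centre)
  ultimately show ?thesis by linarith
qed

lemma hf_mult:
  assumes "w $ 1 \<noteq> 0"
  shows "hf w z * w $ 1 = (w $ 1 * cmod (z - centre w))\<^sup>2 - lor w"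
  unfolding hf_centre[OF assms] power_mult_distrib
  using assms by (simp add: left_diff_distrib power2_eq_square)

lemma hf_neg_iff:
  assumes "w $ 1 > 0" "lor w = 1"
  shows "hf w z < 0 \<longleftrightarrow> dist (centre w) z < 1 / w $ 1"
    and "hf w z \<le> 0 \<longleftrightarrow> dist (centre w) z \<le> 1 / w $ 1"
proof -
  have nz: "w $ 1 \<noteq> 0" using assms by simp
  have abs: "\<bar>w $ 1 * cmod (z - centre w)\<bar> = dist (centre w) z * w $ 1"
    using assms by (simp add: dist_norm norm_minus_commute)
  have "hf w z < 0 \<longleftrightarrow> hf w z * w $ 1 < 0" using assms by (simp add: mult_less_0_iff)
  also have "\<dots> \<longleftrightarrow> dist (centre w) z * w $ 1 < 1"
    unfolding hf_mult[OF nz] assms(2) abs[symmetric] abs_square_less_1[symmetric] by simp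
  finally show "hf w z < 0 \<longleftrightarrow> dist (centre w) z < 1 / w $ 1"
    using assms(1) by (simp add: pos_less_divide_eq)
  have "hf w z \<le> 0 \<longleftrightarrow> hf w z * w $ 1 \<le> 0" using assms by (simp add: mult_le_0_iff)
  also have "\<dots> \<longleftrightarrow> dist (centre w) z * w $ 1 \<le> 1"
    unfolding hf_mult[OF nz] assms(2) abs[symmetric] abs_square_le_1[symmetric] by simp
  finally show "hf w z \<le> 0 \<longleftrightarrow> dist (centre w) z \<le> 1 / w $ 1"
    using assms(1) by (simp add: pos_le_divide_eq)
qed

lemma region_ball:
  assumes "w $ 1 > 0" "lor w = 1"
  shows "region w = ball (centre w) (1 / w $ 1)"
  unfolding region_def ball_def hf_neg_iff(1)[OF assms] ..

lemma region_half_plane: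
  assumes "w $ 1 = 0"
  shows "region w = half_plane (Complex (w $ 2) (w $ 3)) (w $ 4 / 2)"
  using assms by (auto simp: region_def half_plane_def hf_def inner_complex_def algebra_simps)

lemma vec4_eq:
  fixes v w :: "real^4"
  assumes "v $ 1 = w $ 1" "v $ 2 = w $ 2" "v $ 3 = w $ 3" "v $ 4 = w $ 4"
  shows "v = w"
  using assms by (simp add: vec_eq_iff forall_4)

lemma has_circle_coords_iff:
  "has_circle_coords D w \<longleftrightarrow> lor w = 1 \<and> 0 \<le> w $ 1 \<and> D = region w"
proof
  assume "has_circle_coords D w"
  then show "lor w = 1 \<and> 0 \<le> w $ 1 \<and> D = region w"
  proof cases
    case (disk r p)
    have w: "w $ 1 = 1 / r" "w $ 2 = Re p / r" "w $ 3 = Im p / r" "w $ 4 = ((Re p)\<^sup>2 + (Im p)\<^sup>2) / r - r"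
      by (simp_all add: disk disk_coords_def Let_def)
    have l: "lor w = 1" unfolding lor_def w using \<open>r > 0\<close> by (simp add: power2_eq_square field_simps)
    have "centre w = p" "1 / w $ 1 = r" "0 < w $ 1" using \<open>r > 0\<close> by (simp_all add: centre_def w complex_eq_iff)
    then show ?thesis using l region_ball[of w] disk by simp
  next
    case (half_plane u h)
    have w: "w $ 1 = 0" "w $ 2 = Re u" "w $ 3 = Im u" "w $ 4 = 2 * h"
      by (simp_all add: half_plane half_plane_coords_def)
    have "lor w = 1" using half_plane(3) by (simp add: lor_def w cmod_def)
    moreover have "Complex (Re u) (Im u) = u" by simp
    ultimately show ?thesis using region_half_plane[of w] half_plane(1) by (simp add: w)
  qed
next
  assume w: "lor w = 1 \<and> 0 \<le> w $ 1 \<and> D = region w"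
  show "has_circle_coords D w"
  proof (cases "w $ 1 = 0")
    case True
    define u where "u = Complex (w $ 2) (w $ 3)"
    have "norm u = 1" using w True by (simp add: u_def cmod_def lor_def)
    moreover have "half_plane_coords u (w $ 4 / 2) = w"
      by (rule vec4_eq) (simp_all add: half_plane_coords_def u_def True)
    ultimately show ?thesis
      using has_circle_coords.half_plane[of u "w $ 4 / 2"] w region_half_plane[OF True] by (simp add: u_def)
  next
    case False
    then have k: "0 < w $ 1" using w by simp
    have "disk_coords (centre w) (1 / w $ 1) = w"
    proof (rule vec4_eq)
      have "(w $ 2)\<^sup>2 + (w $ 3)\<^sup>2 = 1 + w $ 1 * w $ 4" using w by (simp add: lor_def)
      then have "w $ 1 * ((w $ 2 / w $ 1)\<^sup>2 + (w $ 3 / w $ 1)\<^sup>2) = (1 + w $ 1 * w $ 4) / w $ 1"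
        using k by (simp add: power2_eq_square field_simps)
      then show "disk_coords (centre w) (1 / w $ 1) $ 4 = w $ 4"
        using k by (simp add: disk_coords_def Let_def centre_def add_divide_distrib)
    qed (use k in \<open>simp_all add: disk_coords_def Let_def centre_def\<close>)
    then show ?thesis
      using has_circle_coords.disk[of "1 / w $ 1" "centre w"] w k region_ball[OF k] by simp
  qed
qed

lemma closure_region:
  assumes "lor w = 1" "0 \<le> w $ 1"
  shows "closure (region w) = {z. hf w z \<le> 0}"
proof (cases "w $ 1 = 0")
  case True
  have "Complex (w $ 2) (w $ 3) \<noteq> 0" using assms True by (auto simp: lor_def complex_eq_iff)
  then have "closure (region w) = {p. Complex (w $ 2) (w $ 3) \<bullet> p \<ge> w $ 4 / 2}"
    unfolding region_half_plane[OF True] half_plane_def inner_commute[of _ "Complex _ _"]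
    by (rule closure_halfspace_gt)
  also have "\<dots> = {z. hf w z \<le> 0}"
    by (auto simp: hf_def True inner_complex_def)
  finally show ?thesis .
next
  case False
  then have k: "0 < w $ 1" using assms by simp
  then show ?thesis
    unfolding hf_neg_iff(2)[OF k assms(1)] region_ball[OF k assms(1)] by (simp add: cball_def)
qed

lemma unbounded_region_0:
  assumes "lor w = 1" "w $ 1 = 0" shows "\<not> bounded (region w)"
proof
  assume "bounded (region w)"
  then obtain B where B: "\<And>z. z \<in> region w \<Longrightarrow> cmod z \<le> B" by (auto simp: bounded_iff)
  define t where "t = 1 + \<bar>B\<bar> + \<bar>w $ 4\<bar>"
  define u where "u = Complex (w $ 2) (w $ 3)"
  have u: "cmod u = 1" "(w $ 2)\<^sup>2 + (w $ 3)\<^sup>2 = 1" using assms by (simp_all add: u_def cmod_def lor_def)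
  have "hf w (of_real t * u) = - 2 * t * ((w $ 2)\<^sup>2 + (w $ 3)\<^sup>2) + w $ 4"
    by (simp add: hf_def assms u_def power2_eq_square algebra_simps)
  also have "\<dots> < 0" unfolding u(2) by (simp add: t_def)
  finally have "of_real t * u \<in> region w" by (simp add: region_def)
  from B[OF this] have "\<bar>t\<bar> \<le> B" by (simp add: norm_mult u)
  then show False by (simp add: t_def)
qed

lemma region_bounded_imp:
  assumes "lor w = 1" "bounded (region w)" shows "0 < w $ 1"
proof (rule ccontr)
  assume "\<not> 0 < w $ 1"
  then consider "w $ 1 = 0" | "w $ 1 < 0" by linarith
  then show False
  proof cases
    case 2
    have "- region w \<subseteq> cball (centre w) (1 / \<bar>w $ 1\<bar>)"
    proof
      fix z assume "z \<in> - region w"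
      then have "0 \<le> hf w z" by (simp add: region_def)
      then have "hf w z * w $ 1 \<le> 0" using 2 by (simp add: mult_nonneg_nonpos)
      then have "\<bar>w $ 1 * cmod (z - centre w)\<bar> \<le> 1"
        using 2 assms by (simp add: hf_mult flip: abs_square_le_1)
      then have "dist (centre w) z * \<bar>w $ 1\<bar> \<le> 1"
        by (simp add: abs_mult dist_norm norm_minus_commute mult.commute)
      then show "z \<in> cball (centre w) (1 / \<bar>w $ 1\<bar>)"
        unfolding mem_cball using 2 by (subst pos_le_divide_eq) auto
    qed
    then have "bounded (region w \<union> - region w)"
      using assms(2) bounded_cball bounded_subset by (metis bounded_Un)
    then show False by simp
  qed (use unbounded_region_0 assms in auto)
qed

text \<open>The region alone determines the curvature although \<open>u\<close> might a priori
  describe the exterior of a disk. Such an exterior is unbounded, and its complement is bounded,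
  unlike that of a half-plane.\<close>

lemma curvature_eq:
  assumes "has_curvature (region u) k" "lor u = 1"
  shows "u $ 1 = k"
proof -
  obtain w where w: "lor w = 1" "0 \<le> w $ 1" "region u = region w" "w $ 1 = k"
    using assms(1) unfolding has_curvature_def has_circle_coords_iff by blast
  show ?thesis
  proof (cases "w $ 1 = 0")
    case False
    then have k: "0 < w $ 1" using w by simp
    then have "0 < u $ 1"
      using region_bounded_imp[OF assms(2)] region_ball[OF k w(1)] w(3) by simp
    then have "ball (centre u) (1 / u $ 1) = ball (centre w) (1 / w $ 1)"
      using w k region_ball assms(2) by metis
    moreover have "0 < 1 / u $ 1" "0 < 1 / w $ 1" using k \<open>0 < u $ 1\<close> by simp_all
    ultimately have "1 / u $ 1 = 1 / w $ 1" unfolding ball_eq_ball_iff by linarith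
    then show ?thesis using w(4) by simp
  next
    case True
    have nu: "\<not> 0 < u $ 1"
      using unbounded_region_0[OF w(1) True] w(3) region_ball[OF _ assms(2)] by auto
    have "\<not> u $ 1 < 0"
    proof
      assume neg: "u $ 1 < 0"
      have l: "lor (- w) = 1" "(- w) $ 1 = 0" using w True by (simp_all add: lor_def)
      have "lor (- u) = 1" "0 < (- u) $ 1" using assms(2) neg by (simp_all add: lor_def)
      then have "closure (region (- u)) = {z. hf (- u) z \<le> 0}"
        by (intro closure_region) auto
      also have "\<dots> = - region u" by (auto simp: region_def hf_uminus)
      finally have cl: "closure (region (- u)) = - region w" using w(3) by simp
      have "bounded (closure (region (- u)))"
        unfolding region_ball[OF \<open>0 < (- u) $ 1\<close> \<open>lor (- u) = 1\<close>] by (intro bounded_closure bounded_ball)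
      moreover have "region (- w) \<subseteq> - region w"
        by (auto simp: region_def hf_uminus)
      ultimately have "bounded (region (- w))" unfolding cl by (rule bounded_subset)
      then show False using unbounded_region_0[OF l] by simp
    qed
    then show ?thesis using nu True w(4) by simp
  qed
qed

text \<open>Action of the Moebius matrix on Hermitian forms: the inverse (s y - q)/(p - r y) is
  substituted into \<open>hf w\<close>, denominators are cleared, and the result is divided by the
  modulus of the determinant.\<close>

definition Lam :: "complex \<Rightarrow> complex \<Rightarrow> complex \<Rightarrow> complex \<Rightarrow> real^4 \<Rightarrow> real^4" where
  "Lam p q r s w = (let
      d = cmod (p * s - q * r);
      W = Complex (w $ 2) (w $ 3);
      V = of_real (w $ 1) * cnj s * q + W * cnj s * p + cnj W * q * cnj r + of_real (w $ 4) * p * cnj r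
    in vector [(w $ 1 * (cmod s)\<^sup>2 + 2 * Re (cnj W * s * cnj r) + w $ 4 * (cmod r)\<^sup>2) / d, Re V / d, Im V / d,
       (w $ 1 * (cmod q)\<^sup>2 + 2 * Re (cnj W * q * cnj p) + w $ 4 * (cmod p)\<^sup>2) / d])"

text \<open>\<open>lor\<close> is minus the determinant of the Hermitian matrix. The congruence
  multiplies it by the squared modulus of p s - q r, which the normalization divides out.\<close>

lemma lor_Lam:
  assumes "p * s - q * r \<noteq> 0"
  shows "lor (Lam p q r s w) = lor w"
proof -
  define d where "d = cmod (p * s - q * r)"
  define W where "W = Complex (w $ 2) (w $ 3)"
  define k :: complex where "k = of_real (w $ 1)"
  define l :: complex where "l = of_real (w $ 4)"
  define V where "V = k * cnj s * q + W * cnj s * p + cnj W * q * cnj r + l * p * cnj r"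
  define K where "K = w $ 1 * (cmod s)\<^sup>2 + 2 * Re (cnj W * s * cnj r) + w $ 4 * (cmod r)\<^sup>2"
  define L where "L = w $ 1 * (cmod q)\<^sup>2 + 2 * Re (cnj W * q * cnj p) + w $ 4 * (cmod p)\<^sup>2"
  have d: "d \<noteq> 0" using assms by (simp add: d_def)
  have tr: "complex_of_real (2 * Re x) = x + cnj x" for x by (simp add: complex_add_cnj)
  have K: "complex_of_real K = k * (s * cnj s) + (cnj W * s * cnj r + W * cnj s * r) + l * (r * cnj r)"
    unfolding K_def of_real_add tr unfolding of_real_mult complex_norm_square k_def l_def by simp
  have L: "complex_of_real L = k * (q * cnj q) + (cnj W * q * cnj p + W * cnj q * p) + l * (p * cnj p)"
    unfolding L_def of_real_add tr unfolding of_real_mult complex_norm_square k_def l_def by simp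
  have V': "cnj V = k * s * cnj q + cnj W * s * cnj p + W * cnj q * r + l * cnj p * r"
    by (simp add: V_def k_def l_def)
  have "complex_of_real ((cmod V)\<^sup>2 - K * L) = V * cnj V - complex_of_real K * complex_of_real L"
    unfolding of_real_diff of_real_mult complex_norm_square ..
  also have "\<dots> = (W * cnj W - k * l) * ((p * s - q * r) * cnj (p * s - q * r))"
    unfolding K L V' unfolding V_def complex_cnj_diff complex_cnj_mult by algebra
  also have "\<dots> = complex_of_real (((cmod W)\<^sup>2 - w $ 1 * w $ 4) * d\<^sup>2)"
    unfolding of_real_diff of_real_mult complex_norm_square k_def l_def d_def ..
  finally have "(cmod V)\<^sup>2 - K * L = lor w * d\<^sup>2"
    by (simp only: of_real_eq_iff) (simp add: lor_def W_def cmod_power2)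
  moreover have "lor (Lam p q r s w) = (Re V / d)\<^sup>2 + (Im V / d)\<^sup>2 - (K / d) * (L / d)"
    by (simp add: lor_def Lam_def Let_def V_def K_def L_def W_def k_def l_def d_def)
  moreover have "\<dots> = ((cmod V)\<^sup>2 - K * L) / d\<^sup>2"
    unfolding cmod_power2 using d by (simp add: power2_eq_square field_simps)
  ultimately show ?thesis using d by simp
qed

lemma hf_Lam:
  assumes "p * s - q * r \<noteq> 0"
  shows "hf (Lam p q r s w) z * cmod (p * s - q * r) = w $ 1 * (cmod (s * z - q))\<^sup>2
      - 2 * (w $ 2 * Re ((s * z - q) * cnj (p - r * z)) + w $ 3 * Im ((s * z - q) * cnj (p - r * z)))
      + w $ 4 * (cmod (p - r * z))\<^sup>2"
proof -
  define d where "d = cmod (p * s - q * r)"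
  define W where "W = Complex (w $ 2) (w $ 3)"
  define V where "V = of_real (w $ 1) * cnj s * q + W * cnj s * p + cnj W * q * cnj r + of_real (w $ 4) * p * cnj r"
  define K where "K = w $ 1 * (cmod s)\<^sup>2 + 2 * Re (cnj W * s * cnj r) + w $ 4 * (cmod r)\<^sup>2"
  define L where "L = w $ 1 * (cmod q)\<^sup>2 + 2 * Re (cnj W * q * cnj p) + w $ 4 * (cmod p)\<^sup>2"
  have "d \<noteq> 0" using assms by (simp add: d_def)
  moreover have "hf (Lam p q r s w) z = K / d * (cmod z)\<^sup>2 - 2 * (Re V / d * Re z + Im V / d * Im z) + L / d"
    by (simp add: hf_def Lam_def Let_def V_def K_def L_def W_def d_def)
  ultimately have "hf (Lam p q r s w) z * d = K * (cmod z)\<^sup>2 - 2 * (Re V * Re z + Im V * Im z) + L"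
    by (simp add: field_simps)
  also have "\<dots> = w $ 1 * (cmod (s * z - q))\<^sup>2
      - 2 * (w $ 2 * Re ((s * z - q) * cnj (p - r * z)) + w $ 3 * Im ((s * z - q) * cnj (p - r * z)))
      + w $ 4 * (cmod (p - r * z))\<^sup>2"
    unfolding K_def V_def L_def W_def cmod_power2 by (simp add: power2_eq_square algebra_simps)
  finally show ?thesis by (simp add: d_def)
qed

lemma Lam_add: "Lam p q r s (w + u) = Lam p q r s w + Lam p q r s u"
  by (rule vec4_eq; simp add: Lam_def Let_def add_divide_distrib[symmetric])
     (simp_all add: algebra_simps)

lemma Lam_scale: "Lam p q r s (t *\<^sub>R w) = t *\<^sub>R Lam p q r s w"
  by (rule vec4_eq; simp add: Lam_def Let_def) (simp_all add: algebra_simps)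

lemma hf_moebius:
  assumes det: "p * s - q * r \<noteq> 0" and z: "r * z + s \<noteq> 0" and y: "y = (p * z + q) / (r * z + s)"
  shows "hf (Lam p q r s w) y * (cmod (r * z + s))\<^sup>2 = hf w z * cmod (p * s - q * r)"
proof -
  define Y where "Y = p - r * y"
  have Y: "Y * (r * z + s) = p * s - q * r"
    using z by (simp add: Y_def y field_simps)
  have X: "s * y - q = z * Y"
    using z by (simp add: Y_def y field_simps)
  have hY: "hf (Lam p q r s w) y * cmod (p * s - q * r) = hf w z * (cmod Y)\<^sup>2"
  proof -
    have YY: "(z * Y) * cnj Y = z * of_real ((cmod Y)\<^sup>2)" unfolding complex_norm_square by (simp add: mult.assoc)
    show ?thesis
      unfolding hf_Lam[OF det] Y_def[symmetric] X YY
      by (simp add: hf_def norm_mult power_mult_distrib algebra_simps)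
  qed
  have cY: "cmod Y * cmod (r * z + s) = cmod (p * s - q * r)"
    unfolding Y[symmetric] by (simp add: norm_mult)
  have "(hf (Lam p q r s w) y * (cmod (r * z + s))\<^sup>2) * cmod (p * s - q * r)
      = (hf (Lam p q r s w) y * cmod (p * s - q * r)) * (cmod (r * z + s))\<^sup>2"
    by (simp only: mult_ac)
  also have "\<dots> = hf w z * (cmod Y * cmod (r * z + s))\<^sup>2"
    unfolding hY power_mult_distrib by (simp only: mult_ac)
  also have "\<dots> = (hf w z * cmod (p * s - q * r)) * cmod (p * s - q * r)"
    unfolding cY by (simp add: power2_eq_square)
  finally show ?thesis using det by simp
qed

text \<open>Nonnegative curvature means that the region does not contain the point at infinity, so
  the image of infinity cannot lie in the new region.\<close>

lemma moebius_region_eq: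
  assumes det: "p * s - q * r \<noteq> 0" and w: "0 \<le> w $ 1"
    and maps: "maps_onto (moebius p q r s) (region w) E"
  shows "E = region (Lam p q r s w)"
proof (intro equalityI subsetI)
  fix y assume "y \<in> E"
  then have "Some y \<in> moebius p q r s ` Some ` region w" using maps unfolding maps_onto_def by simp
  then obtain z where z: "z \<in> region w" "moebius p q r s (Some z) = Some y"
    by (elim imageE) simp
  then have *: "r * z + s \<noteq> 0" "y = (p * z + q) / (r * z + s)" by (auto split: if_splits)
  have "hf (Lam p q r s w) y * (cmod (r * z + s))\<^sup>2 < 0"
    unfolding hf_moebius[OF det *] using z det by (simp add: region_def mult_neg_pos)
  then show "y \<in> region (Lam p q r s w)" by (simp add: region_def mult_less_0_iff)
next
  fix y assume y: "y \<in> region (Lam p q r s w)"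
  have Y: "p - r * y \<noteq> 0"
  proof
    assume 0: "p - r * y = 0"
    have "hf (Lam p q r s w) y * cmod (p * s - q * r) = w $ 1 * (cmod (s * y - q))\<^sup>2"
      unfolding hf_Lam[OF det] 0 by simp
    moreover have "hf (Lam p q r s w) y * cmod (p * s - q * r) < 0"
      using y det by (simp add: region_def mult_neg_pos)
    moreover have "0 \<le> w $ 1 * (cmod (s * y - q))\<^sup>2" using w by simp
    ultimately show False by linarith
  qed
  define z where "z = (s * y - q) / (p - r * y)"
  have "(r * z + s) * (p - r * y) = p * s - q * r" using Y by (simp add: z_def field_simps)
  then have nz: "r * z + s \<noteq> 0" using det by auto
  have zY: "z * (p - r * y) = s * y - q" using Y by (simp add: z_def)
  have "(p * z + q) * (p - r * y) = p * (z * (p - r * y)) + q * (p - r * y)"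
    by (simp only: algebra_simps)
  also have "\<dots> = y * (r * (z * (p - r * y)) + s * (p - r * y))"
    unfolding zY by (simp add: algebra_simps)
  also have "\<dots> = (y * (r * z + s)) * (p - r * y)"
    by (simp only: algebra_simps)
  finally have "p * z + q = y * (r * z + s)" using Y by simp
  then have yz: "y = (p * z + q) / (r * z + s)" using nz by simp
  have "hf w z * cmod (p * s - q * r) < 0"
    unfolding hf_moebius[OF det nz yz, symmetric] using y nz by (simp add: region_def mult_neg_pos)
  then have "z \<in> region w" by (simp add: region_def mult_less_0_iff)
  then have "Some y \<in> moebius p q r s ` Some ` region w"
    using nz yz by (auto simp: image_iff)
  then show "y \<in> E" using maps unfolding maps_onto_def by auto
qed

text \<open>Positive curvature of the image excludes a pole in the region: at a pole, the new
  curvature is a nonnegative multiple of \<open>hf w\<close>, which is negative on the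
  region.\<close>

lemma moebius_maps_onto:
  assumes det: "p * s - q * r \<noteq> 0" and w: "0 \<le> w $ 1" and k: "0 < Lam p q r s w $ 1"
  shows "maps_onto (moebius p q r s) (region w) (region (Lam p q r s w))"
proof -
  have nz: "r * z + s \<noteq> 0" if z: "z \<in> region w" for z
  proof
    assume 0: "r * z + s = 0"
    then have s: "s = - (r * z)" by (simp add: eq_neg_iff_add_eq_0 add.commute)
    have "cnj (Complex (w $ 2) (w $ 3)) * s * cnj r = - (cnj (Complex (w $ 2) (w $ 3)) * z) * of_real ((cmod r)\<^sup>2)"
      unfolding s complex_norm_square by (simp add: algebra_simps)
    then have re: "Re (cnj (Complex (w $ 2) (w $ 3)) * s * cnj r) = - (w $ 2 * Re z + w $ 3 * Im z) * (cmod r)\<^sup>2"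
      by (simp add: algebra_simps)
    have cs: "(cmod s)\<^sup>2 = (cmod r)\<^sup>2 * (cmod z)\<^sup>2" by (simp add: s norm_mult power_mult_distrib)
    have "Lam p q r s w $ 1 * cmod (p * s - q * r) = w $ 1 * (cmod s)\<^sup>2
        + 2 * Re (cnj (Complex (w $ 2) (w $ 3)) * s * cnj r) + w $ 4 * (cmod r)\<^sup>2"
      using det by (simp add: Lam_def Let_def)
    also have "\<dots> = hf w z * (cmod r)\<^sup>2"
      unfolding re cs hf_def by (simp add: algebra_simps)
    finally have "Lam p q r s w $ 1 * cmod (p * s - q * r) = hf w z * (cmod r)\<^sup>2" .
    moreover have "hf w z * (cmod r)\<^sup>2 \<le> 0" using z by (simp add: region_def mult_nonpos_nonneg)
    moreover have "0 < Lam p q r s w $ 1 * cmod (p * s - q * r)" using k det by simp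
    ultimately show False by linarith
  qed
  let ?E = "{y. \<exists>z\<in>region w. y = (p * z + q) / (r * z + s)}"
  have maps: "maps_onto (moebius p q r s) (region w) ?E"
    unfolding maps_onto_def image_image
  proof (intro equalityI subsetI)
    fix o' assume "o' \<in> (\<lambda>z. moebius p q r s (Some z)) ` region w"
    then show "o' \<in> Some ` ?E" using nz by auto
  next
    fix o' assume "o' \<in> Some ` ?E"
    then obtain z where z: "z \<in> region w" "o' = Some ((p * z + q) / (r * z + s))" by auto
    then have "o' = moebius p q r s (Some z)" using nz[OF z(1)] by simp
    then show "o' \<in> (\<lambda>z. moebius p q r s (Some z)) ` region w" using z(1) by blast
  qed
  then show ?thesis using moebius_region_eq[OF det w maps] by simp
qed

section \<open>The orbit of the seeds\<close>

text \<open>The reflection in the circle through the three points of tangency: it fixes A, B, C and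
  exchanges the two gaps between them.\<close>

fun flip :: "quad \<Rightarrow> quad" where
  "flip (x, y, z, d) = (x, y, z, - d)"

text \<open>Symmetry of the octahedron that exchanges the antipodal pairs marked in f; by
  \<open>flop_flop\<close> these form an elementary abelian group of order 8.\<close>

definition flop :: "face \<Rightarrow> quad \<Rightarrow> quad" where
  "flop f v = lift f (flip v)"

definition face_refl :: "face \<Rightarrow> quad \<Rightarrow> quad" where
  "face_refl f v = flop f (flip (flop f v))"

fun xor3 :: "face \<Rightarrow> face \<Rightarrow> face" where
  "xor3 (i, j, k) (i', j', k') = (i \<noteq> i', j \<noteq> j', k \<noteq> k')"

definition unit_quads :: "quad set" where
  "unit_quads = {(1, 0, 0, 0), (0, 1, 0, 0), (0, 0, 1, 0)}"

text \<open>The three base disks, those in one gap between them, and their mirror images in the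
  other gap.\<close>

definition packing_quads :: "quad set" where
  "packing_quads = unit_quads \<union> all_disks \<union> flip ` all_disks"

lemma flip_flip [simp]: "flip (flip v) = v"
  by (cases v) simp

lemma lift_eq_flop: "lift f v = flop f (flip v)"
  by (simp add: flop_def)

lemma flop_id: "flop (False, False, False) v = v"
  by (cases v) (simp add: flop_def Let_def)

lemma flop_flop: "flop f (flop g v) = flop (xor3 f g) v"
proof -
  obtain i j k i' j' k' x y z d where "f = (i, j, k)" "g = (i', j', k')" "v = (x, y, z, d)"
    by (metis prod_cases4 prod_cases3)
  then show ?thesis
    by (cases i; cases j; cases k; cases i'; cases j'; cases k') (simp_all add: flop_def Let_def)
qed

lemma xor3_eq_0_iff: "xor3 f g = (False, False, False) \<longleftrightarrow> f = g"
  by (cases f; cases g) auto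

lemma flop_units:
  "flop (i, j, k) (1, 0, 0, 0) = (if i then (1, 2, 2, 2) else (1, 0, 0, 0))"
  "flop (i, j, k) (0, 1, 0, 0) = (if j then (2, 1, 2, 2) else (0, 1, 0, 0))"
  "flop (i, j, k) (0, 0, 1, 0) = (if k then (2, 2, 1, 2) else (0, 0, 1, 0))"
  by (cases i; cases j; cases k; simp add: flop_def Let_def)+

lemma flop_tips:
  "flop (i, j, k) (1, 2, 2, 2) = (if i then (1, 0, 0, 0) else (1, 2, 2, 2))"
  "flop (i, j, k) (2, 1, 2, 2) = (if j then (0, 1, 0, 0) else (2, 1, 2, 2))"
  "flop (i, j, k) (2, 2, 1, 2) = (if k then (0, 0, 1, 0) else (2, 2, 1, 2))"
  by (cases i; cases j; cases k; simp add: flop_def Let_def)+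

lemma flop_unit_tip:
  assumes "v \<in> unit_quads \<union> tips" shows "flop f v \<in> unit_quads \<union> tips"
proof -
  obtain i j k where f: "f = (i, j, k)" by (metis prod_cases3)
  from assms show ?thesis
    unfolding f unit_quads_def tips_def
    by (elim UnE insertE emptyE; simp only: flop_units flop_tips split: if_split) blast+
qed

lemma all_disks_cases:
  assumes "v \<in> all_disks"
  obtains "v \<in> tips" | f u where "f \<in> faces" "u \<in> all_disks" "v = lift f u"
proof -
  from assms obtain n where n: "v \<in> disks n" by (auto simp: all_disks_def)
  then obtain m where "n = Suc m" by (cases n) auto
  with n have "v \<in> disks (Suc m)" by simp
  then show ?thesis
  proof (cases rule: disks_SucE)
    case (2 f u)
    then have "u \<in> all_disks" unfolding all_disks_def by blast
    then show ?thesis using that(2) 2 by blast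
  qed (rule that(1))
qed

lemma tips_all_disks: "v \<in> tips \<Longrightarrow> v \<in> all_disks"
  using disks_Suc_tips[of v 0] by (auto simp: all_disks_def simp del: disks.simps)

lemma lift_all_disks: "v \<in> all_disks \<Longrightarrow> f \<in> faces \<Longrightarrow> lift f v \<in> all_disks"
  unfolding all_disks_def using disks_Suc_lift by blast

lemma flip_packing: "v \<in> packing_quads \<Longrightarrow> flip v \<in> packing_quads"
  unfolding packing_quads_def by (auto simp: unit_quads_def image_iff)

text \<open>Octahedral symmetries permute the gaps: \<open>flop f\<close> carries the gap beyond g
  to the one beyond \<open>xor3 f g\<close>. When f = g this is the gap on the other side of the
  base face, hence the mirror images.\<close>

lemma flop_packing:
  assumes "v \<in> packing_quads" shows "flop f v \<in> packing_quads"
proof -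
  have lift': "lift f u \<in> packing_quads" if "u \<in> all_disks" for f u
  proof (cases "f \<in> faces")
    case False
    then have "lift f u = flip u"
      using flop_id[of "flip u"] by (simp add: faces_def lift_eq_flop)
    then show ?thesis using that by (simp add: packing_quads_def)
  qed (use lift_all_disks[OF that] in \<open>simp add: packing_quads_def\<close>)
  have unit_tip: "flop f v \<in> packing_quads" if "v \<in> unit_quads \<union> tips" for v
    using flop_unit_tip[OF that, of f] tips_all_disks unfolding packing_quads_def by blast
  consider "v \<in> unit_quads" | "v \<in> all_disks" | u where "u \<in> all_disks" "v = flip u"
    using assms by (auto simp: packing_quads_def)
  then show ?thesis
  proof cases
    case 2
    then show ?thesis
    proof (cases rule: all_disks_cases)
      case (2 g u)
      have "flop f v = lift (xor3 f g) u"
        unfolding 2(3) lift_eq_flop flop_flop ..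
      then show ?thesis using lift'[OF 2(2)] by simp
    qed (use unit_tip in auto)
  next
    case (3 u)
    then show ?thesis using lift'[of u f] by (simp add: lift_eq_flop)
  qed (use unit_tip in auto)
qed

text \<open>Coefficients with respect to e1, e3, e4 and a fourth vector (e2-e1)/2 - e3 - e4, chosen
  so that e2 becomes the antipode (1,2,2,2) of e1; it is a multiple of the normal
  (1,-1,2,2).\<close>

fun phi :: "quad \<Rightarrow> real^4" where
  "phi (x, y, z, d) = vector [x - d / 2, d / 2, y - d, z - d]"

fun circ :: "quad \<Rightarrow> real^4" where
  "circ (x, y, z, d) = vector [2 * x, sqrt 2 * d, y - z, y + z - x / 2]"

lemma circ_phi: "(\<Sum>i\<in>UNIV. (phi v $ i) *\<^sub>R (BM_basis $ i)) = circ v"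
proof -
  obtain x y z d where v: "v = (x, y, z, d)" by (metis prod_cases4)
  show ?thesis
    by (rule vec4_eq) (simp_all add: v sum_4 BM_basis_def disk_coords_def half_plane_coords_def Let_def
        power2_eq_square field_simps)
qed

lemma lor_circ: "lor (circ v) = qf v"
  by (cases v) (simp add: lor_def power2_eq_square algebra_simps)

lemma J_form_eq: "J_form x y = x $ 1 * y $ 1 + x $ 2 * y $ 2 + x $ 3 * y $ 3 + x $ 4 * y $ 4
    - 3 * (x $ 1 * y $ 2 + x $ 2 * y $ 1) - (x $ 1 * y $ 3 + x $ 3 * y $ 1) - (x $ 1 * y $ 4 + x $ 4 * y $ 1)
    - (x $ 2 * y $ 3 + x $ 3 * y $ 2) - (x $ 2 * y $ 4 + x $ 4 * y $ 2) - (x $ 3 * y $ 4 + x $ 4 * y $ 3)"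
  by (simp add: J_form_def J_mat_def matrix_vector_mult_def inner_vec_def sum_4 algebra_simps)

text \<open>Four generators are reflections in dual circles of faces of the base octahedron; the
  fifth is the octahedral symmetry that exchanges e3 with its antipode.\<close>

lemma J_refl_phi:
  "J_refl (vector [-1, 1, 2, 2]) (phi v) = phi (face_refl (True, False, False) v)"
  "J_refl (vector [1, -1, 2, 2]) (phi v) = phi (face_refl (False, False, False) v)"
  "J_refl (vector [3, 1, 2, -2]) (phi v) = phi (face_refl (False, False, True) v)"
  "J_refl (vector [1, 3, 2, -2]) (phi v) = phi (face_refl (True, False, True) v)"
  "J_refl (vector [1, 1, -2, 0]) (phi v) = phi (flop (False, True, False) v)"
  by (rule vec4_eq; cases v; simp add: J_refl_def J_form_eq face_refl_def flop_def Let_def field_simps)+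

lemma seeds_phi:
  "axis 1 1 = phi (1, 0, 0, 0)" "axis 2 1 = phi (1, 2, 2, 2)" "axis 3 1 = phi (0, 1, 0, 0)"
  "axis 4 1 = phi (0, 0, 1, 0)" "axis 1 1 + axis 2 1 - axis 4 1 = phi (2, 2, 1, 2)"
  by (rule vec4_eq; simp add: axis_def)+

declare phi.simps [simp del]

lemma BM_seeds_eq:
  "BM_seeds = phi ` {(1, 0, 0, 0), (1, 2, 2, 2), (0, 1, 0, 0), (0, 0, 1, 0), (2, 2, 1, 2)}"
  unfolding BM_seeds_def seeds_phi(5) unfolding seeds_phi(1-4) image_insert image_empty ..

lemma phi_image_J_refl:
  assumes "n \<in> BM_normals" "w \<in> phi ` packing_quads"
  shows "J_refl n w \<in> phi ` packing_quads"
proof -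
  obtain v where v: "v \<in> packing_quads" "w = phi v" using assms(2) by blast
  have *: "face_refl f v \<in> packing_quads" "flop f v \<in> packing_quads" for f
    unfolding face_refl_def by (intro flop_packing flip_packing v(1))+
  show ?thesis
    using assms(1) unfolding BM_normals_def v(2) by (auto simp: J_refl_phi intro!: imageI * )
qed

lemma J_refl_involutive:
  assumes "n \<in> BM_normals" shows "J_refl n (J_refl n x) = x"
proof -
  have "J_form n n \<noteq> 0" using assms by (auto simp: BM_normals_def J_form_eq)
  moreover have "J_form (x - t *\<^sub>R n) n = J_form x n - t * J_form n n" for t
    by (simp add: J_form_eq algebra_simps)
  ultimately show ?thesis by (simp add: J_refl_def)
qed

lemma J_refl_Bij:
  assumes "n \<in> BM_normals"
  shows "J_refl n \<in> Bij UNIV" "inv\<^bsub>BijGroup UNIV\<^esub> (J_refl n) = J_refl n"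
proof -
  have "bij (J_refl n)" using J_refl_involutive[OF assms] by (rule involuntory_imp_bij)
  then show bij: "J_refl n \<in> Bij UNIV" by (simp add: Bij_def)
  have "inv_into UNIV (J_refl n) = J_refl n" using J_refl_involutive[OF assms] by (intro inv_equality) auto
  then show "inv\<^bsub>BijGroup UNIV\<^esub> (J_refl n) = J_refl n"
    using inv_BijGroup[OF bij] by (simp add: restrict_def)
qed

lemma BijGroup_UNIV_mult:
  assumes "g \<in> Bij UNIV" "h \<in> Bij UNIV"
  shows "g \<otimes>\<^bsub>BijGroup UNIV\<^esub> h = g \<circ> h"
  using assms by (simp add: BijGroup_def compose_def o_def restrict_def)

text \<open>Bijectivity is carried through the induction because the multiplication of
  \<open>BijGroup\<close> is composition only on bijections.\<close>

lemma BM_group_Bij: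
  assumes "g \<in> BM_group"
  shows "g \<in> Bij UNIV \<and> (\<forall>w\<in>phi ` packing_quads. g w \<in> phi ` packing_quads)"
  using assms unfolding BM_group_def
proof (induction rule: generate.induct)
  case one
  have "\<one>\<^bsub>BijGroup UNIV\<^esub> = (id :: real^4 \<Rightarrow> real^4)" by (simp add: BijGroup_def id_def restrict_def)
  moreover have "bij (\<lambda>w :: real^4. w)" using bij_id unfolding id_def .
  ultimately show ?case by (simp add: Bij_def id_def)
next
  case (incl h)
  then show ?case using J_refl_Bij phi_image_J_refl by auto
next
  case (inv h)
  then show ?case using J_refl_Bij phi_image_J_refl by auto
next
  case (eng h1 h2)
  then have "h1 \<circ> h2 \<in> Bij UNIV" by (auto simp: Bij_def intro: bij_comp)
  moreover have "h1 \<otimes>\<^bsub>BijGroup UNIV\<^esub> h2 = h1 \<circ> h2"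
    using eng by (intro BijGroup_UNIV_mult) auto
  moreover have "\<forall>w\<in>phi ` packing_quads. (h1 \<circ> h2) w \<in> phi ` packing_quads"
    using eng unfolding o_apply by blast
  ultimately show ?case by (simp only:)
qed

definition seed_orbit :: "(real^4) set" where
  "seed_orbit = {g v | g v. g \<in> BM_group \<and> v \<in> BM_seeds}"

lemma seed_orbit_J_refl:
  assumes "n \<in> BM_normals" "w \<in> seed_orbit" shows "J_refl n w \<in> seed_orbit"
proof -
  obtain g v where gv: "g \<in> BM_group" "v \<in> BM_seeds" "w = g v"
    using assms(2) by (auto simp: seed_orbit_def)
  have "J_refl n \<otimes>\<^bsub>BijGroup UNIV\<^esub> g \<in> BM_group"
    unfolding BM_group_def
    by (rule generate.eng[OF generate.incl gv(1)[unfolded BM_group_def]]) (use assms(1) in blast)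
  moreover have "J_refl n \<otimes>\<^bsub>BijGroup UNIV\<^esub> g = J_refl n \<circ> g"
    using J_refl_Bij(1)[OF assms(1)] BM_group_Bij[OF gv(1)] by (simp add: BijGroup_UNIV_mult)
  ultimately have "J_refl n \<circ> g \<in> BM_group" by simp
  moreover have "J_refl n w = (J_refl n \<circ> g) v" by (simp add: gv(3))
  ultimately show ?thesis unfolding seed_orbit_def using gv(2) by blast
qed

lemma seeds_subset: "BM_seeds \<subseteq> seed_orbit"
proof
  fix v assume "v \<in> BM_seeds"
  moreover have "\<one>\<^bsub>BijGroup UNIV\<^esub> v = v" by (simp add: BijGroup_def)
  moreover have "\<one>\<^bsub>BijGroup UNIV\<^esub> \<in> BM_group" unfolding BM_group_def by (rule generate.one)
  ultimately show "v \<in> seed_orbit" unfolding seed_orbit_def by (metis (mono_tags, lifting) mem_Collect_eq)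
qed

lemma phi_flop_orbit: "phi v \<in> seed_orbit \<Longrightarrow> phi (flop (False, True, False) v) \<in> seed_orbit"
  using seed_orbit_J_refl[of "vector [1, 1, -2, 0]" "phi v"] by (simp add: BM_normals_def J_refl_phi)

text \<open>Only faces with middle entry False occur among the generators; the other four
  reflections are conjugates under the exchange of e3 with its antipode.\<close>

lemma phi_face_refl_orbit:
  assumes "phi v \<in> seed_orbit" shows "phi (face_refl f v) \<in> seed_orbit"
proof -
  have *: "phi (face_refl (i, False, k) v) \<in> seed_orbit" if "phi v \<in> seed_orbit" for i k v
    using seed_orbit_J_refl[of _ "phi v"] that unfolding BM_normals_def
    by (cases i; cases k) (auto simp flip: J_refl_phi)
  obtain i j k where f: "f = (i, j, k)" by (metis prod_cases3)
  show ?thesis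
  proof (cases j)
    case True
    let ?S = "flop (False, True, False)"
    have "?S (face_refl (i, False, k) (?S v)) = face_refl f v"
      by (simp add: face_refl_def flop_flop f True)
    then show ?thesis using phi_flop_orbit[OF *[OF phi_flop_orbit[OF assms], of i k]] by simp
  qed (use * assms f in auto)
qed

text \<open>Five of the six disks of the octahedron are seeds; the missing antipode (2,1,2,2) is the
  image of e3 under the fifth generator.\<close>

lemma phi_unit_tip_orbit:
  assumes "v \<in> unit_quads \<union> tips" shows "phi v \<in> seed_orbit"
proof -
  have "phi (0, 1, 0, 0) \<in> seed_orbit" using seeds_subset unfolding BM_seeds_eq by blast
  then have "phi (2, 1, 2, 2) \<in> seed_orbit"
    using phi_flop_orbit[of "(0, 1, 0, 0)"] by (simp add: flop_def Let_def)
  moreover have "phi (1, 0, 0, 0) \<in> seed_orbit" "phi (0, 0, 1, 0) \<in> seed_orbit"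
    "phi (1, 2, 2, 2) \<in> seed_orbit" "phi (2, 2, 1, 2) \<in> seed_orbit"
    using seeds_subset unfolding BM_seeds_eq by blast+
  ultimately show ?thesis
    using assms \<open>phi (0, 1, 0, 0) \<in> seed_orbit\<close> by (auto simp: unit_quads_def tips_def)
qed

text \<open>The claim covers all octahedral images so that the induction closes: with h =
  \<open>xor3 f g\<close>, \<open>flop f (lift g u)\<close> is the reflection in face h of
  \<open>flop h u\<close>.\<close>

lemma phi_disks_orbit: "v \<in> disks n \<Longrightarrow> phi (flop f v) \<in> seed_orbit"
proof (induction n arbitrary: v f)
  case (Suc n)
  from Suc.prems show ?case
  proof (cases rule: disks_SucE)
    case 1
    then show ?thesis by (intro phi_unit_tip_orbit flop_unit_tip) simp
  next
    case (2 g u)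
    have "flop f v = face_refl (xor3 f g) (flop (xor3 f g) u)"
      using flop_id xor3_eq_0_iff[of "xor3 f g" "xor3 f g"]
      by (simp add: 2(3) lift_eq_flop flop_flop face_refl_def)
    then show ?thesis using phi_face_refl_orbit[OF Suc.IH[OF 2(2)]] by simp
  qed
qed simp

theorem seed_orbit_eq: "seed_orbit = phi ` packing_quads"
proof (intro equalityI subsetI)
  fix w assume "w \<in> seed_orbit"
  then obtain g v where gv: "g \<in> BM_group" "v \<in> BM_seeds" "w = g v"
    by (auto simp: seed_orbit_def)
  have "BM_seeds \<subseteq> phi ` (unit_quads \<union> tips)"
    unfolding BM_seeds_eq unit_quads_def tips_def by (rule image_mono) blast
  then have "v \<in> phi ` packing_quads"
    using gv(2) tips_all_disks unfolding packing_quads_def by blast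
  then show "w \<in> phi ` packing_quads" using BM_group_Bij[OF gv(1)] gv(3) by blast
next
  fix w assume "w \<in> phi ` packing_quads"
  then obtain v where v: "v \<in> packing_quads" "w = phi v" by auto
  have disk: "phi u \<in> seed_orbit" if "u \<in> all_disks" for u
    using that phi_disks_orbit[of u _ "(False, False, False)"] by (auto simp: all_disks_def flop_id)
  consider "v \<in> unit_quads" | "v \<in> all_disks" | u where "u \<in> all_disks" "v = flip u"
    using v(1) by (auto simp: packing_quads_def)
  then show "w \<in> seed_orbit"
  proof cases
    case (3 u)
    then have "v = face_refl (False, False, False) u" by (simp add: face_refl_def flop_id)
    then show ?thesis using phi_face_refl_orbit[OF disk[OF 3(1)]] v(2) by simp
  qed (use v(2) phi_unit_tip_orbit disk in auto)
qed

lemma BM_packing_eq: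
  "BM_packing = {D. \<exists>v\<in>packing_quads. has_circle_coords D (circ v)}"
proof -
  have "BM_packing = {D. \<exists>w\<in>seed_orbit. represents w D}"
    unfolding BM_packing_def seed_orbit_def by blast
  then show ?thesis unfolding seed_orbit_eq represents_def by (simp add: circ_phi)
qed

section \<open>Disks in a curvilinear triangle\<close>

lemma in_gap_all_disks: "v \<in> all_disks \<Longrightarrow> in_gap v"
  unfolding all_disks_def using in_gap_disks by blast

lemma qf_all_disks: "v \<in> all_disks \<Longrightarrow> qf v = 1"
  unfolding all_disks_def using qf_disks by blast

text \<open>\<open>N\<close> sends a coefficient vector to the circle coordinates, in the plane of the triangle, of
  the disk that it represents.\<close>

locale triangle =
  fixes a b c :: real and A B C :: "complex set" and N :: "quad \<Rightarrow> real^4"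
  assumes sides: "0 \<le> a" "a \<le> b" "b \<le> c" "0 < b"
    and N_linear: "N (x, y, z, d) = x *\<^sub>R N (1, 0, 0, 0) + y *\<^sub>R N (0, 1, 0, 0) + z *\<^sub>R N (0, 0, 1, 0) + d *\<^sub>R N (0, 0, 0, 1)"
    and lor_N: "lor (N v) = qf v"
    and curvature_N: "N v $ 1 = dotq v (gap a b c)"
    and A_eq: "A = region (N (1, 0, 0, 0))" and B_eq: "B = region (N (0, 1, 0, 0))" and C_eq: "C = region (N (0, 0, 1, 0))"
    and null_N: "2 * (hf (N (1, 0, 0, 0)) p * hf (N (0, 1, 0, 0)) p + hf (N (1, 0, 0, 0)) p * hf (N (0, 0, 1, 0)) p
        + hf (N (0, 1, 0, 0)) p * hf (N (0, 0, 1, 0)) p) = (hf (N (0, 0, 0, 1)) p)\<^sup>2"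
begin

definition K where "K = closure A \<union> closure B \<union> closure C"

text \<open>Unit normalization of the vector orthogonal to A, B, C, that is, the disk bounded by the
  circle through the points of tangency; its curvature is \<open>neck_d a b c\<close>.\<close>

abbreviation "dual \<equiv> (0, 0, 0, 1 / sqrt 2) :: quad"

lemma N_add: "N v + N w = N (v + w)"
proof -
  obtain x y z d where v: "v = (x, y, z, d)" by (metis prod_cases4)
  obtain x' y' z' d' where w: "w = (x', y', z', d')" by (metis prod_cases4)
  show ?thesis
    unfolding v w plus_prod_def fst_conv snd_conv N_linear[of x] N_linear[of x'] N_linear[of "x + x'"]
    by (simp add: scaleR_add_left)
qed

lemma N_diff: "N v - N w = N (v - w)"
  using N_add[of "v - w" w] by (simp add: diff_eq_eq)

lemma d_pos: "0 < neck_d a b c"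
proof -
  have "0 < b * c" "0 \<le> a * b" "0 \<le> a * c" using sides by auto
  then have "0 < a * b + a * c + b * c" by linarith
  then show ?thesis by (simp add: neck_d_def)
qed

lemma dual_scale: "(1 / sqrt 2) * (1 / sqrt 2) = (1 / 2 :: real)" "1 / 2 \<le> 1 / sqrt (2 :: real)"
  by (simp_all add: divide_simps real_le_lsqrt)

lemma not_in_K_iff: "p \<notin> K \<longleftrightarrow> 0 < hf (N (1, 0, 0, 0)) p \<and> 0 < hf (N (0, 1, 0, 0)) p \<and> 0 < hf (N (0, 0, 1, 0)) p"
proof -
  have "closure A = {z. hf (N (1, 0, 0, 0)) z \<le> 0}" "closure B = {z. hf (N (0, 1, 0, 0)) z \<le> 0}"
    "closure C = {z. hf (N (0, 0, 1, 0)) z \<le> 0}"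
    unfolding A_eq B_eq C_eq
    by (rule closure_region; use sides in \<open>simp add: lor_N curvature_N gap_def\<close>)+
  then show ?thesis by (auto simp: K_def not_le)
qed

lemma dual_pos: "0 < N dual $ 1" and lor_dual: "lor (N dual) = 1"
  using d_pos by (simp_all add: curvature_N lor_N gap_def power_divide)

lemma hf_dual: "hf (N dual) p = hf (N (0, 0, 0, 1)) p / sqrt 2"
  using N_linear[of 0 0 0 "1 / sqrt 2"] by (simp add: hf_scale)

text \<open>The component of p in the complement of K cannot leave the dual disk: on its boundary
  the right-hand side of \<open>null_N\<close> vanishes, while outside K all products on the left
  are positive.\<close>

lemma in_triangle:
  assumes "hf (N dual) p < 0" "p \<notin> K"
  shows "p \<in> inside K"
proof -
  define U where "U = connected_component_set (- K) p"
  have U: "connected U" "p \<in> U" "U \<subseteq> - K"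
    using assms(2) connected_component_subset by (auto simp: U_def)
  have "U \<subseteq> region (N dual)"
  proof (rule ccontr)
    assume "\<not> U \<subseteq> region (N dual)"
    then have "U \<inter> frontier (region (N dual)) \<noteq> {}"
      using U assms(1) by (intro connected_Int_frontier) (auto simp: region_def)
    then obtain y where y: "y \<in> U" "y \<in> frontier (region (N dual))" by blast
    have "y \<in> closure (region (N dual))" "y \<notin> region (N dual)"
      using y(2) unfolding frontier_def region_ball[OF dual_pos lor_dual] by auto
    then have "hf (N dual) y = 0"
      using closure_region[OF lor_dual] dual_pos by (auto simp: region_def)
    then have "(hf (N (0, 0, 0, 1)) y)\<^sup>2 = 0" by (simp add: hf_dual)
    moreover have "0 < hf (N (1, 0, 0, 0)) y" "0 < hf (N (0, 1, 0, 0)) y" "0 < hf (N (0, 0, 1, 0)) y"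
      using y(1) U(3) not_in_K_iff by auto
    ultimately show False using null_N[of y] by (smt (verit) mult_pos_pos)
  qed
  then have "bounded U"
    unfolding region_ball[OF dual_pos lor_dual] by (rule bounded_subset[OF bounded_ball])
  then show ?thesis using assms(2) by (simp add: inside_def U_def)
qed

text \<open>The value 2 of \<open>lor (w + N dual)\<close> encodes orthogonality of w to the dual
  circle. So the centre of the dual disk has power R, its squared radius, with respect to w, and an
  outward ray from p does not meet w again.\<close>

lemma ray_avoids:
  assumes w: "0 \<le> w $ 1" and l: "lor w = 1" "lor (w + N dual) = 2"
    and p: "0 \<le> hf (N dual) p" "0 < hf w p" and t: "1 \<le> t"
  shows "0 < hf w (centre (N dual) + of_real t * (p - centre (N dual)))"
proof -
  define u where "u = N dual"
  define R where "R = 1 / (u $ 1)\<^sup>2"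
  define k where "k = w $ 1 * R"
  define o' where "o' = centre u"
  define P where "P = (cmod (p - o'))\<^sup>2"
  define L where "L = 2 * (w $ 1 * (Re o' * Re (p - o') + Im o' * Im (p - o')) - (w $ 2 * Re (p - o') + w $ 3 * Im (p - o')))"
  have u: "0 < u $ 1" "lor u = 1" using dual_pos lor_dual by (simp_all add: u_def)
  have exp: "hf w (o' + of_real s * (p - o')) = w $ 1 * P * s\<^sup>2 + L * s + hf w o'" for s
    unfolding hf_def P_def L_def cmod_power2 by (simp add: power2_eq_square algebra_simps)
  have orth: "2 * (w $ 2 * u $ 2 + w $ 3 * u $ 3) = w $ 1 * u $ 4 + w $ 4 * u $ 1"
    using l u(2) unfolding lor_def u_def[symmetric] by (simp add: power2_eq_square algebra_simps)
  have uu: "(u $ 2)\<^sup>2 + (u $ 3)\<^sup>2 = 1 + u $ 1 * u $ 4" using u(2) by (simp add: lor_def)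
  have "hf w o' * (u $ 1)\<^sup>2 = w $ 1 * ((u $ 2)\<^sup>2 + (u $ 3)\<^sup>2) - (2 * (w $ 2 * u $ 2 + w $ 3 * u $ 3)) * u $ 1 + w $ 4 * (u $ 1)\<^sup>2"
    unfolding hf_def o'_def centre_def cmod_power2 using u(1)
    by (simp add: power2_eq_square field_simps)
  also have "\<dots> = w $ 1" unfolding uu orth by (simp add: power2_eq_square algebra_simps)
  finally have ho: "hf w o' = k" using u(1) by (simp add: k_def R_def field_simps)
  have "0 \<le> hf u p * u $ 1" using p(1) u(1) by (simp add: u_def)
  then have "1 \<le> (u $ 1)\<^sup>2 * P"
    using u hf_mult[of u p] by (simp add: P_def o'_def power_mult_distrib)
  then have P: "R \<le> P" using u(1) by (simp add: R_def divide_le_eq mult.commute)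
  have p1: "0 < w $ 1 * P + L + k" using exp[of 1] p(2) ho by simp
  \<comment> \<open>The quadratic in t has constant term \<open>w $ 1 * R\<close>, so it equals t
    times its value at 1 plus a remainder that is nonnegative, since p lies outside the dual disk (P
    \<ge> R).\<close>
  have "hf w (o' + of_real t * (p - o')) = t * (w $ 1 * P + L + k) + w $ 1 * (t - 1) * (t * P - R)"
    unfolding exp ho k_def by (simp add: power2_eq_square algebra_simps)
  moreover have "0 < t * (w $ 1 * P + L + k)" using t p1 by simp
  moreover have "0 \<le> w $ 1 * (t - 1) * (t * P - R)"
  proof -
    have "0 \<le> P" by (simp add: P_def)
    then have "P \<le> t * P" using t mult_right_mono[of 1 t P] by simp
    then show ?thesis using w t P by simp
  qed
  ultimately show ?thesis by (simp add: o'_def u_def)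
qed

text \<open>The radial ray from p is unbounded, connected and avoids A, B and C, as all three are
  orthogonal to the dual circle.\<close>

lemma not_in_triangle:
  assumes p: "0 \<le> hf (N dual) p"
  shows "p \<notin> inside K"
proof
  assume inside: "p \<in> inside K"
  then have pK: "p \<notin> K" by (simp add: inside_def)
  define q where "q = centre (N dual)"
  define ray where "ray = (\<lambda>t. q + of_real t * (p - q)) ` {1..}"
  have "p \<noteq> q"
  proof
    assume "p = q"
    then have "hf (N dual) p * N dual $ 1 = - 1"
      using hf_mult[of "N dual" p] dual_pos lor_dual by (simp add: q_def)
    then show False using p dual_pos by (metis mult_nonneg_nonneg less_imp_le neg_0_le_iff_le not_one_le_zero)
  qed
  have "p \<in> ray" unfolding ray_def by (rule image_eqI[of _ _ 1]) auto
  moreover have "connected ray"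
    unfolding ray_def by (intro connected_continuous_image continuous_intros) auto
  moreover have "ray \<subseteq> - K"
  proof
    fix y assume "y \<in> ray"
    then obtain t where t: "1 \<le> t" "y = q + of_real t * (p - q)" by (auto simp: ray_def)
    have "0 < hf (N v) y" if "v \<in> unit_quads" "0 < hf (N v) p" for v
      unfolding t(2) q_def
      by (rule ray_avoids[OF _ _ _ p _ t(1)])
         (use that sides in \<open>auto simp: N_add lor_N curvature_N unit_quads_def gap_def power_divide\<close>)
    then show "y \<in> - K"
      using pK by (simp add: not_in_K_iff unit_quads_def)
  qed
  ultimately have "ray \<subseteq> connected_component_set (- K) p" by (intro connected_component_maximal)
  then have "bounded ray" using inside bounded_subset by (auto simp: inside_def)
  then obtain M where M: "\<And>y. y \<in> ray \<Longrightarrow> cmod y \<le> M" by (auto simp: bounded_iff)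
  define t where "t = 1 + (\<bar>M\<bar> + cmod q) / cmod (p - q)"
  have pq: "0 < cmod (p - q)" using \<open>p \<noteq> q\<close> by simp
  have t1: "1 \<le> t" using pq by (simp add: t_def)
  have "cmod (of_real t * (p - q)) \<le> cmod (q + of_real t * (p - q)) + cmod q"
    using norm_triangle_ineq4[of "q + of_real t * (p - q)" q] by simp
  also have "\<dots> \<le> M + cmod q" using t1 by (intro add_right_mono M) (auto simp: ray_def)
  finally have "t * cmod (p - q) \<le> M + cmod q" using t1 by (simp add: norm_mult)
  moreover have "t * cmod (p - q) = cmod (p - q) + \<bar>M\<bar> + cmod q"
    using pq by (simp add: t_def field_simps)
  ultimately show False using pq by linarith
qed

lemma curvature_pos:
  assumes "v \<in> all_disks" shows "N dual $ 1 < N v $ 1"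
proof -
  obtain x y z d where v: "v = (x, y, z, d)" by (metis prod_cases4)
  have xyz: "0 \<le> x" "0 \<le> y" "0 \<le> z" "1 \<le> d" using in_gap_all_disks[OF assms] v by auto
  have "1 * neck_d a b c \<le> d * neck_d a b c" using d_pos xyz by (intro mult_right_mono) auto
  moreover have "1 * (d * neck_d a b c) < sqrt 2 * (d * neck_d a b c)"
    using d_pos xyz by (intro mult_strict_right_mono) auto
  moreover have "d * (sqrt 2 * neck_d a b c) = sqrt 2 * (d * neck_d a b c)" by simp
  moreover have "0 \<le> x * a" "0 \<le> y * b" "0 \<le> z * c" using sides xyz by auto
  ultimately have "neck_d a b c < x * a + y * b + z * c + d * (sqrt 2 * neck_d a b c)" by linarith
  then show ?thesis by (simp add: curvature_N v gap_def)
qed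

text \<open>By \<open>hf_nonneg\<close>, the triangle inequalities of \<open>in_gap\<close> make the
  disk disjoint from A, B, C, and d \<ge> 1 places it inside the dual disk.\<close>

lemma disk_in_triangle:
  assumes v: "v \<in> all_disks" shows "region (N v) \<subseteq> inside K"
proof
  fix p assume "p \<in> region (N v)"
  then have p: "hf (N v) p < 0" by (simp add: region_def)
  obtain x y z d where v_eq: "v = (x, y, z, d)" by (metis prod_cases4)
  have gap: "0 \<le> x" "0 \<le> y" "0 \<le> z" "1 \<le> d" "x + 1 \<le> y + z" "y + 1 \<le> x + z" "z + 1 \<le> x + y"
    using in_gap_all_disks[OF v] v_eq by auto
  have q1: "x\<^sup>2 + y\<^sup>2 + z\<^sup>2 - 2 * x * y - 2 * x * z - 2 * y * z + 2 * d\<^sup>2 = 1"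
    using qf_all_disks[OF v] v_eq by simp
  have pos: "0 < N v $ 1" using curvature_pos[OF v] dual_pos by linarith
  have "0 < hf (N u) p" if u: "u \<in> unit_quads" for u
  proof -
    have "0 \<le> hf (N v + N u) p"
    proof (rule hf_nonneg)
      have "0 \<le> N u $ 1" using u sides by (auto simp: unit_quads_def curvature_N gap_def)
      then show "0 < (N v + N u) $ 1" using pos by simp
      show "lor (N v + N u) \<le> 0"
        using u gap q1 unfolding N_add lor_N v_eq
        by (auto simp: unit_quads_def power2_eq_square algebra_simps)
    qed
    then show ?thesis using p by (simp add: hf_add)
  qed
  then have "p \<notin> K" by (simp add: not_in_K_iff unit_quads_def)
  moreover have "0 \<le> hf (N v - N dual) p"
  proof (rule hf_nonneg)
    show "0 < (N v - N dual) $ 1" using curvature_pos[OF v] by simp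
    define h :: real where "h = 1 / sqrt 2"
    have "lor (N v - N (0, 0, 0, h)) = 1 - 4 * (d * h) + 2 * (h * h)"
      using q1 unfolding N_diff lor_N v_eq by (simp add: power2_eq_square algebra_simps)
    moreover have "1 * (1 / 2) \<le> d * h" unfolding h_def using gap dual_scale by (intro mult_mono) auto
    moreover have "h * h = 1 / 2" unfolding h_def by (rule dual_scale)
    ultimately show "lor (N v - N dual) \<le> 0" unfolding h_def[symmetric] by linarith
  qed
  then have "hf (N dual) p < 0"
    using p hf_add[of "N v - N dual" "N dual" p] by simp
  ultimately show "p \<in> inside K" by (intro in_triangle)
qed

text \<open>Changing the sign of d turns the inclusion in the dual disk into disjointness from
  it.\<close>

lemma flipped_not_in_triangle:
  assumes v: "v \<in> all_disks" and pos: "0 < N (flip v) $ 1" and p: "p \<in> region (N (flip v))"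
  shows "p \<notin> inside K"
proof (rule not_in_triangle)
  obtain x y z d where v_eq: "v = (x, y, z, d)" by (metis prod_cases4)
  have d: "1 \<le> d" using in_gap_all_disks[OF v] v_eq by auto
  have q1: "x\<^sup>2 + y\<^sup>2 + z\<^sup>2 - 2 * x * y - 2 * x * z - 2 * y * z + 2 * d\<^sup>2 = 1"
    using qf_all_disks[OF v] v_eq by simp
  have "0 \<le> hf (N (flip v) + N dual) p"
  proof (rule hf_nonneg)
    show "0 < (N (flip v) + N dual) $ 1" using pos dual_pos by simp
    define h :: real where "h = 1 / sqrt 2"
    have "lor (N (flip v) + N (0, 0, 0, h)) = 1 - 4 * (d * h) + 2 * (h * h)"
      using q1 unfolding N_add lor_N v_eq by (simp add: power2_eq_square algebra_simps)
    moreover have "1 * (1 / 2) \<le> d * h" unfolding h_def using d dual_scale by (intro mult_mono) auto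
    moreover have "h * h = 1 / 2" unfolding h_def by (rule dual_scale)
    ultimately show "lor (N (flip v) + N dual) \<le> 0" unfolding h_def[symmetric] by linarith
  qed
  then show "0 \<le> hf (N dual) p" using p by (simp add: hf_add region_def)
qed

lemma packing_in_triangle:
  assumes "v \<in> packing_quads" "region (N v) \<subseteq> inside K" "region (N v) = ball p r" "0 < r"
  shows "v \<in> all_disks"
proof -
  have pin: "p \<in> region (N v)" using assms(3,4) by simp
  then have "p \<in> inside K" using assms(2) by blast
  then have "p \<notin> K" by (simp add: inside_def)
  consider "v \<in> unit_quads" | "v \<in> all_disks" | u where "u \<in> all_disks" "v = flip u"
    using assms(1) by (auto simp: packing_quads_def)
  then show ?thesis
  proof cases
    case 1
    then show ?thesis using \<open>p \<notin> K\<close> pin by (auto simp: not_in_K_iff unit_quads_def region_def)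
  next
    case (3 u)
    have "qf v = 1" using qf_all_disks[OF 3(1)] 3(2) by (cases u) simp
    then have "0 < N v $ 1"
      using region_bounded_imp[of "N v"] assms(3) by (simp add: lor_N)
    then show ?thesis using flipped_not_in_triangle[OF 3(1)] pin \<open>p \<in> inside K\<close> 3(2) by auto
  qed
qed

text \<open>N preserves the quadratic form, so its kernel lies in the radical of \<open>qf\<close>,
  and \<open>qf\<close> is nondegenerate.\<close>

lemma N_inj: "N v = N w \<Longrightarrow> v = w"
proof -
  assume "N v = N w"
  then have z: "N (v - w) = 0" by (simp flip: N_diff)
  obtain x y z d where u: "v - w = (x, y, z, d)" by (metis prod_cases4)
  have eq: "qf ((x, y, z, d) + r) = qf r" for r
    using z unfolding u by (metis N_add add.left_neutral lor_N)
  have "qf (x, y, z, d) = lor 0" using z unfolding u by (metis lor_N)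
  then have q0: "x * x + y * y + z * z - 2 * x * y - 2 * x * z - 2 * y * z + 2 * (d * d) = 0"
    by (simp add: lor_def power2_eq_square)
  have "(x + 1) * (x + 1) + y * y + z * z - 2 * (x + 1) * y - 2 * (x + 1) * z - 2 * y * z + 2 * (d * d) = 1"
    "x * x + (y + 1) * (y + 1) + z * z - 2 * x * (y + 1) - 2 * x * z - 2 * (y + 1) * z + 2 * (d * d) = 1"
    "x * x + y * y + (z + 1) * (z + 1) - 2 * x * y - 2 * x * (z + 1) - 2 * y * (z + 1) + 2 * (d * d) = 1"
    using eq[of "(1, 0, 0, 0)"] eq[of "(0, 1, 0, 0)"] eq[of "(0, 0, 1, 0)"]
    by (simp_all only: qf.simps power2_eq_square add_Pair add_0_right mult_1_right mult_zero_right mult_zero_left diff_zero)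
  then have "x - y - z = 0" "y - x - z = 0" "z - x - y = 0" using q0 by algebra+
  then have "x = 0" "y = 0" "z = 0" by linarith+
  then have "x = 0" "y = 0" "z = 0" "d = 0" using q0 by auto
  then show "v = w" using u by (simp add: zero_prod_def[symmetric])
qed

theorem packing_bij:
  assumes Q1: "\<And>E. E \<in> Q \<Longrightarrow> \<exists>v\<in>packing_quads. E = region (N v) \<and> E \<subseteq> inside K"
    and Q2: "\<And>v. v \<in> packing_quads \<Longrightarrow> 0 < N v $ 1 \<Longrightarrow> region (N v) \<subseteq> inside K \<Longrightarrow> region (N v) \<in> Q"
  shows "bij_betw (\<lambda>v. (centre (N v), 1 / N v $ 1)) all_disks {(p, r). r > 0 \<and> ball p r \<in> Q}"
proof -
  have ball: "region (N v) = ball (centre (N v)) (1 / N v $ 1)" "0 < N v $ 1" if "v \<in> all_disks" for v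
    using curvature_pos[OF that] dual_pos region_ball[of "N v"] qf_all_disks[OF that] by (auto simp: lor_N)
  show ?thesis
    unfolding bij_betw_def
  proof
    show "inj_on (\<lambda>v. (centre (N v), 1 / N v $ 1)) all_disks"
    proof (rule inj_onI)
      fix v w assume v: "v \<in> all_disks" and w: "w \<in> all_disks"
        and eq: "(centre (N v), 1 / N v $ 1) = (centre (N w), 1 / N w $ 1)"
      have k: "0 < N v $ 1" "0 < N w $ 1" using ball v w by auto
      have 1: "N v $ 1 = N w $ 1" using eq by simp
      have 2: "N v $ 2 = N w $ 2" "N v $ 3 = N w $ 3" using eq k 1 by (auto simp: centre_def)
      have "lor (N v) = lor (N w)" using qf_all_disks v w by (simp add: lor_N)
      then have "N v $ 4 = N w $ 4" using k by (simp add: lor_def 1 2)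
      then show "v = w" using 1 2 by (intro N_inj vec4_eq)
    qed
    show "(\<lambda>v. (centre (N v), 1 / N v $ 1)) ` all_disks = {(p, r). r > 0 \<and> ball p r \<in> Q}"
    proof (intro equalityI subsetI)
      fix pr assume "pr \<in> (\<lambda>v. (centre (N v), 1 / N v $ 1)) ` all_disks"
      then obtain v where v: "v \<in> all_disks" "pr = (centre (N v), 1 / N v $ 1)" by auto
      have "region (N v) \<in> Q"
        by (rule Q2) (use v ball disk_in_triangle in \<open>auto simp: packing_quads_def\<close>)
      then show "pr \<in> {(p, r). r > 0 \<and> ball p r \<in> Q}" using v ball by simp
    next
      fix pr assume "pr \<in> {(p, r). r > 0 \<and> ball p r \<in> Q}"
      then obtain p r where pr: "pr = (p, r)" "r > 0" "ball p r \<in> Q" by auto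
      obtain v where v: "v \<in> packing_quads" "ball p r = region (N v)" "ball p r \<subseteq> inside K"
        using Q1[OF pr(3)] by blast
      have "v \<in> all_disks" using packing_in_triangle[OF v(1)] v(2,3) pr(2) by metis
      moreover from this have "ball p r = ball (centre (N v)) (1 / N v $ 1)" using v(2) ball by simp
      then have "p = centre (N v)" "r = 1 / N v $ 1" using pr(2) by (auto simp: ball_eq_ball_iff)
      ultimately show "pr \<in> (\<lambda>v. (centre (N v), 1 / N v $ 1)) ` all_disks" using pr(1) by blast
    qed
  qed
qed

end

lemma circ_linear:
  "circ (x, y, z, d) = x *\<^sub>R circ (1, 0, 0, 0) + y *\<^sub>R circ (0, 1, 0, 0) + z *\<^sub>R circ (0, 0, 1, 0) + d *\<^sub>R circ (0, 0, 0, 1)"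
  by (rule vec4_eq) (simp_all add: algebra_simps)

lemma complex_Re_Im_mult_cnj: "(Re (x * cnj y))\<^sup>2 + (Im (x * cnj y))\<^sup>2 = (cmod x)\<^sup>2 * (cmod y)\<^sup>2"
  using cmod_power2[of "x * cnj y"] by (simp add: norm_mult power_mult_distrib)

text \<open>Evaluation of circle coordinates at a point is the product with a null vector, so the
  values at A, B, C and the dual circle obey the relation between curvatures in a gap. Used twice:
  at finite points, and at infinity, where the values are the curvatures.\<close>

lemma null_identity:
  fixes n1 n2 n3 n4 D :: real
  assumes D: "D \<noteq> 0" and n: "n2\<^sup>2 + n3\<^sup>2 = n1 * n4"
    and "ha * D = 2 * n1 - n4 / 2" "hb * D = n4 - 2 * n3" "hc * D = n4 + 2 * n3" "he * D = 2 * (sqrt 2 * n2)"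
  shows "2 * (ha * hb + ha * hc + hb * hc) = he\<^sup>2"
proof -
  have "2 * (ha * hb + ha * hc + hb * hc) * D\<^sup>2
      = 2 * ((ha * D) * (hb * D) + (ha * D) * (hc * D) + (hb * D) * (hc * D))"
    by (simp add: power2_eq_square algebra_simps)
  also have "\<dots> = 8 * (n1 * n4 - n3\<^sup>2)"
    unfolding assms(3-5) by (simp add: power2_eq_square algebra_simps)
  also have "\<dots> = 8 * n2\<^sup>2" unfolding n[symmetric] by simp
  also have "\<dots> = (he * D)\<^sup>2" unfolding assms(6) by (simp add: power_mult_distrib)
  also have "\<dots> = he\<^sup>2 * D\<^sup>2" by (rule power_mult_distrib)
  finally show ?thesis using D by simp
qed

lemma packing_quads_props:
  assumes "v \<in> packing_quads" shows "qf v = 1" "0 \<le> circ v $ 1"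
proof -
  consider "v \<in> unit_quads" | "v \<in> all_disks" | u where "u \<in> all_disks" "v = flip u"
    using assms by (auto simp: packing_quads_def)
  then have "qf v = 1 \<and> 0 \<le> circ v $ 1"
  proof cases
    case 2
    then show ?thesis using in_gap_all_disks[OF 2] qf_all_disks[OF 2] by (cases v) auto
  next
    case (3 u)
    then show ?thesis using in_gap_all_disks[OF 3(1)] qf_all_disks[OF 3(1)] by (cases u) auto
  qed (auto simp: unit_quads_def)
  then show "qf v = 1" "0 \<le> circ v $ 1" by auto
qed

theorem packing_within_bij:
  assumes sides: "0 \<le> a" "a \<le> b" "b \<le> c" "0 < b" and Q: "BM_packing_within a b c Q"
  obtains F where "bij_betw F all_disks {(p, r). r > 0 \<and> ball p r \<in> Q}"
    "\<And>v. v \<in> all_disks \<Longrightarrow> snd (F v) = 1 / dotq v (gap a b c)"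
proof -
  obtain A B C M D1 D3 D4 where tri: "tangent_triple a b c A B C" and M: "is_moebius M"
    and D: "represents (axis 1 1) D1" "represents (axis 3 1) D3" "represents (axis 4 1) D4"
    and maps: "maps_onto M D1 A" "maps_onto M D3 B" "maps_onto M D4 C"
    and Q_eq: "Q = {E. (\<exists>D\<in>BM_packing. maps_onto M D E) \<and> E \<subseteq> curvilinear_triangle A B C}"
    using Q unfolding BM_packing_within_def by blast
  obtain p q r s where det: "p * s - q * r \<noteq> 0" and M_eq: "M = Defs.moebius p q r s"
    using M unfolding is_moebius_def by blast
  define L where "L v = Lam p q r s (circ v)" for v
  define \<delta> where "\<delta> = cmod (p * s - q * r)"
  have \<delta>: "\<delta> \<noteq> 0" using det by (simp add: \<delta>_def)
  have L_linear: "L (x, y, z, d) = x *\<^sub>R L (1, 0, 0, 0) + y *\<^sub>R L (0, 1, 0, 0) + z *\<^sub>R L (0, 0, 1, 0) + d *\<^sub>R L (0, 0, 0, 1)"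
    for x y z d
    unfolding L_def circ_linear[of x y z d] Lam_add Lam_scale ..
  have lor_L: "lor (L v) = qf v" for v
    unfolding L_def lor_Lam[OF det] by (rule lor_circ)
  have coords: "D1 = region (circ (1, 0, 0, 0))" "D3 = region (circ (0, 1, 0, 0))" "D4 = region (circ (0, 0, 1, 0))"
    using D unfolding represents_def seeds_phi circ_phi has_circle_coords_iff by auto
  have A: "A = region (L (1, 0, 0, 0))" and B: "B = region (L (0, 1, 0, 0))" and C: "C = region (L (0, 0, 1, 0))"
    using maps unfolding M_eq coords L_def by (auto intro!: moebius_region_eq[OF det])
  have curv: "L (1, 0, 0, 0) $ 1 = a" "L (0, 1, 0, 0) $ 1 = b" "L (0, 0, 1, 0) $ 1 = c"
    using tri unfolding tangent_triple_def A B C by (auto intro!: curvature_eq simp: lor_L)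
  have null_L: "2 * (hf (L (1, 0, 0, 0)) y * hf (L (0, 1, 0, 0)) y + hf (L (1, 0, 0, 0)) y * hf (L (0, 0, 1, 0)) y
        + hf (L (0, 1, 0, 0)) y * hf (L (0, 0, 1, 0)) y) = (hf (L (0, 0, 0, 1)) y)\<^sup>2" for y
  proof (rule null_identity[OF \<delta>])
    let ?z = "(s * y - q) * cnj (p - r * y)"
    show "(- Re ?z)\<^sup>2 + (Im ?z)\<^sup>2 = (cmod (s * y - q))\<^sup>2 * (cmod (p - r * y))\<^sup>2"
      unfolding power2_minus by (rule complex_Re_Im_mult_cnj)
  qed (simp_all only: \<delta>_def L_def hf_Lam[OF det], simp_all add: algebra_simps)
  define e where "e = L (0, 0, 0, 1) $ 1"
  have "2 * (a * b + a * c + b * c) = e\<^sup>2"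
    unfolding e_def curv[symmetric]
  proof (rule null_identity[OF \<delta>])
    let ?z = "s * cnj r"
    show "(Re ?z)\<^sup>2 + (- Im ?z)\<^sup>2 = (cmod s)\<^sup>2 * (cmod r)\<^sup>2"
      unfolding power2_minus by (rule complex_Re_Im_mult_cnj)
  qed (use det in \<open>simp_all add: \<delta>_def L_def Lam_def Let_def distrib_left\<close>)
  then have "sqrt (2 * (a * b + a * c + b * c)) = \<bar>e\<bar>" by simp
  then have e: "sqrt 2 * neck_d a b c = \<bar>e\<bar>" by (simp only: neck_d_def real_sqrt_mult)
  \<comment> \<open>The Moebius transformation may reverse the roles of the two triangles bounded by
    \<open>D1\<close>, \<open>D3\<close>, \<open>D4\<close>; the sign of \<open>e\<close> tells which of them is mapped to the bounded one.\<close>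
  define \<tau> where "\<tau> v = (if e \<ge> 0 then v else flip v)" for v
  define N where "N v = L (\<tau> v)" for v
  have \<tau>_packing: "\<tau> v \<in> packing_quads" if "v \<in> packing_quads" for v
    using that flip_packing by (simp add: \<tau>_def)
  have \<tau>\<tau>: "\<tau> (\<tau> v) = v" for v by (simp add: \<tau>_def)
  have N_eq: "N (x, y, z, d) = x *\<^sub>R L (1, 0, 0, 0) + y *\<^sub>R L (0, 1, 0, 0) + z *\<^sub>R L (0, 0, 1, 0)
      + ((if e \<ge> 0 then 1 else - 1) * d) *\<^sub>R L (0, 0, 0, 1)" for x y z d
    unfolding N_def \<tau>_def using L_linear[of x y z d] L_linear[of x y z "- d"] by auto
  have N_units: "N (1, 0, 0, 0) = L (1, 0, 0, 0)" "N (0, 1, 0, 0) = L (0, 1, 0, 0)" "N (0, 0, 1, 0) = L (0, 0, 1, 0)"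
    "N (0, 0, 0, 1) = (if e \<ge> 0 then 1 else - 1) *\<^sub>R L (0, 0, 0, 1)"
    by (subst N_eq, simp)+
  interpret triangle a b c A B C N
  proof
    show "N (x, y, z, d) = x *\<^sub>R N (1, 0, 0, 0) + y *\<^sub>R N (0, 1, 0, 0) + z *\<^sub>R N (0, 0, 1, 0) + d *\<^sub>R N (0, 0, 0, 1)" for x y z d
      unfolding N_units N_eq[of x y z d] by simp
    show "lor (N v) = qf v" for v
      unfolding N_def lor_L \<tau>_def by (cases v) simp
    show "N v $ 1 = dotq v (gap a b c)" for v
      by (cases v) (auto simp: N_eq curv gap_def e e_def[symmetric])
    show "2 * (hf (N (1, 0, 0, 0)) y * hf (N (0, 1, 0, 0)) y + hf (N (1, 0, 0, 0)) y * hf (N (0, 0, 1, 0)) y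
        + hf (N (0, 1, 0, 0)) y * hf (N (0, 0, 1, 0)) y) = (hf (N (0, 0, 0, 1)) y)\<^sup>2" for y
      unfolding N_units hf_scale null_L by simp
  qed (use sides A B C N_units in auto)
  have "bij_betw (\<lambda>v. (centre (N v), 1 / N v $ 1)) all_disks {(p, r). r > 0 \<and> ball p r \<in> Q}"
  proof (rule packing_bij)
    fix E assume "E \<in> Q"
    then obtain D where DE: "D \<in> BM_packing" "maps_onto M D E" "E \<subseteq> inside K"
      unfolding Q_eq curvilinear_triangle_def K_def by blast
    then obtain v where v: "v \<in> packing_quads" "0 \<le> circ v $ 1" "D = region (circ v)"
      unfolding BM_packing_eq has_circle_coords_iff by blast
    have "E = region (N (\<tau> v))"
      using moebius_region_eq[OF det v(2)] DE(2) unfolding M_eq v(3) N_def \<tau>\<tau> L_def by simp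
    then show "\<exists>v\<in>packing_quads. E = region (N v) \<and> E \<subseteq> inside K"
      using \<tau>_packing[OF v(1)] DE(3) by blast
  next
    fix v assume v: "v \<in> packing_quads" "0 < N v $ 1" "region (N v) \<subseteq> inside K"
    note props = packing_quads_props[OF \<tau>_packing[OF v(1)]]
    have "region (circ (\<tau> v)) \<in> BM_packing"
      unfolding BM_packing_eq has_circle_coords_iff lor_circ using \<tau>_packing[OF v(1)] props by blast
    moreover have "maps_onto M (region (circ (\<tau> v))) (region (N v))"
      using moebius_maps_onto[OF det props(2)] v(2) unfolding M_eq N_def L_def by simp
    ultimately show "region (N v) \<in> Q"
      using v(3) unfolding Q_eq curvilinear_triangle_def K_def by blast
  qed
  then show ?thesis
    by (rule that) (simp add: curvature_N)
qed

section \<open>The critical exponent\<close>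

lemma finite_subset_all_disks:
  "finite F \<Longrightarrow> F \<subseteq> all_disks \<Longrightarrow> \<exists>n. F \<subseteq> disks n"
proof (induction F rule: finite_induct)
  case (insert v F)
  then obtain n k where "F \<subseteq> disks n" "v \<in> disks k" by (auto simp: all_disks_def)
  then have "insert v F \<subseteq> disks (max n k)"
    using disks_mono[of n "max n k"] disks_mono[of k "max n k"] by auto
  then show ?case by blast
qed simp

lemma summable_iff_total_finite:
  "(\<lambda>v. dotq v q powr (- t)) summable_on all_disks \<longleftrightarrow> total t q < \<infinity>"
proof
  assume S: "(\<lambda>v. dotq v q powr (- t)) summable_on all_disks"
  have "mass n t q \<le> (\<Sum>\<^sub>\<infinity>v\<in>all_disks. dotq v q powr (- t))" for n
    unfolding mass_def by (rule finite_sum_le_infsum[OF S]) (auto simp: all_disks_def)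
  then have "total t q \<le> ennreal (\<Sum>\<^sub>\<infinity>v\<in>all_disks. dotq v q powr (- t))"
    unfolding total_def by (intro SUP_least ennreal_leI)
  then show "total t q < \<infinity>" by (simp add: order_le_less_trans)
next
  assume fin: "total t q < \<infinity>"
  then obtain T where T: "total t q = ennreal T" "0 \<le> T" by (cases "total t q") auto
  show "(\<lambda>v. dotq v q powr (- t)) summable_on all_disks"
  proof (rule nonneg_bdd_above_summable_on)
    show "bdd_above (sum (\<lambda>v. dotq v q powr (- t)) ` {F. F \<subseteq> all_disks \<and> finite F})"
    proof (rule bdd_aboveI2)
      fix F assume F: "F \<in> {F. F \<subseteq> all_disks \<and> finite F}"
      then have "\<exists>n. F \<subseteq> disks n"
        using finite_subset_all_disks by blast
      then obtain n where "F \<subseteq> disks n" by blast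
      then have "(\<Sum>v\<in>F. dotq v q powr (- t)) \<le> mass n t q"
        unfolding mass_def by (intro sum_mono2) auto
      also have "ennreal (mass n t q) \<le> total t q" unfolding total_def by (rule SUP_upper) simp
      then have "mass n t q \<le> T" using T by simp
      finally show "(\<Sum>v\<in>F. dotq v q powr (- t)) \<le> T" .
    qed
  qed simp
qed

text \<open>The two comparison lemmas bound each total by a fixed multiple of the other, so the
  critical exponent does not depend on the triangle.\<close>

lemma total_gap_finite_iff:
  assumes t: "0 \<le> t" and abc: "0 \<le> a" "a \<le> b" "b \<le> c" "0 < b"
  shows "total t (gap a b c) < \<infinity> \<longleftrightarrow> total t (gap 0 1 1) < \<infinity>"
proof
  have sorted: "sorted_triple (a, b, c)" using abc by (simp add: sorted_triple_def)
  define k where "k = (a + (b + c) / 2) powr (- t)"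
  have "0 < a + (b + c) / 2" by (rule add_nonneg_pos) (use abc in auto)
  then have k: "0 < k" by (simp add: k_def)
  assume fin: "total t (gap a b c) < \<infinity>"
  then obtain T where T: "total t (gap a b c) = ennreal T" "0 \<le> T" by (cases "total t (gap a b c)") auto
  have "mass n t (gap 0 1 1) \<le> T / k" for n
  proof -
    have "k * mass n t (gap 0 1 1) \<le> mass n t (gap a b c)"
      unfolding k_def by (rule mass_lower) (use t abc neck_d_ge(1)[OF sorted] in auto)
    also have "ennreal (mass n t (gap a b c)) \<le> total t (gap a b c)" unfolding total_def by (rule SUP_upper) simp
    then have "mass n t (gap a b c) \<le> T" using T by simp
    finally show ?thesis using k by (simp add: pos_le_divide_eq mult.commute)
  qed
  then have "total t (gap 0 1 1) \<le> ennreal (T / k)" unfolding total_def by (intro SUP_least ennreal_leI)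
  then show "total t (gap 0 1 1) < \<infinity>" by (simp add: order_le_less_trans)
next
  define k where "k = 1/2 * ((a + b) powr (- t) + c powr (- t))"
  have k: "0 \<le> k" by (simp add: k_def)
  assume fin: "total t (gap 0 1 1) < \<infinity>"
  then obtain T where T: "total t (gap 0 1 1) = ennreal T" "0 \<le> T" by (cases "total t (gap 0 1 1)") auto
  have "mass n t (gap a b c) \<le> k * T" for n
  proof -
    have "mass n t (gap a b c) \<le> k * mass n t (gap 0 1 1)"
      unfolding k_def by (rule mass_upper) (use t abc in auto)
    also have "ennreal (mass n t (gap 0 1 1)) \<le> total t (gap 0 1 1)" unfolding total_def by (rule SUP_upper) simp
    then have "mass n t (gap 0 1 1) \<le> T" using T by simp
    then have "k * mass n t (gap 0 1 1) \<le> k * T" using k by (rule mult_left_mono)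
    finally show ?thesis .
  qed
  then have "total t (gap a b c) \<le> ennreal (k * T)" unfolding total_def by (intro SUP_least ennreal_leI)
  then show "total t (gap a b c) < \<infinity>" by (simp add: order_le_less_trans)
qed

lemma dotq_gap_ge:
  assumes "0 \<le> a" "a \<le> b" "b \<le> c" "0 < b" "v \<in> all_disks"
  shows "b \<le> dotq v (gap a b c)"
proof -
  obtain x y z d where v: "v = (x, y, z, d)" by (metis prod_cases4)
  have xyz: "0 \<le> x" "0 \<le> y" "0 \<le> z" "1 \<le> d" using in_gap_all_disks[OF assms(5)] v by auto
  have n: "b \<le> neck_d a b c" using neck_d_ge(1)[of a b c] assms by (simp add: sorted_triple_def)
  have "1 * (1 * neck_d a b c) \<le> d * (sqrt 2 * neck_d a b c)"
    using n xyz assms by (intro mult_mono) auto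
  moreover have "0 \<le> x * a" "0 \<le> y * b" "0 \<le> z * c" using assms xyz by auto
  ultimately have "b \<le> x * a + y * b + z * c + d * (sqrt 2 * neck_d a b c)" using n by linarith
  then show ?thesis by (simp add: v gap_def)
qed

lemma summable_mono_exponent:
  assumes abc: "0 \<le> a" "a \<le> b" "b \<le> c" "0 < b" and "t \<le> u"
    and S: "(\<lambda>v. dotq v (gap a b c) powr (- t)) summable_on all_disks"
  shows "(\<lambda>v. dotq v (gap a b c) powr (- u)) summable_on all_disks"
proof (rule summable_on_comparison_test)
  show "(\<lambda>v. b powr (- (u - t)) * dotq v (gap a b c) powr (- t)) summable_on all_disks"
    using S by (rule summable_on_cmult_right)
  fix v assume v: "v \<in> all_disks"
  have "dotq v (gap a b c) powr (- u) = dotq v (gap a b c) powr (- (u - t)) * dotq v (gap a b c) powr (- t)"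
    by (simp flip: powr_add)
  also have "\<dots> \<le> b powr (- (u - t)) * dotq v (gap a b c) powr (- t)"
    using dotq_gap_ge[OF abc v] abc \<open>t \<le> u\<close> by (intro mult_right_mono powr_neg_antimono) auto
  finally show "dotq v (gap a b c) powr (- u) \<le> b powr (- (u - t)) * dotq v (gap a b c) powr (- t)" .
qed simp

lemma packing_summable_iff:
  assumes abc: "0 \<le> a" "a \<le> b" "b \<le> c" "0 < b" and Q: "BM_packing_within a b c Q"
  shows "(\<lambda>(p, r). r powr t) summable_on {(p, r). r > 0 \<and> ball p r \<in> Q}
    \<longleftrightarrow> (\<lambda>v. dotq v (gap a b c) powr (- t)) summable_on all_disks"
proof -
  obtain F where F: "bij_betw F all_disks {(p, r). r > 0 \<and> ball p r \<in> Q}"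
    "\<And>v. v \<in> all_disks \<Longrightarrow> snd (F v) = 1 / dotq v (gap a b c)"
    using packing_within_bij[OF abc Q] by blast
  have "(\<lambda>(p, r). r powr t) summable_on {(p, r). r > 0 \<and> ball p r \<in> Q}
      \<longleftrightarrow> (\<lambda>v. (case F v of (p, r) \<Rightarrow> r powr t)) summable_on all_disks"
    by (rule summable_on_reindex_bij_betw[OF F(1), symmetric])
  also have "\<dots> \<longleftrightarrow> (\<lambda>v. dotq v (gap a b c) powr (- t)) summable_on all_disks"
  proof (rule summable_on_cong)
    fix v assume v: "v \<in> all_disks"
    have "0 < dotq v (gap a b c)" using dotq_gap_ge[OF abc v] abc by linarith
    then show "(case F v of (p, r) \<Rightarrow> r powr t) = dotq v (gap a b c) powr (- t)"
      by (simp add: case_prod_unfold F(2)[OF v] powr_divide powr_minus divide_simps)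
  qed
  finally show ?thesis .
qed

theorem theorem2p2:
  fixes a b c \<kappa> mu lam S :: real and m :: nat and Q :: "complex set set"
  assumes "0 \<le> a" and "a \<le> b" and "b \<le> c" and "b > 0"
    and "BM_packing_within a b c Q" and "S = critical_exponent Q"
    and "\<kappa> > 0"
    and "mu > 1/2" and "f_fun m \<kappa> 0 1 1 mu = 1"
    and "lam > 1/2" and "g_fun m \<kappa> 0 1 1 lam = 1"
  shows "lam \<le> S \<and> S \<le> mu \<and>
    (1 < \<kappa> \<and> \<kappa> \<le> (3 + 2 * sqrt 2) ^ (m + 1) \<longrightarrow>
       0 < mu - lam \<and> mu - lam < 2.3 / ln \<kappa>)"
proof -
  note abc = assms(1-4)
  define X where "X = {t. (\<lambda>v. dotq v (gap a b c) powr (- t)) summable_on all_disks}"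
  have S: "S = Inf X"
    unfolding assms(6) critical_exponent_def packing_summable_iff[OF abc assms(5)] X_def ..
  have pos: "t \<in> X \<longleftrightarrow> total t (gap 0 1 1) < \<infinity>" if "0 \<le> t" for t
    unfolding X_def mem_Collect_eq summable_iff_total_finite by (rule total_gap_finite_iff[OF that abc])
  have upper: "t \<in> X" if "mu < t" for t
    using pos[of t] total_finite[OF assms(8,9) that] that assms(8) by simp
  have lower: "lam \<le> t" if "t \<in> X" for t
  proof (cases "0 < t")
    case True
    then show ?thesis using total_finite_imp_ge[OF assms(11) True] pos[of t] that by simp
  next
    case False
    \<comment> \<open>Summability at some t \<le> 0 would pass up to the positive exponent lam/2,
      where the lower bound yields lam \<le> lam/2, a contradiction. This also makes the set bounded
      below, as \<open>Inf\<close> requires.\<close>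
    then have "lam / 2 \<in> X"
      using that summable_mono_exponent[OF abc, of t "lam / 2"] assms(10) by (simp add: X_def)
    then show ?thesis
      using total_finite_imp_ge[OF assms(11), of "lam / 2"] pos[of "lam / 2"] assms(10) by simp
  qed
  have "X \<noteq> {}" using upper[of "mu + 1"] by auto
  then have "lam \<le> S" unfolding S using lower by (rule cInf_greatest)
  moreover have "S \<le> mu"
  proof (rule dense_ge)
    fix t assume "mu < t"
    then show "S \<le> t" unfolding S using upper lower by (intro cInf_lower bdd_belowI) auto
  qed
  moreover have "0 < mu - lam \<and> mu - lam < 2.3 / ln \<kappa>" if "1 < \<kappa> \<and> \<kappa> \<le> (3 + 2 * sqrt 2) ^ (m + 1)"
    using exponent_gap[of \<kappa> m mu lam] that assms(8-11) by blast
  ultimately show ?thesis by blast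
qed

end
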